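(* Let $N\in\mathbb{N}$, $T>0$, let $a_2,a_{1,1},\dots,a_{1,N},a_0\in C([0,T];\mathbb{C})$ and consider $$P(t,D_x,D_t)=D_t-a_2(t)\Delta_x+\sum_{j=1}^N a_{1,j}(t)D_{x_j}+a_0(t)$$ and the Cauchy problem (CP): $Pu(t,x)=f(t,x)$, $u(0,x)=g(x)$, $t\in[0,T]$, $x\in\mathbb{T}^N$. (a) If there is $\delta\ge0$ such that (CP) is well-posed in $H^r$ with loss of $\delta$ derivatives, then (CP) is well-posed in $C^\infty$. (b) If (CP) is well-posed in $C^\infty$, then it is also well-posed in $G^s$ for every $s\ge1$. (c) Suppose $s_1,s_2\in\mathbb{R}$ satisfy $1\le s_2\le s_1$. If (CP) is well-posed in $G^{s_1}$, then it is well-posed in $G^{s_2}$.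
   Context: $\mathbb{T}^N=\mathbb{R}^N/2\pi\mathbb{Z}^N$, $D_t=\frac1i\partial_t$, $D_{x_j}=\frac1i\partial_{x_j}$, $\Delta_x=\sum_j\partial_{x_j}^2$. Spaces. For a distribution $u$ on $\mathbb{T}^N$ its Fourier coefficients are $\widehat u(\xi)=\langle u,e^{-ix\xi}\rangle$, $\xi\in\mathbb{Z}^N$, normalized so that $u=\sum_\xi\widehat u(\xi)e^{ix\xi}$. For $r\in\mathbb{R}$, $H^r(\mathbb{T}^N)$ is the set of distributions with $\|u\|_{H^r}^2=\sum_{\xi}|\widehat u(\xi)|^2(1+|\xi|)^{2r}<\infty$. $C^\infty(\mathbb{T}^N)=\bigcap_r H^r(\mathbb{T}^N)$ carries the projective limit topology. For $s\ge1$, $G^s(\mathbb{T}^N)$ is the set of $f\in C^\infty(\mathbb{T}^N)$ for which there are $C,h>0$ with $|D^\alpha f(x)|\le Ch^{|\alpha|}|\alpha|!^s$ for all multi-indices $\alpha$ and all $x$. With $\|f\|_{h,s}=\sup_\alpha \|D^\alpha f\|_\infty/(h^{|\alpha|}|\alpha|!^s)$ and $G^s_h(\mathbb{T}^N)=\{f:\|f\|_{h,s}<\infty\}$, $G^s(\mathbb{T}^N)$ carries the (locally convex) inductive limit topology of the Banach spaces $G^s_h(\mathbb{T}^N)$, $h\to\infty$. $C([0,T];X)$ denotes the continuous maps $[0,T]\to X$. Solutions. $u\in C([0,T];H^\rho(\mathbb{T}^N))$ (some $\rho\in\mathbb{R}$) solves (CP) if $u(0)=g$ and $Pu=f$ holds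 with $D_tu$ understood as the weak derivative in $t$ on $(0,T)$: $\langle D_tu,\varphi\rangle=\int_0^T u(t)(-D_t\varphi(t))\,dt$ for $\varphi\in C_c^\infty((0,T))$. Well-posedness. Given $\delta\ge0$, (CP) is well-posed in $H^r$ with loss of $\delta$ derivatives if for every $r\in\mathbb{R}$, $f\in C([0,T];H^r(\mathbb{T}^N))$ and $g\in H^r(\mathbb{T}^N)$ there is a unique solution $u\in C([0,T];H^{r-\delta}(\mathbb{T}^N))$. It is well-posed in $C^\infty$ (resp. in $G^s$, for a fixed $s\ge1$) if for every $f\in C([0,T];X)$ and $g\in X$ there is a unique solution $u\in C([0,T];X)$, where $X=C^\infty(\mathbb{T}^N)$ (resp. $X=G^s(\mathbb{T}^N)$). *)

theory Defs
  imports "HOL-Analysis.Analysis"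
begin

text \<open>
  The torus $R^N / 2 \pi Z^N$, with $N$ = \<^term>\<open>CARD('n)\<close>, is handled through
  $2 \pi$-periodic functions on \<^typ>\<open>real ^ 'n\<close>.
\<close>

section \<open>Smooth functions on the torus\<close>

definition pd :: "'n::finite \<Rightarrow> (real ^ 'n \<Rightarrow> complex) \<Rightarrow> real ^ 'n \<Rightarrow> complex" where
  "pd j f = (\<lambda>x. frechet_derivative f (at x) (axis j 1))"

definition pds :: "'n::finite list \<Rightarrow> (real ^ 'n \<Rightarrow> complex) \<Rightarrow> real ^ 'n \<Rightarrow> complex" where
  "pds js f = foldr pd js f"

definition smooth_torus :: "(real ^ 'n::finite \<Rightarrow> complex) set" where
  "smooth_torus = {f. (\<forall>js x. pds js f differentiable (at x)) \<and>
                      (\<forall>x j. f (x + axis j (2 * pi)) = f x)}"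

definition mdeg :: "('n::finite \<Rightarrow> nat) \<Rightarrow> nat" where
  "mdeg \<alpha> = (\<Sum>j\<in>UNIV. \<alpha> j)"

text \<open>
  $D^\alpha$ with $D = \partial / i$.  The index type carries no order, so some order of the
  coordinates is chosen; on \<^term>\<open>smooth_torus\<close> the choice is irrelevant because partial
  derivatives commute.
\<close>

definition mderiv :: "('n::finite \<Rightarrow> nat) \<Rightarrow> (real ^ 'n \<Rightarrow> complex) \<Rightarrow> real ^ 'n \<Rightarrow> complex" where
  "mderiv \<alpha> f = (\<lambda>x. (1 / \<i>) ^ mdeg \<alpha> * pds (SOME js. \<forall>j. count_list js j = \<alpha> j) f x)"

definition Ck_norm :: "nat \<Rightarrow> (real ^ 'n::finite \<Rightarrow> complex) \<Rightarrow> real" where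
  "Ck_norm k f = Sup {cmod (mderiv \<alpha> f x) | \<alpha> x. mdeg \<alpha> \<le> k}"


section \<open>Distributions on the torus\<close>

type_synonym 'n functional = "(real ^ 'n \<Rightarrow> complex) \<Rightarrow> complex"

text \<open>
  Continuous linear functionals on \<^term>\<open>smooth_torus\<close>.  They are set to 0 on all other functions,
  so that equality of distributions is equality of HOL functions.
\<close>

definition distributions :: "'n::finite functional set" where
  "distributions = {u.
     (\<forall>\<phi>\<in>smooth_torus. \<forall>\<psi>\<in>smooth_torus. \<forall>a b.
        u (\<lambda>x. a * \<phi> x + b * \<psi> x) = a * u \<phi> + b * u \<psi>) \<and>
     (\<exists>k C. \<forall>\<phi>\<in>smooth_torus. cmod (u \<phi>) \<le> C * Ck_norm k \<phi>) \<and>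
     (\<forall>\<phi>. \<phi> \<notin> smooth_torus \<longrightarrow> u \<phi> = 0)}"

definition freq :: "int ^ 'n \<Rightarrow> real ^ 'n::finite" where
  "freq \<xi> = (\<chi> j. of_int (\<xi> $ j))"

definition fourier_coeff :: "'n::finite functional \<Rightarrow> int ^ 'n \<Rightarrow> complex" where
  "fourier_coeff u \<xi> = u (\<lambda>x. exp (- \<i> * of_real (x \<bullet> freq \<xi>)))"

text \<open>
  The embedding of functions into distributions.  The factor $(2 \pi)^{-N}$ is the normalization
  for which a function is the sum of its Fourier series with coefficients \<^const>\<open>fourier_coeff\<close>.
\<close>

definition distr_of :: "(real ^ 'n::finite \<Rightarrow> complex) \<Rightarrow> 'n functional" where
  "distr_of F = (\<lambda>\<phi>. if \<phi> \<in> smooth_torus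
     then integral (cbox 0 (\<chi> j. 2 * pi)) (\<lambda>x. F x * \<phi> x) / of_real ((2 * pi) ^ CARD('n))
     else 0)"

definition distr_pd :: "'n::finite \<Rightarrow> 'n functional \<Rightarrow> 'n functional" where
  "distr_pd j u = (\<lambda>\<phi>. if \<phi> \<in> smooth_torus then - u (pd j \<phi>) else 0)"

definition distr_D :: "'n::finite \<Rightarrow> 'n functional \<Rightarrow> 'n functional" where
  "distr_D j u = (\<lambda>\<phi>. (1 / \<i>) * distr_pd j u \<phi>)"

definition distr_laplace :: "'n::finite functional \<Rightarrow> 'n functional" where
  "distr_laplace u = (\<lambda>\<phi>. \<Sum>j\<in>UNIV. distr_pd j (distr_pd j u) \<phi>)"


section \<open>Sobolev spaces and smooth functions\<close>

definition sob_weight :: "real \<Rightarrow> 'n::finite functional \<Rightarrow> int ^ 'n \<Rightarrow> real" where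
  "sob_weight r u \<xi> = (cmod (fourier_coeff u \<xi>))\<^sup>2 * (1 + norm (freq \<xi>)) powr (2 * r)"

definition sob :: "real \<Rightarrow> 'n::finite functional set" where
  "sob r = {u \<in> distributions. sob_weight r u summable_on UNIV}"

definition sob_norm :: "real \<Rightarrow> 'n::finite functional \<Rightarrow> real" where
  "sob_norm r u = sqrt (\<Sum>\<^sub>\<infinity>\<xi>. sob_weight r u \<xi>)"

definition sob_top :: "real \<Rightarrow> 'n::finite functional topology" where
  "sob_top r = Metric_space.mtopology (sob r) (\<lambda>u v. sob_norm r (u - v))"

definition Cinf :: "'n::finite functional set" where
  "Cinf = (\<Inter>r. sob r)"

text \<open>The projective limit topology: the coarsest one making all inclusions into \<^term>\<open>sob r\<close> continuous.\<close>

definition Cinf_top :: "'n::finite functional topology" where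
  "Cinf_top = topology_generated_by {U \<inter> Cinf | U r. openin (sob_top r) U}"


section \<open>Gevrey spaces\<close>

text \<open>The smooth function represented by an element of \<^const>\<open>Cinf\<close>.\<close>

definition fun_of :: "'n::finite functional \<Rightarrow> real ^ 'n \<Rightarrow> complex" where
  "fun_of u = (THE F. F \<in> smooth_torus \<and> distr_of F = u)"

definition gevrey :: "real \<Rightarrow> 'n::finite functional set" where
  "gevrey s = {u \<in> Cinf. \<exists>C>0. \<exists>h>0. \<forall>\<alpha> x.
     cmod (mderiv \<alpha> (fun_of u) x) \<le> C * h ^ mdeg \<alpha> * fact (mdeg \<alpha>) powr s}"

definition gevrey_norm :: "real \<Rightarrow> real \<Rightarrow> 'n::finite functional \<Rightarrow> ennreal" where
  "gevrey_norm h s u = (SUP \<alpha>. SUP x.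
     ennreal (cmod (mderiv \<alpha> (fun_of u) x) / (h ^ mdeg \<alpha> * fact (mdeg \<alpha>) powr s)))"

definition gevrey_h :: "real \<Rightarrow> real \<Rightarrow> 'n::finite functional set" where
  "gevrey_h h s = {u \<in> Cinf. gevrey_norm h s u < \<infinity>}"

definition abs_convex :: "'n::finite functional set \<Rightarrow> bool" where
  "abs_convex V \<longleftrightarrow> (\<forall>u\<in>V. \<forall>v\<in>V. \<forall>a b.
     cmod a + cmod b \<le> 1 \<longrightarrow> (\<lambda>\<phi>. a * u \<phi> + b * v \<phi>) \<in> V)"

text \<open>
  The basic neighbourhoods of 0 in the locally convex inductive limit: absolutely convex sets that
  meet every step \<^term>\<open>gevrey_h h s\<close> in a neighbourhood of 0 of that Banach space.
\<close>

definition gevrey_nhds0 :: "real \<Rightarrow> 'n::finite functional set set" where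
  "gevrey_nhds0 s = {V. V \<subseteq> gevrey s \<and> abs_convex V \<and>
     (\<forall>h>0. \<exists>\<epsilon>>0. {u \<in> gevrey_h h s. gevrey_norm h s u < ennreal \<epsilon>} \<subseteq> V)}"

definition gevrey_open :: "real \<Rightarrow> 'n::finite functional set \<Rightarrow> bool" where
  "gevrey_open s U \<longleftrightarrow> U \<subseteq> gevrey s \<and>
     (\<forall>u\<in>U. \<exists>V\<in>gevrey_nhds0 s. {v \<in> gevrey s. v - u \<in> V} \<subseteq> U)"

definition gevrey_top :: "real \<Rightarrow> 'n::finite functional topology" where
  "gevrey_top s = topology (gevrey_open s)"

lemma gevrey_nhds0_Int:
  fixes V W :: "'n::finite functional set"
  assumes "V \<in> gevrey_nhds0 s" "W \<in> gevrey_nhds0 s"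
  shows "V \<inter> W \<in> gevrey_nhds0 s"
proof -
  have "\<exists>\<epsilon>>0. {u \<in> gevrey_h h s. gevrey_norm h s u < ennreal \<epsilon>} \<subseteq> V \<inter> W" if h: "h > 0" for h
  proof -
    obtain a where a: "a > 0" "{u \<in> gevrey_h h s. gevrey_norm h s u < ennreal a} \<subseteq> V"
      using assms(1) h unfolding gevrey_nhds0_def by auto
    obtain b where b: "b > 0" "{u \<in> gevrey_h h s. gevrey_norm h s u < ennreal b} \<subseteq> W"
      using assms(2) h unfolding gevrey_nhds0_def by auto
    have "gevrey_norm h s u < ennreal a \<and> gevrey_norm h s u < ennreal b"
      if "gevrey_norm h s u < ennreal (min a b)" for u :: "'n functional"
      using less_le_trans[OF that ennreal_leI[OF min.cobounded1]]
        less_le_trans[OF that ennreal_leI[OF min.cobounded2]] by simp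
    then have "{u \<in> gevrey_h h s. gevrey_norm h s u < ennreal (min a b)} \<subseteq> V \<inter> W"
      using a b by blast
    then show ?thesis
      using a(1) b(1) by (intro exI[of _ "min a b"]) simp
  qed
  then show ?thesis
    using assms unfolding gevrey_nhds0_def abs_convex_def by simp blast
qed

lemma istopology_gevrey_open: "istopology (gevrey_open s :: 'n::finite functional set \<Rightarrow> bool)"
  unfolding istopology_def
proof (intro conjI allI impI)
  fix S T :: "'n functional set"
  assume S: "gevrey_open s S" and T: "gevrey_open s T"
  have "\<exists>V\<in>gevrey_nhds0 s. {v \<in> gevrey s. v - u \<in> V} \<subseteq> S \<inter> T" if u: "u \<in> S \<inter> T" for u
  proof -
    obtain V where V: "V \<in> gevrey_nhds0 s" "{v \<in> gevrey s. v - u \<in> V} \<subseteq> S"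
      using S u unfolding gevrey_open_def by auto
    obtain W where W: "W \<in> gevrey_nhds0 s" "{v \<in> gevrey s. v - u \<in> W} \<subseteq> T"
      using T u unfolding gevrey_open_def by auto
    show ?thesis
      using V(2) W(2) by (intro bexI[OF _ gevrey_nhds0_Int[OF V(1) W(1)]]) auto
  qed
  moreover have "S \<inter> T \<subseteq> gevrey s"
    using S unfolding gevrey_open_def by auto
  ultimately show "gevrey_open s (S \<inter> T)"
    unfolding gevrey_open_def by simp
next
  fix \<K> :: "'n functional set set"
  assume op: "\<forall>K\<in>\<K>. gevrey_open s K"
  have "\<exists>V\<in>gevrey_nhds0 s. {v \<in> gevrey s. v - u \<in> V} \<subseteq> \<Union>\<K>" if u: "u \<in> K" "K \<in> \<K>" for u K
  proof -
    obtain V where V: "V \<in> gevrey_nhds0 s" "{v \<in> gevrey s. v - u \<in> V} \<subseteq> K"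
      using bspec[OF op u(2)] u(1) unfolding gevrey_open_def by auto
    show ?thesis
      using V(2) \<open>K \<in> \<K>\<close> by (intro bexI[OF _ V(1)]) auto
  qed
  moreover have "\<Union>\<K> \<subseteq> gevrey s"
    using op unfolding gevrey_open_def by auto
  ultimately show "gevrey_open s (\<Union>\<K>)"
    unfolding gevrey_open_def by auto
qed


section \<open>The Cauchy problem\<close>

definition C_maps :: "real \<Rightarrow> 'a topology \<Rightarrow> (real \<Rightarrow> 'a) set" where
  "C_maps T X = {u. continuous_map (top_of_set {0..T}) X u}"

text \<open>Test functions in time; boundedness of the interval makes the closed support compact.\<close>

definition time_deriv :: "(real \<Rightarrow> complex) \<Rightarrow> real \<Rightarrow> complex" where
  "time_deriv \<phi> = (\<lambda>t. vector_derivative \<phi> (at t))"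

definition time_tests :: "real \<Rightarrow> (real \<Rightarrow> complex) set" where
  "time_tests T = {\<phi>. (\<forall>k t. (time_deriv ^^ k) \<phi> differentiable (at t)) \<and>
                      closure {t. \<phi> t \<noteq> 0} \<subseteq> {0<..<T}}"

text \<open>
  The distribution $\int_0^T w(t) \varphi(t)\, dt$ on the torus, as a weak integral.  For $w$
  continuous into some \<^term>\<open>sob r\<close> it agrees with the Riemann integral in \<^term>\<open>sob r\<close>.
\<close>

definition distr_integral ::
    "real \<Rightarrow> (real \<Rightarrow> 'n::finite functional) \<Rightarrow> (real \<Rightarrow> complex) \<Rightarrow> 'n functional" where
  "distr_integral T w \<phi> = (\<lambda>\<psi>. integral {0..T} (\<lambda>t. w t \<psi> * \<phi> t))"

text \<open>$- a_2(t) \Delta_x + \sum_j a_{1,j}(t) D_{x_j} + a_0(t)$\<close>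

definition spatial_op ::
    "(real \<Rightarrow> complex) \<Rightarrow> ('n::finite \<Rightarrow> real \<Rightarrow> complex) \<Rightarrow> (real \<Rightarrow> complex) \<Rightarrow>
     real \<Rightarrow> 'n functional \<Rightarrow> 'n functional" where
  "spatial_op a2 a1 a0 t u = (\<lambda>\<psi>. - a2 t * distr_laplace u \<psi>
      + (\<Sum>j\<in>UNIV. a1 j t * distr_D j u \<psi>) + a0 t * u \<psi>)"

definition solves_CP ::
    "real \<Rightarrow> (real \<Rightarrow> complex) \<Rightarrow> ('n::finite \<Rightarrow> real \<Rightarrow> complex) \<Rightarrow> (real \<Rightarrow> complex) \<Rightarrow>
     (real \<Rightarrow> 'n functional) \<Rightarrow> 'n functional \<Rightarrow> (real \<Rightarrow> 'n functional) \<Rightarrow> bool" where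
  "solves_CP T a2 a1 a0 f g u \<longleftrightarrow>
     (\<exists>\<rho>. u \<in> C_maps T (sob_top \<rho>)) \<and> u 0 = g \<and>
     (\<forall>\<phi>\<in>time_tests T. \<forall>\<psi>\<in>smooth_torus.
        distr_integral T u (\<lambda>t. - ((1 / \<i>) * time_deriv \<phi> t)) \<psi>
        + distr_integral T (\<lambda>t. spatial_op a2 a1 a0 t (u t)) \<phi> \<psi>
        = distr_integral T f \<phi> \<psi>)"

text \<open>
  Data in \<open>X\<close>, solutions in \<open>Y\<close>.  Elements of \<^term>\<open>C_maps T Y\<close> are total functions on
  \<^typ>\<open>real\<close>, so uniqueness is equality on \<^term>\<open>{0..T}\<close>.
\<close>

definition well_posed ::
    "real \<Rightarrow> (real \<Rightarrow> complex) \<Rightarrow> ('n::finite \<Rightarrow> real \<Rightarrow> complex) \<Rightarrow> (real \<Rightarrow> complex) \<Rightarrow>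
     'n functional topology \<Rightarrow> 'n functional topology \<Rightarrow> bool" where
  "well_posed T a2 a1 a0 X Y \<longleftrightarrow>
     (\<forall>f\<in>C_maps T X. \<forall>g\<in>topspace X.
        \<exists>u\<in>C_maps T Y. solves_CP T a2 a1 a0 f g u \<and>
          (\<forall>v\<in>C_maps T Y. solves_CP T a2 a1 a0 f g v \<longrightarrow> (\<forall>t\<in>{0..T}. v t = u t)))"

definition well_posed_sob where
  "well_posed_sob T a2 a1 a0 \<delta> \<longleftrightarrow>
     (\<forall>r. well_posed T a2 a1 a0 (sob_top r) (sob_top (r - \<delta>)))"

definition well_posed_Cinf where
  "well_posed_Cinf T a2 a1 a0 \<longleftrightarrow> well_posed T a2 a1 a0 Cinf_top Cinf_top"

definition well_posed_gevrey where
  "well_posed_gevrey T a2 a1 a0 s \<longleftrightarrow> well_posed T a2 a1 a0 (gevrey_top s) (gevrey_top s)"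

end

theory Submission
  imports Defs
begin

text \<open>
  Each Fourier coefficient of a solution satisfies a scalar linear ODE.  Applying the hypothesis to
  the data $\widehat g = e^{-a|\xi|^{1/s}}$ and $\widehat f$ of the same modulus, with a phase that
  cancels the oscillation in Duhamel's formula, shows that the propagator of the ODE grows at most
  like $e^{2a|\xi|^{1/s}}$ for every $a > 0$.  Since Gevrey data have coefficients that decay like
  $e^{-b|\xi|^{1/s}}$ uniformly in $t$ for some $b > 0$, taking $a$ small against $b$ shows that the
  solution which the hypothesis provides is again Gevrey of order $s$.  Uniqueness is inherited from
  the larger space, and it also identifies the Fourier coefficients of weak solutions with the
  Duhamel formula.  Part (a) only needs the inclusions between the Sobolev spaces.
\<close>

section \<open>Fourier modes and rapidly convergent Fourier series\<close>

text \<open>Well-posedness asserts existence and uniqueness but gives no estimate. The estimate is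
  not taken from a closed graph argument: the resonant data form one fixed pair, so the bare
  existence of a solution for them bounds the propagator at all frequencies at once. A solution is
  by definition a continuous curve in some Sobolev space, so its coefficients are known to grow at
  most polynomially; a second copy of the decay pays for that polynomial, which is why the exponent
  doubles. The space \<open>X\<close> of the hypothesis enters only by containing the Gevrey curves
  and data, so one argument serves (b) and (c). The obstacle is the inductive limit topology.
  Continuity of a curve has to be traded for two conditions on Fourier coefficients: one decay rate
  for the whole interval, and continuity of each single coefficient. That a continuous curve has
  such a rate needs enough continuous seminorms on the limit; conversely the two conditions give
  continuity into a single Banach step. As distributions are functionals on test functions, this
  dictionary rests on Fourier inversion for smooth functions.\<close>

definition jap :: "int ^ 'n::finite \<Rightarrow> real" where
  "jap \<xi> = 1 + norm (freq \<xi>)"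

definition fmode :: "int ^ 'n::finite \<Rightarrow> real ^ 'n \<Rightarrow> complex" where
  "fmode \<xi> x = exp (\<i> * of_real (x \<bullet> freq \<xi>))"

lemma freq_nth [simp]: "freq \<xi> $ j = of_int (\<xi> $ j)"
  by (simp add: freq_def)

lemma freq_uminus [simp]: "freq (- \<xi>) = - freq \<xi>"
  by (simp add: vec_eq_iff)

lemma freq_add: "freq (\<xi> + \<eta>) = freq \<xi> + freq \<eta>"
  by (simp add: vec_eq_iff)

lemma freq_0 [simp]: "freq 0 = 0"
  by (simp add: vec_eq_iff)

lemma jap_ge_1: "1 \<le> jap \<xi>"
  by (simp add: jap_def)

lemma jap_pos [simp]: "0 < jap \<xi>"
  using jap_ge_1[of \<xi>] by linarith

lemma jap_nonneg [simp]: "0 \<le> jap \<xi>"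
  using jap_pos[of \<xi>] by linarith

lemma jap_neq_0 [simp]: "jap \<xi> \<noteq> 0"
  using jap_pos[of \<xi>] by linarith

lemma norm_freq_le_jap: "norm (freq \<xi>) \<le> jap \<xi>"
  by (simp add: jap_def)

lemma jap_power_le: "jap \<xi> ^ m \<le> 2 ^ m * (1 + norm (freq \<xi>) ^ m)"
proof -
  have "jap \<xi> ^ m \<le> (2 * max 1 (norm (freq \<xi>))) ^ m"
    by (rule power_mono) (simp_all add: jap_def)
  also have "\<dots> = 2 ^ m * max 1 (norm (freq \<xi>)) ^ m"
    by (simp add: power_mult_distrib)
  also have "max 1 (norm (freq \<xi>)) ^ m \<le> 1 + norm (freq \<xi>) ^ m"
    by (simp add: max_def)
  finally show ?thesis by simp
qed

lemma abs_le_norm_freq: "\<bar>of_int (\<xi> $ j)\<bar> \<le> norm (freq \<xi>)"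
  using component_le_norm_cart[of "freq \<xi>" j] by simp

lemma norm_fmode [simp]: "cmod (fmode \<xi> x) = 1"
  by (simp add: fmode_def)

lemma fmode_add: "fmode (\<xi> + \<eta>) x = fmode \<xi> x * fmode \<eta> x"
  by (simp add: fmode_def freq_add inner_add_right distrib_left exp_add)

lemma fmode_0 [simp]: "fmode 0 x = 1"
  by (simp add: fmode_def)

lemma fmode_periodic: "fmode \<xi> (x + axis j (2 * pi)) = fmode \<xi> x"
proof -
  have "exp (\<i> * of_real (axis j (2 * pi) \<bullet> freq \<xi>)) = 1"
    by (auto simp: inner_axis' exp_eq_1 intro!: exI[of _ "\<xi> $ j"])
  then show ?thesis
    by (simp add: fmode_def inner_add_left distrib_left exp_add)
qed

section \<open>Summability over the integer lattice\<close>

lemma summable_on_int_inverse_square: "(\<lambda>k::int. 1 / (1 + (of_int k)\<^sup>2) :: real) summable_on UNIV"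
proof -
  have 1: "(\<lambda>n::nat. 1 / (1 + (of_nat n)\<^sup>2) :: real) summable_on UNIV"
  proof -
    have "summable (\<lambda>n::nat. 1 / (1 + (of_nat n)\<^sup>2) :: real)"
    proof (rule summable_comparison_test'[where N = 1])
      show "summable (\<lambda>n::nat. 1 / real n ^ 2)"
        using inverse_power_summable[of 2, where 'a = real] by (simp add: field_simps)
    next
      fix n :: nat assume "1 \<le> n"
      then show "norm (1 / (1 + (real n)\<^sup>2)) \<le> 1 / (real n)\<^sup>2"
        by (auto intro!: divide_left_mono simp: add_pos_nonneg)
    qed
    then show ?thesis
      by (intro norm_summable_imp_summable_on) simp
  qed
  have 2: "(\<lambda>k::int. 1 / (1 + (of_int k)\<^sup>2) :: real) summable_on (range int)"
    using 1 by (subst summable_on_reindex) (auto simp: o_def)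
  have 3: "(\<lambda>k::int. 1 / (1 + (of_int k)\<^sup>2) :: real) summable_on (range (\<lambda>n. - int n))"
    using 1 by (subst summable_on_reindex) (auto simp: o_def inj_def)
  \<comment> \<open>Both ranges contain 0, so one of them is trimmed to make the union
    disjoint.\<close>
  then have 4: "(\<lambda>k::int. 1 / (1 + (of_int k)\<^sup>2) :: real) summable_on (range (\<lambda>n. - int n) - range int)"
    by (rule summable_on_subset_banach) auto
  have "UNIV = range int \<union> (range (\<lambda>n. - int n) - range int)"
    by (auto simp: image_iff) (metis int_cases2)
  then show ?thesis
    using summable_on_Un_disjoint[OF 2 4] by simp
qed

text \<open>The square of \<open>jap \<xi>\<close> dominates \<open>1 + \<xi>_j^2\<close> for each
  coordinate \<open>j\<close>, so the power \<open>2 * CARD('n)\<close> dominates the product over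
  all coordinates. A finite set of frequencies lies in the product of its coordinate projections,
  over which the sum of products factorizes into one-dimensional sums.\<close>

lemma summable_on_jap: "(\<lambda>\<xi>::int ^ 'n::finite. 1 / jap \<xi> ^ (2 * CARD('n))) summable_on UNIV"
proof (rule nonneg_bounded_partial_sums_imp_summable_on)
  define s where "s = (\<Sum>\<^sub>\<infinity>k::int. 1 / (1 + (of_int k)\<^sup>2) :: real)"
  have "(\<Sum>\<xi>\<in>F. 1 / jap \<xi> ^ (2 * CARD('n))) \<le> s ^ CARD('n)"
    if F: "finite F" for F :: "(int ^ 'n) set"
  proof -
    define D where "D = (\<lambda>j::'n. (\<lambda>\<xi>. \<xi> $ j) ` F)"
    have fD: "finite (D j)" for j
      using F by (simp add: D_def)
    have "(\<Sum>\<xi>\<in>F. 1 / jap \<xi> ^ (2 * CARD('n))) \<le> (\<Sum>\<xi>\<in>F. \<Prod>j\<in>UNIV. 1 / (1 + (of_int (\<xi> $ j))\<^sup>2))"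
    proof (rule sum_mono)
      fix \<xi> assume "\<xi> \<in> F"
      have "(1 + (of_int (\<xi> $ j))\<^sup>2) \<le> (jap \<xi>)\<^sup>2" for j
      proof -
        have "(of_int (\<xi> $ j))\<^sup>2 \<le> (norm (freq \<xi>))\<^sup>2"
          using abs_le_norm_freq[of \<xi> j] by (metis abs_ge_zero power2_abs power_mono)
        then show ?thesis
          unfolding jap_def power2_sum by (simp add: add_increasing2)
      qed
      then have "(\<Prod>j\<in>UNIV. 1 + (of_int (\<xi> $ j))\<^sup>2) \<le> (\<Prod>j\<in>(UNIV::'n set). (jap \<xi>)\<^sup>2)"
        by (intro prod_mono) (auto simp: add_nonneg_nonneg)
      also have "\<dots> = jap \<xi> ^ (2 * CARD('n))"
        by (simp add: power_mult)
      finally show "1 / jap \<xi> ^ (2 * CARD('n)) \<le> (\<Prod>j\<in>UNIV. 1 / (1 + (of_int (\<xi> $ j))\<^sup>2))"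
        unfolding prod_dividef
        by (simp, intro divide_left_mono) (auto intro!: mult_pos_pos prod_pos simp: add_pos_nonneg)
    qed
    also have "\<dots> = (\<Sum>g\<in>(\<lambda>\<xi> j. \<xi> $ j) ` F. \<Prod>j\<in>UNIV. 1 / (1 + (of_int (g j))\<^sup>2))"
      by (subst sum.reindex) (auto simp: inj_on_def fun_eq_iff vec_eq_iff o_def)
    also have "\<dots> \<le> (\<Sum>g\<in>PiE UNIV D. \<Prod>j\<in>UNIV. 1 / (1 + (of_int (g j))\<^sup>2))"
      by (intro sum_mono2 finite_PiE fD)
         (auto simp: D_def PiE_iff intro!: prod_nonneg add_nonneg_nonneg)
    also have "\<dots> = (\<Prod>j\<in>UNIV. \<Sum>k\<in>D j. 1 / (1 + (of_int k)\<^sup>2))"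
      by (rule prod_sum_PiE[symmetric]) (auto simp: fD)
    also have "\<dots> \<le> (\<Prod>j\<in>(UNIV::'n set). s)"
      unfolding s_def
      by (intro prod_mono conjI finite_sum_le_infsum summable_on_int_inverse_square fD sum_nonneg) auto
    finally show ?thesis
      by simp
  qed
  then show "\<forall>\<^sub>F F in finite_subsets_at_top UNIV.
      (\<Sum>\<xi>::int ^ 'n\<in>F. 1 / jap \<xi> ^ (2 * CARD('n))) \<le> s ^ CARD('n)"
    by (intro eventually_finite_subsets_at_top_weakI) auto
qed auto

section \<open>Rapidly decreasing coefficients and termwise differentiation\<close>

definition rapid :: "(int ^ 'n::finite \<Rightarrow> complex) \<Rightarrow> bool" where
  "rapid c \<longleftrightarrow> (\<forall>m. \<exists>C. \<forall>\<xi>. cmod (c \<xi>) * jap \<xi> ^ m \<le> C)"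

definition fser :: "(int ^ 'n::finite \<Rightarrow> complex) \<Rightarrow> real ^ 'n \<Rightarrow> complex" where
  "fser c x = (\<Sum>\<^sub>\<infinity>\<xi>. c \<xi> * fmode \<xi> x)"

lemma summable_on_decay:
  fixes p :: "int ^ 'n::finite \<Rightarrow> real"
  assumes "\<And>\<xi>. 0 \<le> p \<xi>" "\<And>\<xi>. p \<xi> * jap \<xi> ^ (2 * CARD('n)) \<le> C"
  shows "p summable_on UNIV"
proof (rule summable_on_comparison_test[OF summable_on_cmult_right[OF summable_on_jap, of C]])
  fix \<xi> :: "int ^ 'n"
  show "p \<xi> \<le> C * (1 / jap \<xi> ^ (2 * CARD('n)))"
    using assms(2)[of \<xi>] by (simp add: pos_le_divide_eq)
qed (rule assms(1))

lemma rapid_summable: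
  fixes c :: "int ^ 'n::finite \<Rightarrow> complex"
  assumes "rapid c"
  shows "(\<lambda>\<xi>. cmod (c \<xi>) * jap \<xi> ^ m) summable_on UNIV"
proof -
  obtain C where "\<And>\<xi>. cmod (c \<xi>) * jap \<xi> ^ (m + 2 * CARD('n)) \<le> C"
    using assms unfolding rapid_def by blast
  then show ?thesis
    by (intro summable_on_decay[where C = C]) (auto simp: power_add mult.assoc)
qed

lemma rapid_summable0: "rapid c \<Longrightarrow> (\<lambda>\<xi>. cmod (c \<xi>)) summable_on UNIV"
  using rapid_summable[of c 0] by simp

lemma rapid_mult:
  assumes "rapid c" "\<And>\<xi>. cmod (p \<xi>) \<le> A * jap \<xi> ^ k"
  shows "rapid (\<lambda>\<xi>. p \<xi> * c \<xi>)"
  unfolding rapid_def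
proof
  fix m
  obtain C where C: "\<And>\<xi>. cmod (c \<xi>) * jap \<xi> ^ (k + m) \<le> C"
    using assms(1) unfolding rapid_def by blast
  have "cmod (p \<xi> * c \<xi>) * jap \<xi> ^ m \<le> \<bar>A\<bar> * C" for \<xi>
  proof -
    have "cmod (p \<xi> * c \<xi>) * jap \<xi> ^ m \<le> (A * jap \<xi> ^ k) * (cmod (c \<xi>) * jap \<xi> ^ m)"
      using mult_right_mono[OF assms(2)[of \<xi>], of "cmod (c \<xi>) * jap \<xi> ^ m"]
      by (simp add: norm_mult mult.assoc)
    also have "\<dots> = A * (cmod (c \<xi>) * jap \<xi> ^ (k + m))"
      by (simp add: power_add)
    also have "\<dots> \<le> \<bar>A\<bar> * C"
      by (rule mult_mono[OF abs_ge_self C]) auto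
    finally show ?thesis .
  qed
  then show "\<exists>C. \<forall>\<xi>. cmod (p \<xi> * c \<xi>) * jap \<xi> ^ m \<le> C"
    by blast
qed

lemma rapid_finite_support:
  assumes "finite {\<xi>. c \<xi> \<noteq> 0}"
  shows "rapid c"
  unfolding rapid_def
proof
  fix m
  define C where "C = (\<Sum>\<xi>\<in>{\<xi>. c \<xi> \<noteq> 0}. cmod (c \<xi>) * jap \<xi> ^ m)"
  have "cmod (c \<xi>) * jap \<xi> ^ m \<le> C" for \<xi>
  proof (cases "c \<xi> = 0")
    case True
    then show ?thesis by (auto simp: C_def intro!: sum_nonneg)
  next
    case False
    then show ?thesis
      unfolding C_def by (intro member_le_sum assms) auto
  qed
  then show "\<exists>C. \<forall>\<xi>. cmod (c \<xi>) * jap \<xi> ^ m \<le> C" by blast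
qed

lemma rapid_mono:
  assumes "rapid c" "\<And>\<xi>. cmod (d \<xi>) \<le> cmod (c \<xi>)"
  shows "rapid d"
  unfolding rapid_def
proof
  fix m
  obtain C where C: "\<And>\<xi>. cmod (c \<xi>) * jap \<xi> ^ m \<le> C"
    using assms(1) unfolding rapid_def by blast
  have "cmod (d \<xi>) * jap \<xi> ^ m \<le> C" for \<xi>
    by (rule order_trans[OF mult_right_mono[OF assms(2)] C]) simp
  then show "\<exists>C. \<forall>\<xi>. cmod (d \<xi>) * jap \<xi> ^ m \<le> C" by blast
qed

lemma has_sum_diff:
  fixes f g :: "'a \<Rightarrow> 'b::real_normed_vector"
  assumes "(f has_sum a) A" "(g has_sum b) A"
  shows "((\<lambda>x. f x - g x) has_sum (a - b)) A"
  using has_sum_add[OF assms(1), of "\<lambda>x. - g x" "- b"] assms(2) by (simp add: has_sum_uminus)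

lemma fser_has_sum: "rapid c \<Longrightarrow> ((\<lambda>\<xi>. c \<xi> * fmode \<xi> x) has_sum fser c x) UNIV"
  unfolding fser_def
  by (rule has_sum_infsum, rule abs_summable_summable) (simp add: norm_mult rapid_summable0)

lemma norm_fser_le: "rapid c \<Longrightarrow> cmod (fser c x) \<le> (\<Sum>\<^sub>\<infinity>\<xi>. cmod (c \<xi>))"
  by (rule norm_infsum_le[OF fser_has_sum has_sum_infsum[OF rapid_summable0]]) (auto simp: norm_mult)

lemma fser_periodic: "fser c (x + axis j (2 * pi)) = fser c x"
  by (simp add: fser_def fmode_periodic)

text \<open>The argument is purely imaginary, so the factor \<open>exp \<bar>Re z\<bar>\<close> in
  the complex Taylor bound is 1.\<close>

lemma norm_exp_remainder: "cmod (exp (\<i> * of_real a) - 1 - \<i> * of_real a) \<le> a\<^sup>2"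
proof -
  have "(\<Sum>k\<le>1. (\<i> * complex_of_real a) ^ k / fact k) = 1 + \<i> * of_real a"
    by (simp add: atMost_Suc)
  then show ?thesis
    using Taylor_exp[of "\<i> * of_real a" 1]
    by (simp only: diff_diff_eq) (simp add: norm_mult power2_eq_square)
qed

text \<open>Each term is linearized separately. Its remainder is at most
  \<open>norm (y - x)^2\<close> times \<open>cmod (c \<xi>) * jap \<xi>^2\<close>, and the latter is
  summable, so the total remainder is quadratic in \<open>y - x\<close>.\<close>

lemma fser_has_derivative:
  fixes c :: "int ^ 'n::finite \<Rightarrow> complex"
  assumes c: "rapid c"
  shows "(fser c has_derivative (\<lambda>h. \<Sum>\<^sub>\<infinity>\<xi>. \<i> * of_real (h \<bullet> freq \<xi>) * c \<xi> * fmode \<xi> x)) (at x)"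
proof -
  define D where "D h = (\<Sum>\<^sub>\<infinity>\<xi>. \<i> * of_real (h \<bullet> freq \<xi>) * c \<xi> * fmode \<xi> x)" for h
  define M where "M k = (\<Sum>\<^sub>\<infinity>\<xi>. cmod (c \<xi>) * jap \<xi> ^ k)" for k
  have bound: "\<bar>h \<bullet> freq \<xi>\<bar> \<le> norm h * jap \<xi>" for h and \<xi> :: "int ^ 'n"
    by (rule order_trans[OF Cauchy_Schwarz_ineq2]) (simp add: mult_left_mono norm_freq_le_jap)
  have nD: "cmod (\<i> * of_real (h \<bullet> freq \<xi>) * c \<xi> * fmode \<xi> x) \<le> norm h * (cmod (c \<xi>) * jap \<xi> ^ 1)" for h \<xi>
    using mult_right_mono[OF bound[of h \<xi>], of "cmod (c \<xi>)"] by (simp add: norm_mult mult_ac)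
  have D: "((\<lambda>\<xi>. \<i> * of_real (h \<bullet> freq \<xi>) * c \<xi> * fmode \<xi> x) has_sum D h) UNIV" for h
    unfolding D_def
    by (rule has_sum_infsum, rule abs_summable_summable,
        rule summable_on_comparison_test[OF summable_on_cmult_right[OF rapid_summable[OF c, of 1], of "norm h"]])
       (rule nD norm_ge_zero)+
  have bl: "bounded_linear D"
  proof
    fix h k
    show "D (h + k) = D h + D k"
      using has_sum_add[OF D[of h] D[of k]] D[of "h + k"]
      by (intro has_sum_unique) (auto simp: inner_add_left algebra_simps)
  next
    fix r :: real and h
    show "D (r *\<^sub>R h) = r *\<^sub>R D h"
      using has_sum_cmult_right[OF D[of h], of "of_real r"] D[of "r *\<^sub>R h"]
      by (intro has_sum_unique) (auto simp: mult_ac scaleR_conv_of_real[of r "D h"])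
  next
    show "\<exists>K. \<forall>h. norm (D h) \<le> norm h * K"
    proof (intro exI allI)
      fix h
      show "norm (D h) \<le> norm h * M 1"
        unfolding M_def
        by (rule norm_infsum_le[OF D has_sum_cmult_right[OF has_sum_infsum[OF rapid_summable[OF c]]]]) (rule nD)
    qed
  qed
  have rem: "cmod (fser c y - fser c x - D (y - x)) \<le> (norm (y - x))\<^sup>2 * M 2" for y
  proof -
    let ?a = "\<lambda>\<xi>. (y - x) \<bullet> freq \<xi>"
    have sum: "((\<lambda>\<xi>. c \<xi> * fmode \<xi> y - c \<xi> * fmode \<xi> x - \<i> * of_real (?a \<xi>) * c \<xi> * fmode \<xi> x)
        has_sum (fser c y - fser c x - D (y - x))) UNIV"
      by (intro has_sum_diff fser_has_sum c D)
    show ?thesis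
      unfolding M_def
    proof (rule norm_infsum_le[OF sum has_sum_cmult_right[OF has_sum_infsum[OF rapid_summable[OF c]]]])
      fix \<xi>
      have "fmode \<xi> y = fmode \<xi> x * exp (\<i> * of_real (?a \<xi>))"
        by (simp add: fmode_def flip: exp_add) (simp add: algebra_simps)
      then have "c \<xi> * fmode \<xi> y - c \<xi> * fmode \<xi> x - \<i> * of_real (?a \<xi>) * c \<xi> * fmode \<xi> x
          = c \<xi> * fmode \<xi> x * (exp (\<i> * of_real (?a \<xi>)) - 1 - \<i> * of_real (?a \<xi>))"
        by (simp add: algebra_simps)
      then have "norm (c \<xi> * fmode \<xi> y - c \<xi> * fmode \<xi> x - \<i> * of_real (?a \<xi>) * c \<xi> * fmode \<xi> x)
          \<le> cmod (c \<xi>) * (?a \<xi>)\<^sup>2"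
        using norm_exp_remainder[of "?a \<xi>"] by (simp add: norm_mult mult_left_mono)
      also have "\<dots> \<le> cmod (c \<xi>) * (norm (y - x) * jap \<xi>)\<^sup>2"
        using bound[of "y - x" \<xi>] by (intro mult_left_mono) (metis abs_ge_zero power2_abs power_mono, simp)
      finally show "norm (c \<xi> * fmode \<xi> y - c \<xi> * fmode \<xi> x - \<i> * of_real (?a \<xi>) * c \<xi> * fmode \<xi> x)
          \<le> (norm (y - x))\<^sup>2 * (cmod (c \<xi>) * (jap \<xi>)\<^sup>2)"
        by (simp add: power_mult_distrib mult_ac)
    qed
  qed
  have "(fser c has_derivative D) (at x)"
  proof (rule has_derivativeI_sandwich[where e = 1 and H = "\<lambda>y. norm (y - x) * M 2"])
    show "norm (fser c y - fser c x - D (y - x)) / norm (y - x) \<le> norm (y - x) * M 2" if "y \<noteq> x" for y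
      using rem[of y] that by (simp add: pos_divide_le_eq power2_eq_square mult_ac)
    show "((\<lambda>y. norm (y - x) * M 2) \<longlongrightarrow> 0) (at x)"
      by (auto intro!: tendsto_eq_intros)
  qed (use bl in auto)
  then show ?thesis
    by (simp add: D_def[abs_def])
qed

lemma pd_fser:
  assumes "rapid c"
  shows "pd j (fser c) = fser (\<lambda>\<xi>. \<i> * of_int (\<xi> $ j) * c \<xi>)"
proof
  fix x
  show "pd j (fser c) x = fser (\<lambda>\<xi>. \<i> * of_int (\<xi> $ j) * c \<xi>) x"
    by (simp add: pd_def fser_def inner_axis' flip: frechet_derivative_at[OF fser_has_derivative[OF assms, of x]])
qed

lemma rapid_deriv: "rapid c \<Longrightarrow> rapid (\<lambda>\<xi>. \<i> * of_int (\<xi> $ j) * c \<xi>)"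
  using order_trans[OF abs_le_norm_freq norm_freq_le_jap]
  by (intro rapid_mult[where A = 1 and k = 1]) (auto simp: norm_mult)

lemma fser_differentiable: "rapid c \<Longrightarrow> fser c differentiable (at x)"
  using fser_has_derivative differentiableI by blast

lemma fser_continuous_on: "rapid c \<Longrightarrow> continuous_on S (fser c)"
  by (intro continuous_at_imp_continuous_on ballI differentiable_imp_continuous_within fser_differentiable)

text \<open>The Fourier multiplier of \<open>pds js\<close>.\<close>

definition symb :: "'n::finite list \<Rightarrow> int ^ 'n \<Rightarrow> complex" where
  "symb js \<xi> = (\<Prod>j\<leftarrow>js. \<i> * of_int (\<xi> $ j))"

lemma norm_symb_le: "cmod (symb js \<xi>) \<le> norm (freq \<xi>) ^ length js"
proof (induction js)
  case (Cons j js)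
  then show ?case
    using abs_le_norm_freq[of \<xi> j] by (auto simp: symb_def norm_mult intro!: mult_mono)
qed (simp add: symb_def)

lemma rapid_symb:
  assumes "rapid c"
  shows "rapid (\<lambda>\<xi>. symb js \<xi> * c \<xi>)"
  by (rule rapid_mult[OF assms, where A = 1 and k = "length js"])
     (simp add: order_trans[OF norm_symb_le] power_mono norm_freq_le_jap)

lemma pds_fser:
  assumes "rapid c"
  shows "pds js (fser c) = fser (\<lambda>\<xi>. symb js \<xi> * c \<xi>)"
proof (induction js)
  case Nil
  then show ?case by (simp add: pds_def symb_def)
next
  case (Cons j js)
  have "pds (j # js) (fser c) = pd j (fser (\<lambda>\<xi>. symb js \<xi> * c \<xi>))"
    using Cons by (simp add: pds_def)
  then show ?case
    unfolding pd_fser[OF rapid_symb[OF assms]] by (simp add: symb_def mult.assoc)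
qed

lemma fser_smooth: "rapid c \<Longrightarrow> fser c \<in> smooth_torus"
  by (simp add: smooth_torus_def pds_fser rapid_symb fser_differentiable fser_periodic)

lemma fser_finite:
  assumes "finite S" "\<And>\<xi>. \<xi> \<notin> S \<Longrightarrow> c \<xi> = 0"
  shows "fser c x = (\<Sum>\<xi>\<in>S. c \<xi> * fmode \<xi> x)"
  unfolding fser_def using assms
  by (intro infsumI has_sum_finite_neutralI) auto

lemma rapid_single: "rapid (\<lambda>\<eta>. if \<eta> = \<xi> then a else 0)"
  by (rule rapid_finite_support) (auto intro: finite_subset[of _ "{\<xi>}"])

lemma fser_single: "fser (\<lambda>\<eta>. if \<eta> = \<xi> then a else 0) = (\<lambda>x. a * fmode \<xi> x)"
  by (rule ext, subst fser_finite[where S = "{\<xi>}"]) auto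

lemma fmode_eq_fser: "fmode \<xi> = fser (\<lambda>\<eta>. if \<eta> = \<xi> then 1 else 0)"
  by (simp add: fser_single)

lemma fmode_smooth [simp]: "fmode \<xi> \<in> smooth_torus"
  unfolding fmode_eq_fser by (intro fser_smooth rapid_single)

lemma pd_fmode: "pd j (fmode \<xi>) = (\<lambda>x. \<i> * of_int (\<xi> $ j) * fmode \<xi> x)"
proof -
  have "pd j (fmode \<xi>) = fser (\<lambda>\<eta>. if \<eta> = \<xi> then \<i> * of_int (\<xi> $ j) else 0)"
    unfolding fmode_eq_fser pd_fser[OF rapid_single] by (rule arg_cong[of _ _ fser]) auto
  then show ?thesis
    by (simp add: fser_single)
qed

lemma fourier_coeff_fmode: "fourier_coeff u \<xi> = u (fmode (- \<xi>))"
  by (simp add: fourier_coeff_def fmode_def[abs_def])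

section \<open>Fourier coefficients of smooth functions\<close>

abbreviation tbox :: "(real ^ 'n::finite) set" where
  "tbox \<equiv> cbox 0 (\<chi> j. 2 * pi)"

text \<open>The shifted box is cut at height \<open>2 * pi\<close> in direction \<open>j\<close>;
  the protruding slab is moved back by one period and fills the gap left at the bottom. As
  \<open>h\<close> is at most one period, there is just one such slab.\<close>

lemma integral_tbox_shift:
  fixes G :: "real ^ 'n::finite \<Rightarrow> complex"
  assumes G: "continuous_on UNIV G" and per: "\<And>x. G (x + axis j (2 * pi)) = G x"
    and h: "0 \<le> h" "h \<le> 2 * pi"
  shows "integral tbox (\<lambda>x. G (x + axis j h)) = integral tbox G"
proof -
  define top where "top = (\<chi> i::'n. 2 * pi)"
  \<comment> \<open>The upper corner of the slab of thickness \<open>h\<close> at the lower face of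
    the box, where the protruding slab ends up.\<close>
  define mid where "mid = (\<chi> i. if i = j then h else 2 * pi)"
  have int: "G integrable_on cbox a b" for a b
    by (rule integrable_continuous[OF continuous_on_subset[OF G]]) simp
  have ax: "axis j a $ i = (if i = j then a else 0)" for i and a :: real
    by (simp add: axis_def)
  have box: "x \<in> cbox a b \<longleftrightarrow> (a $ j \<le> x $ j \<and> x $ j \<le> b $ j) \<and> (\<forall>i. i \<noteq> j \<longrightarrow> a $ i \<le> x $ i \<and> x $ i \<le> b $ i)"
    for x a b :: "real ^ 'n"
    unfolding mem_box_cart by metis
  have "integral tbox (\<lambda>x. G (x + axis j h)) = integral (cbox (axis j h) (top + axis j h)) G"
    using integral_shift_cbox[of "axis j h" "axis j h" "top + axis j h" G] by (simp add: top_def)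
  also have "\<dots> = integral (cbox (axis j h) (top + axis j h) \<inter> {x. x \<bullet> axis j 1 \<le> 2 * pi}) G
      + integral (cbox (axis j h) (top + axis j h) \<inter> {x. x \<bullet> axis j 1 \<ge> 2 * pi}) G"
    by (rule integral_split[OF int]) (simp add: axis_in_Basis_iff)
  also have "cbox (axis j h) (top + axis j h) \<inter> {x. x \<bullet> axis j 1 \<le> 2 * pi} = cbox (axis j h) top"
    using h by (auto simp: set_eq_iff box inner_axis ax top_def)
  also have "cbox (axis j h) (top + axis j h) \<inter> {x. x \<bullet> axis j 1 \<ge> 2 * pi}
      = cbox (axis j (2 * pi)) (mid + axis j (2 * pi))"
    using h by (auto simp: set_eq_iff box inner_axis ax top_def mid_def)
  also have "integral (cbox (axis j (2 * pi)) (mid + axis j (2 * pi))) G = integral (cbox 0 mid) G"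
    using integral_shift_cbox[of "axis j (2 * pi)" "axis j (2 * pi)" "mid + axis j (2 * pi)" G]
    by (simp add: per)
  also have "cbox 0 mid = cbox 0 top \<inter> {x. x \<bullet> axis j 1 \<le> h}"
    using h by (auto simp: set_eq_iff box inner_axis ax top_def mid_def)
  also have "cbox (axis j h) top = cbox 0 top \<inter> {x. x \<bullet> axis j 1 \<ge> h}"
    using h by (auto simp: set_eq_iff box inner_axis ax top_def)
  also have "integral (cbox 0 top \<inter> {x. x \<bullet> axis j 1 \<ge> h}) G + integral (cbox 0 top \<inter> {x. x \<bullet> axis j 1 \<le> h}) G
      = integral (cbox 0 top) G"
    by (subst integral_split[OF int, of "axis j 1" _ _ h]) (simp_all add: axis_in_Basis_iff)
  finally show ?thesis
    by (simp add: top_def)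
qed

text \<open>By periodicity the integral of the translate of \<open>G\<close> by \<open>h\<close>
  along axis \<open>j\<close> is constant in \<open>h\<close>. Differentiating under the integral
  sign at \<open>h = 0\<close>, from the right, gives the integral of \<open>pd j G\<close>.\<close>

lemma integral_pd_eq_0:
  fixes G :: "real ^ 'n::finite \<Rightarrow> complex"
  assumes diff: "\<And>x. G differentiable (at x)" and cont: "continuous_on UNIV (pd j G)"
    and per: "\<And>x. G (x + axis j (2 * pi)) = G x"
  shows "integral tbox (pd j G) = 0"
proof -
  have G: "continuous_on UNIV G"
    by (intro continuous_at_imp_continuous_on ballI differentiable_imp_continuous_within diff)
  define e where "e = axis j (1::real)"
  have ax: "axis j h = h *\<^sub>R e" for h
    by (simp add: e_def vec_eq_iff axis_def)
  have "((\<lambda>h. integral tbox (\<lambda>x. G (x + axis j h))) has_vector_derivative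
      integral tbox (\<lambda>x. pd j G (x + axis j 0))) (at 0 within {0..2 * pi})"
  proof (rule leibniz_rule_vector_derivative)
    fix h x
    have "(G has_derivative frechet_derivative G (at (x + axis j h))) (at (x + axis j h))"
      using diff frechet_derivative_works by blast
    moreover have "((\<lambda>h. x + axis j h) has_derivative (\<lambda>k. axis j k)) (at h within {0..2 * pi})"
      unfolding ax by (auto intro!: derivative_eq_intros)
    ultimately have *: "((\<lambda>h. G (x + axis j h)) has_derivative
        (\<lambda>k. frechet_derivative G (at (x + axis j h)) (axis j k))) (at h within {0..2 * pi})"
      using has_derivative_compose[of "\<lambda>h. x + axis j h" "\<lambda>k. axis j k" h "{0..2 * pi}" G] by blast
    have "linear (frechet_derivative G (at (x + axis j h)))"
      by (rule linear_frechet_derivative[OF diff])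
    then show "((\<lambda>h. G (x + axis j h)) has_vector_derivative pd j G (x + axis j h)) (at h within {0..2 * pi})"
      using * unfolding has_vector_derivative_def pd_def ax by (simp add: linear_scale)
  next
    fix h
    show "(\<lambda>x. G (x + axis j h)) integrable_on tbox"
      by (intro integrable_continuous continuous_intros continuous_on_compose2[OF G]) auto
  next
    show "continuous_on ({0..2 * pi} \<times> tbox) (\<lambda>(h, x). pd j G (x + axis j h))"
      unfolding split_beta ax
      by (intro continuous_on_compose2[OF cont] continuous_intros) auto
  qed auto
  moreover have "((\<lambda>h. integral tbox (\<lambda>x. G (x + axis j h))) has_vector_derivative 0) (at 0 within {0..2 * pi})"
    by (rule has_vector_derivative_transform[OF _ _ has_vector_derivative_const])
       (auto simp: integral_tbox_shift[OF G per])
  ultimately have "integral tbox (\<lambda>x. pd j G (x + axis j 0)) = 0"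
    by (intro vector_derivative_unique_within_closed_interval[of 0 "2 * pi" 0]) (auto simp: cbox_interval)
  moreover have "axis j (0::real) = 0"
    by (simp add: vec_eq_iff axis_def)
  ultimately show ?thesis by simp
qed

lemma content_tbox: "measure lborel (tbox :: (real ^ 'n::finite) set) = (2 * pi) ^ CARD('n)"
proof -
  have "0 \<in> (tbox :: (real ^ 'n) set)"
    by (simp add: mem_box_cart)
  then have "(tbox :: (real ^ 'n) set) \<noteq> {}"
    by blast
  then show ?thesis
    by (simp add: content_cbox_cart)
qed

lemma fmode_continuous_on [continuous_intros]: "continuous_on S (fmode \<xi>)"
  unfolding fmode_def[abs_def] by (intro continuous_intros)

lemma smooth_torusD:
  assumes "\<phi> \<in> smooth_torus"
  shows "\<phi> differentiable (at x)" "\<phi> (x + axis j (2 * pi)) = \<phi> x" "continuous_on S \<phi>"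
proof -
  have "pds [] \<phi> differentiable (at x)" for x
    using assms unfolding smooth_torus_def by blast
  then show *: "\<phi> differentiable (at x)" for x
    by (simp add: pds_def)
  show "\<phi> (x + axis j (2 * pi)) = \<phi> x"
    using assms unfolding smooth_torus_def by blast
  show "continuous_on S \<phi>"
    by (intro continuous_at_imp_continuous_on ballI differentiable_imp_continuous_within *)
qed

lemma pd_smooth:
  fixes \<phi> :: "real ^ 'n::finite \<Rightarrow> complex"
  assumes "\<phi> \<in> smooth_torus"
  shows "pd j \<phi> \<in> smooth_torus"
  unfolding smooth_torus_def
proof (intro CollectI conjI allI)
  fix js x
  have "pds (js @ [j]) \<phi> differentiable (at x)"
    using assms unfolding smooth_torus_def by blast
  then show "pds js (pd j \<phi>) differentiable (at x)"
    by (simp add: pds_def)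
next
  fix x :: "real ^ 'n" and k :: 'n
  define p :: "real ^ 'n" where "p = axis k (2 * pi)"
  have "(\<phi> has_derivative frechet_derivative \<phi> (at (x + p))) (at (x + p))"
    using smooth_torusD(1)[OF assms] frechet_derivative_works by blast
  moreover have "((\<lambda>y. y + p) has_derivative (\<lambda>h. h)) (at x)"
    by (auto intro!: derivative_eq_intros)
  ultimately have "((\<lambda>y. \<phi> (y + p)) has_derivative frechet_derivative \<phi> (at (x + p))) (at x)"
    using has_derivative_compose[of "\<lambda>y. y + p" "\<lambda>h. h" x UNIV \<phi>] by blast
  then have "(\<phi> has_derivative frechet_derivative \<phi> (at (x + p))) (at x)"
    by (simp add: p_def smooth_torusD(2)[OF assms])
  from frechet_derivative_at[OF this]
  show "pd j \<phi> (x + axis k (2 * pi)) = pd j \<phi> x"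
    by (simp add: pd_def p_def)
qed

text \<open>A nonzero frequency has a nonzero component \<open>j\<close>, and the mode is then a
  multiple of its own \<open>pd j\<close>, whose integral vanishes.\<close>

lemma integral_tbox_fmode:
  "integral tbox (fmode \<zeta>) = (if \<zeta> = 0 then (2 * pi) ^ CARD('n::finite) else (0::complex))" for \<zeta> :: "int ^ 'n"
proof (cases "\<zeta> = 0")
  case True
  have "fmode \<zeta> = (\<lambda>x. 1)" using True by auto
  then show ?thesis
    using True by (simp add: content_tbox scaleR_conv_of_real)
next
  case False
  then obtain j where j: "\<zeta> $ j \<noteq> 0"
    by (auto simp: vec_eq_iff)
  have "integral tbox (pd j (fmode \<zeta>)) = 0"
    by (intro integral_pd_eq_0 smooth_torusD pd_smooth fmode_smooth)
  then show ?thesis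
    using j False by (simp add: pd_fmode)
qed

text \<open>The M-test along the filter of finite sets of frequencies gives uniform convergence on
  the box, so sum and integral may be exchanged.\<close>

lemma has_sum_integral_fser:
  fixes \<phi> :: "real ^ 'n::finite \<Rightarrow> complex"
  assumes c: "rapid c" and \<phi>: "continuous_on tbox \<phi>"
  shows "((\<lambda>\<xi>. c \<xi> * integral tbox (\<lambda>x. fmode \<xi> x * \<phi> x)) has_sum integral tbox (\<lambda>x. fser c x * \<phi> x)) UNIV"
proof -
  have "bounded (\<phi> ` tbox)"
    by (intro compact_imp_bounded compact_continuous_image \<phi> compact_cbox)
  then obtain B where B: "\<And>x. x \<in> tbox \<Longrightarrow> cmod (\<phi> x) \<le> B"
    unfolding bounded_iff by auto
  have ul: "uniform_limit tbox (\<lambda>X x. \<Sum>\<xi>\<in>X. c \<xi> * fmode \<xi> x * \<phi> x) (\<lambda>x. fser c x * \<phi> x) (finite_subsets_at_top UNIV)"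
  proof (rule Weierstrass_m_test_general')
    fix \<xi> :: "int ^ 'n" and x :: "real ^ 'n" assume "x \<in> tbox"
    then show "cmod (c \<xi> * fmode \<xi> x * \<phi> x) \<le> cmod (c \<xi>) * B"
      by (simp add: norm_mult mult_left_mono B)
  next
    fix x
    show "((\<lambda>\<xi>. c \<xi> * fmode \<xi> x * \<phi> x) has_sum fser c x * \<phi> x) UNIV"
      by (rule has_sum_cmult_left[OF fser_has_sum[OF c]])
  next
    show "(\<lambda>\<xi>. cmod (c \<xi>) * B) summable_on UNIV"
      by (rule summable_on_cmult_left[OF rapid_summable0[OF c]])
  qed
  obtain I J where I: "\<And>X. ((\<lambda>x. \<Sum>\<xi>\<in>X. c \<xi> * fmode \<xi> x * \<phi> x) has_integral I X) tbox"
    and J: "((\<lambda>x. fser c x * \<phi> x) has_integral J) tbox"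
    and lim: "(I \<longlongrightarrow> J) (finite_subsets_at_top UNIV)"
    by (rule uniform_limit_integral_cbox[OF ul]) (auto intro!: continuous_intros \<phi>)
  have "I X = (\<Sum>\<xi>\<in>X. c \<xi> * integral tbox (\<lambda>x. fmode \<xi> x * \<phi> x))" if "finite X" for X
  proof -
    have "I X = integral tbox (\<lambda>x. \<Sum>\<xi>\<in>X. c \<xi> * fmode \<xi> x * \<phi> x)"
      using I[of X] by (simp add: integral_unique)
    also have "\<dots> = (\<Sum>\<xi>\<in>X. integral tbox (\<lambda>x. c \<xi> * fmode \<xi> x * \<phi> x))"
      by (rule integral_sum[OF that]) (intro integrable_continuous continuous_intros \<phi>)
    finally show ?thesis
      by (simp add: mult.assoc)
  qed
  then have "((\<lambda>X. \<Sum>\<xi>\<in>X. c \<xi> * integral tbox (\<lambda>x. fmode \<xi> x * \<phi> x)) \<longlongrightarrow> J) (finite_subsets_at_top UNIV)"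
    by (intro Lim_transform_eventually[OF lim] eventually_finite_subsets_at_top_weakI) auto
  then show ?thesis
    using J by (simp add: has_sum_def integral_unique)
qed

abbreviation fc :: "(real ^ 'n::finite \<Rightarrow> complex) \<Rightarrow> int ^ 'n \<Rightarrow> complex" where
  "fc F \<equiv> fourier_coeff (distr_of F)"

lemma fc_eq: "fc F \<xi> = integral tbox (\<lambda>x. F x * fmode (- \<xi>) x) / of_real ((2 * pi) ^ CARD('n))"
  for F :: "real ^ 'n::finite \<Rightarrow> complex"
  by (simp add: fourier_coeff_fmode distr_of_def)

lemma fc_fser:
  assumes "rapid c"
  shows "fc (fser c) = c"
proof
  fix \<xi> :: "int ^ 'a"
  have *: "integral tbox (\<lambda>x. fmode \<eta> x * fmode (- \<xi>) x) = (if \<eta> = \<xi> then (2 * pi) ^ CARD('a) else (0::complex))" for \<eta>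
  proof -
    have "fmode (\<eta> - \<xi>) = (\<lambda>x. fmode \<eta> x * fmode (- \<xi>) x)"
      using fmode_add[of \<eta> "- \<xi>"] by auto
    then show ?thesis
      using integral_tbox_fmode[of "\<eta> - \<xi>"] by auto
  qed
  have "((\<lambda>\<eta>. c \<eta> * (if \<eta> = \<xi> then (2 * pi) ^ CARD('a) else (0::complex)))
      has_sum integral tbox (\<lambda>x. fser c x * fmode (- \<xi>) x)) UNIV"
    using has_sum_integral_fser[OF assms, of "fmode (- \<xi>)"] by (simp add: * continuous_intros)
  moreover have "((\<lambda>\<eta>. c \<eta> * (if \<eta> = \<xi> then (2 * pi) ^ CARD('a) else (0::complex)))
      has_sum (c \<xi> * (2 * pi) ^ CARD('a))) UNIV"
    by (rule has_sum_finite_neutralI[of "{\<xi>}"]) auto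
  ultimately have "integral tbox (\<lambda>x. fser c x * fmode (- \<xi>) x) = c \<xi> * (2 * pi) ^ CARD('a)"
    by (rule has_sum_unique)
  then show "fc (fser c) \<xi> = c \<xi>"
    by (simp add: fc_eq)
qed

section \<open>Integration by parts and decay of Fourier coefficients\<close>

lemma pd_mult:
  assumes "F differentiable (at x)" "G differentiable (at x)"
  shows "pd j (\<lambda>x. F x * G x) x = F x * pd j G x + pd j F x * G x"
proof -
  have "((\<lambda>x. F x * G x) has_derivative
      (\<lambda>h. F x * frechet_derivative G (at x) h + frechet_derivative F (at x) h * G x)) (at x)"
    using assms by (intro has_derivative_mult) (simp_all add: frechet_derivative_works)
  from frechet_derivative_at[OF this, symmetric] show ?thesis
    by (simp add: pd_def)
qed

text \<open>Integration by parts against the mode: the derivative of the product integrates to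
  0.\<close>

lemma fc_pd:
  assumes "\<phi> \<in> smooth_torus"
  shows "fc (pd j \<phi>) \<xi> = \<i> * of_int (\<xi> $ j) * fc \<phi> \<xi>"
proof -
  have pd: "pd j (\<lambda>x. \<phi> x * fmode (- \<xi>) x)
      = (\<lambda>x. pd j \<phi> x * fmode (- \<xi>) x - \<i> * of_int (\<xi> $ j) * (\<phi> x * fmode (- \<xi>) x))"
    by (rule ext, subst pd_mult) (auto simp: smooth_torusD(1) assms pd_fmode algebra_simps)
  have "integral tbox (pd j (\<lambda>x. \<phi> x * fmode (- \<xi>) x)) = 0"
  proof (rule integral_pd_eq_0)
    show "(\<lambda>x. \<phi> x * fmode (- \<xi>) x) differentiable (at x)" for x
      by (intro differentiable_mult smooth_torusD(1) assms fmode_smooth)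
    show "continuous_on UNIV (pd j (\<lambda>x. \<phi> x * fmode (- \<xi>) x))"
      unfolding pd
      by (intro continuous_intros smooth_torusD(3)[OF pd_smooth[OF assms]] smooth_torusD(3)[OF assms])
  qed (simp add: smooth_torusD(2)[OF assms] fmode_periodic)
  then have "integral tbox (\<lambda>x. pd j \<phi> x * fmode (- \<xi>) x)
      - integral tbox (\<lambda>x. \<i> * of_int (\<xi> $ j) * (\<phi> x * fmode (- \<xi>) x)) = 0"
    unfolding pd
    by (subst (asm) integral_diff)
       (auto intro!: integrable_continuous continuous_intros smooth_torusD(3)[OF pd_smooth[OF assms]]
          smooth_torusD(3)[OF assms])
  then show ?thesis
    by (simp add: fc_eq)
qed

lemma norm_fc_le:
  fixes F :: "real ^ 'n::finite \<Rightarrow> complex"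
  assumes F: "continuous_on tbox F" and M: "\<And>x. x \<in> tbox \<Longrightarrow> cmod (F x) \<le> M"
  shows "cmod (fc F \<xi>) \<le> M"
proof -
  have "0 \<in> (tbox :: (real ^ 'n) set)"
    by (simp add: mem_box_cart)
  then have "0 \<le> M" using M norm_ge_zero order_trans by blast
  have "cmod (integral tbox (\<lambda>x. F x * fmode (- \<xi>) x)) \<le> M * measure lborel (tbox :: (real ^ 'n) set)"
    by (rule has_integral_bound[OF \<open>0 \<le> M\<close> integrable_integral])
       (auto intro!: integrable_continuous continuous_intros F simp: norm_mult M)
  then show ?thesis
    by (simp add: content_tbox fc_eq norm_divide norm_mult norm_power pos_divide_le_eq)
qed

lemma smooth_bounded:
  fixes \<phi> :: "real ^ 'n::finite \<Rightarrow> complex"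
  assumes "\<phi> \<in> smooth_torus"
  obtains M where "\<And>x. x \<in> tbox \<Longrightarrow> cmod (\<phi> x) \<le> M"
proof -
  have "bounded (\<phi> ` tbox)"
    by (intro compact_imp_bounded compact_continuous_image smooth_torusD(3)[OF assms] compact_cbox)
  then show ?thesis
    using that unfolding bounded_iff by blast
qed

lemma pd_power_smooth: "\<phi> \<in> smooth_torus \<Longrightarrow> (pd j ^^ m) \<phi> \<in> smooth_torus"
  by (induction m) (simp_all add: pd_smooth)

lemma fc_pd_power: "\<phi> \<in> smooth_torus \<Longrightarrow> fc ((pd j ^^ m) \<phi>) \<xi> = (\<i> * of_int (\<xi> $ j)) ^ m * fc \<phi> \<xi>"
  by (induction m) (simp_all add: fc_pd pd_power_smooth)

text \<open>The l1 norm is at most \<open>CARD('n)\<close> times the largest component. This lets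
  pure derivatives in one direction control the full length of the frequency.\<close>

lemma norm_freq_le_component:
  fixes \<xi> :: "int ^ 'n::finite"
  obtains j where "norm (freq \<xi>) \<le> CARD('n) * \<bar>real_of_int (\<xi> $ j)\<bar>"
proof (rule ccontr)
  assume "\<not> thesis"
  then have *: "CARD('n) * \<bar>real_of_int (\<xi> $ j)\<bar> < norm (freq \<xi>)" for j
    using that by (meson not_le)
  have "norm (freq \<xi>) \<le> (\<Sum>j\<in>UNIV. \<bar>freq \<xi> $ j\<bar>)"
    by (rule norm_le_l1_cart)
  then have "CARD('n) * norm (freq \<xi>) \<le> (\<Sum>j\<in>(UNIV::'n set). CARD('n) * \<bar>real_of_int (\<xi> $ j)\<bar>)"
    by (subst sum_distrib_left[symmetric]) (simp add: mult_left_mono)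
  also have "\<dots> < (\<Sum>j\<in>(UNIV::'n set). norm (freq \<xi>))"
    by (rule sum_strict_mono) (use * in auto)
  finally show False by simp
qed

text \<open>At each frequency, \<open>m\<close> derivatives in the direction of a dominant component
  bound the coefficient times \<open>norm (freq \<xi>) ^ m\<close>. Together with
  \<open>fser_smooth\<close> and \<open>smooth_eq_fser\<close>, this makes \<open>rapid\<close> the
  exact description of smooth functions by their coefficients.\<close>

lemma rapid_fc:
  fixes \<phi> :: "real ^ 'n::finite \<Rightarrow> complex"
  assumes \<phi>: "\<phi> \<in> smooth_torus"
  shows "rapid (fc \<phi>)"
  unfolding rapid_def
proof
  fix m
  have ex: "\<exists>M. \<forall>x\<in>tbox. cmod ((pd j ^^ k) \<phi> x) \<le> M" for j k
    using smooth_bounded[OF pd_power_smooth[OF \<phi>]] by metis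
  define M where "M j k = (SOME M. \<forall>x\<in>tbox. cmod ((pd j ^^ k) \<phi> x) \<le> M)" for j k
  have M: "cmod ((pd j ^^ k) \<phi> x) \<le> M j k" if "x \<in> tbox" for j k x
    using someI_ex[OF ex] that unfolding M_def by blast
  define N where "N = real CARD('n)"
  \<comment> \<open>Summing over all directions makes the bound independent of which component
    dominates at a given frequency.\<close>
  define A where "A = (\<Sum>j\<in>UNIV. \<bar>M j 0\<bar> + N ^ m * \<bar>M j m\<bar>)"
  have bd: "\<bar>of_int (\<xi> $ j)\<bar> ^ k * cmod (fc \<phi> \<xi>) \<le> \<bar>M j k\<bar>" for j k \<xi>
  proof -
    have "cmod (fc ((pd j ^^ k) \<phi>) \<xi>) \<le> M j k"
      by (rule norm_fc_le) (auto intro: smooth_torusD(3) pd_power_smooth \<phi> M)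
    then show ?thesis
      by (simp add: fc_pd_power \<phi> norm_mult norm_power)
  qed
  have "cmod (fc \<phi> \<xi>) * jap \<xi> ^ m \<le> 2 ^ m * A" for \<xi>
  proof -
    obtain j where j: "norm (freq \<xi>) \<le> N * \<bar>of_int (\<xi> $ j)\<bar>"
      unfolding N_def by (rule norm_freq_le_component)
    note jap_power_le[of \<xi> m]
    also have "norm (freq \<xi>) ^ m \<le> (N * \<bar>of_int (\<xi> $ j)\<bar>) ^ m"
      by (rule power_mono[OF j]) simp
    finally have "jap \<xi> ^ m \<le> 2 ^ m * (1 + N ^ m * \<bar>of_int (\<xi> $ j)\<bar> ^ m)"
      by (simp add: power_mult_distrib)
    then have "cmod (fc \<phi> \<xi>) * jap \<xi> ^ m \<le> cmod (fc \<phi> \<xi>) * (2 ^ m * (1 + N ^ m * \<bar>of_int (\<xi> $ j)\<bar> ^ m))"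
      by (rule mult_left_mono) simp
    also have "\<dots> = 2 ^ m * (\<bar>of_int (\<xi> $ j)\<bar> ^ 0 * cmod (fc \<phi> \<xi>) + N ^ m * (\<bar>of_int (\<xi> $ j)\<bar> ^ m * cmod (fc \<phi> \<xi>)))"
      by (simp add: algebra_simps)
    also have "\<dots> \<le> 2 ^ m * (\<bar>M j 0\<bar> + N ^ m * \<bar>M j m\<bar>)"
      by (intro mult_left_mono add_mono bd) (auto simp: N_def)
    also have "\<dots> \<le> 2 ^ m * A"
      unfolding A_def by (intro mult_left_mono member_le_sum) (auto simp: N_def)
    finally show ?thesis .
  qed
  then show "\<exists>C. \<forall>\<xi>. cmod (fc \<phi> \<xi>) * jap \<xi> ^ m \<le> C" by blast
qed

section \<open>Fourier inversion\<close>

inductive trig_poly :: "(real ^ 'n::finite \<Rightarrow> complex) \<Rightarrow> bool" where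
  mode: "trig_poly (\<lambda>x. a * fmode \<xi> x)"
| add: "trig_poly f \<Longrightarrow> trig_poly g \<Longrightarrow> trig_poly (\<lambda>x. f x + g x)"

lemma trig_poly_mode_mult: "trig_poly f \<Longrightarrow> trig_poly (\<lambda>x. a * fmode \<xi> x * f x)"
proof (induction rule: trig_poly.induct)
  case (mode b \<eta>)
  have "(\<lambda>x. a * fmode \<xi> x * (b * fmode \<eta> x)) = (\<lambda>x. (a * b) * fmode (\<xi> + \<eta>) x)"
    by (auto simp: fmode_add)
  then show ?case
    by (simp only: trig_poly.mode)
next
  case (add f g)
  then show ?case
    using trig_poly.add[OF add.IH] by (simp only: distrib_left)
qed

lemma trig_poly_mult: "trig_poly f \<Longrightarrow> trig_poly g \<Longrightarrow> trig_poly (\<lambda>x. f x * g x)"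
proof (induction rule: trig_poly.induct)
  case (add f h)
  then show ?case
    using trig_poly.add[of "\<lambda>x. f x * g x" "\<lambda>x. h x * g x"] by (simp only: distrib_right)
qed (rule trig_poly_mode_mult)

lemma trig_poly_const: "trig_poly (\<lambda>x. a)"
  using trig_poly.mode[of a 0] by simp

lemma trig_poly_prod:
  "finite S \<Longrightarrow> (\<And>j. j \<in> S \<Longrightarrow> trig_poly (f j)) \<Longrightarrow> trig_poly (\<lambda>x. \<Prod>j\<in>S. f j x)"
  by (induction rule: finite_induct) (simp_all add: trig_poly_const trig_poly_mult)

lemma trig_poly_power: "trig_poly f \<Longrightarrow> trig_poly (\<lambda>x. f x ^ n)"
  by (induction n) (simp_all add: trig_poly_const trig_poly_mult)

lemma trig_poly_continuous: "trig_poly f \<Longrightarrow> continuous_on S f"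
  by (induction rule: trig_poly.induct) (intro continuous_intros | assumption)+

lemma integral_trig_poly_eq_0:
  fixes F :: "real ^ 'n::finite \<Rightarrow> complex"
  assumes "trig_poly f" and F: "continuous_on tbox F"
    and zero: "\<And>\<xi>. integral tbox (\<lambda>x. F x * fmode \<xi> x) = 0"
  shows "integral tbox (\<lambda>x. F x * f x) = 0"
  using assms(1)
proof (induction rule: trig_poly.induct)
  case (mode a \<xi>)
  have "(\<lambda>x. F x * (a * fmode \<xi> x)) = (\<lambda>x. a * (F x * fmode \<xi> x))"
    by auto
  then show ?case
    by (simp add: zero)
next
  case (add f g)
  have "integral tbox (\<lambda>x. F x * (f x + g x)) = integral tbox (\<lambda>x. F x * f x) + integral tbox (\<lambda>x. F x * g x)"
    unfolding distrib_left
    by (rule integral_add) (intro integrable_continuous continuous_intros F trig_poly_continuous add)+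
  then show ?case
    using add by simp
qed

text \<open>
  High powers of this trigonometric polynomial concentrate at \<open>x0\<close>, so a continuous function that is
  orthogonal to all of them vanishes at \<open>x0\<close>.
\<close>

definition peak :: "real ^ 'n::finite \<Rightarrow> real ^ 'n \<Rightarrow> real" where
  "peak x0 y = (\<Prod>j\<in>UNIV. (1 + cos (y $ j - x0 $ j)) / 2)"

lemma trig_poly_peak: "trig_poly (\<lambda>y. complex_of_real (peak x0 y))"
proof -
  have "trig_poly (\<lambda>y. complex_of_real ((1 + cos (y $ j - x0 $ j)) / 2))" for j
  proof -
    have "fmode (axis j 1) y = exp (\<i> * of_real (y $ j))" and "fmode (- axis j 1) y = exp (- (\<i> * of_real (y $ j)))" for y
    proof -
      have "freq (axis j 1) = axis j 1"
        by (simp add: vec_eq_iff axis_def)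
      then show "fmode (axis j 1) y = exp (\<i> * of_real (y $ j))" "fmode (- axis j 1) y = exp (- (\<i> * of_real (y $ j)))"
        by (simp_all add: fmode_def inner_axis)
    qed
    \<comment> \<open>Euler's formula; the shift by \<open>x\<close> moves into the two
      coefficients.\<close>
    moreover have "complex_of_real ((1 + cos (y - x)) / 2)
        = 1 / 2 + (exp (- (\<i> * of_real x)) / 4 * exp (\<i> * of_real y) + exp (\<i> * of_real x) / 4 * exp (- (\<i> * of_real y)))"
      for x y :: real
    proof -
      have "complex_of_real (cos (y - x)) = (exp (\<i> * of_real (y - x)) + exp (- (\<i> * of_real (y - x)))) / 2"
        by (simp add: cos_exp_eq flip: cos_of_real)
      moreover have "exp (\<i> * of_real (y - x)) = exp (- (\<i> * of_real x)) * exp (\<i> * of_real y)"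
        and "exp (- (\<i> * of_real (y - x))) = exp (\<i> * of_real x) * exp (- (\<i> * of_real y))"
        by (simp_all add: right_diff_distrib flip: exp_add)
      ultimately show ?thesis
        by (simp add: add_divide_distrib)
    qed
    ultimately have "complex_of_real ((1 + cos (y $ j - x0 $ j)) / 2)
        = 1 / 2 + (exp (- (\<i> * of_real (x0 $ j))) / 4 * fmode (axis j 1) y + exp (\<i> * of_real (x0 $ j)) / 4 * fmode (- axis j 1) y)" for y
      by simp
    then show ?thesis
      by (simp only:) (intro trig_poly.add trig_poly_const trig_poly.mode)
  qed
  then show ?thesis
    unfolding peak_def of_real_prod by (intro trig_poly_prod) auto
qed

lemma half_one_plus_cos:
  fixes a :: real
  shows "0 \<le> (1 + cos a) / 2" "(1 + cos a) / 2 \<le> 1"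
proof -
  show "0 \<le> (1 + cos a) / 2" using add_left_mono[OF cos_ge_minus_one[of a], of 1] by simp
  show "(1 + cos a) / 2 \<le> (1::real)" using add_left_mono[OF cos_le_one[of a], of 1] by simp
qed

lemma peak_nonneg: "0 \<le> peak x0 y"
  unfolding peak_def by (intro prod_nonneg ballI half_one_plus_cos)

lemma peak_self [simp]: "peak x0 x0 = 1"
  by (simp add: peak_def)

lemma peak_continuous [continuous_intros]: "continuous_on S (peak x0)"
  unfolding peak_def[abs_def] by (intro continuous_intros) auto

text \<open>With \<open>x0\<close> in the open box, no other point of the closed box is congruent to
  \<open>x0\<close> modulo periods: the coordinates differ by less than \<open>2 * pi\<close>, so
  the cosine is 1 only where they agree.\<close>

lemma peak_less_1:
  fixes x0 y :: "real ^ 'n::finite"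
  assumes "x0 \<in> box 0 (\<chi> j. 2 * pi)" "y \<in> tbox" "y \<noteq> x0"
  shows "peak x0 y < 1"
proof -
  obtain j where j: "y $ j \<noteq> x0 $ j"
    using assms(3) by (auto simp: vec_eq_iff)
  have "0 < x0 $ j" "x0 $ j < 2 * pi" "0 \<le> y $ j" "y $ j \<le> 2 * pi"
    using assms(1,2) by (simp_all add: mem_box_cart)
  then have bd: "\<bar>y $ j - x0 $ j\<bar> < 2 * pi"
    by linarith
  have "cos (y $ j - x0 $ j) \<noteq> 1"
  proof
    assume "cos (y $ j - x0 $ j) = 1"
    then obtain k :: int where k: "y $ j - x0 $ j = of_int k * 2 * pi"
      unfolding cos_one_2pi_int by blast
    then have "\<bar>real_of_int k\<bar> * (2 * pi) < 1 * (2 * pi)"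
      using bd by (simp add: abs_mult)
    then have "\<bar>real_of_int k\<bar> < 1"
      by (rule mult_right_less_imp_less) simp
    then have "k = 0" by linarith
    then show False
      using k j by simp
  qed
  then have lt: "cos (y $ j - x0 $ j) < 1"
    using cos_le_one[of "y $ j - x0 $ j"] by linarith
  have "peak x0 y = (1 + cos (y $ j - x0 $ j)) / 2 * (\<Prod>i\<in>UNIV - {j}. (1 + cos (y $ i - x0 $ i)) / 2)"
    unfolding peak_def by (rule prod.remove) auto
  moreover have "(\<Prod>i\<in>UNIV - {j}. (1 + cos (y $ i - x0 $ i)) / 2) \<le> 1"
    by (intro prod_le_1 conjI half_one_plus_cos)
  ultimately have "peak x0 y \<le> (1 + cos (y $ j - x0 $ j)) / 2"
    using mult_left_mono[OF _ half_one_plus_cos(1)] by fastforce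
  also have "\<dots> < 1"
    using lt by simp
  finally show ?thesis .
qed

section \<open>Vanishing of a function that is orthogonal to all modes\<close>

lemma periodic_shift_int:
  fixes F :: "real ^ 'n::finite \<Rightarrow> 'b"
  assumes "\<And>x. F (x + axis j p) = F x"
  shows "F (x + axis j (p * of_int k)) = F x"
proof -
  have ax: "axis j (a + b) = axis j a + axis j b" for a b :: real
    by (simp add: vec_eq_iff axis_def)
  have nat: "F (x + axis j (p * of_nat n)) = F x" for n x
  proof (induction n)
    case 0
    have "x + axis j (p * of_nat 0) = x" by (simp add: axis_def vec_eq_iff)
    then show ?case by (simp only:)
  next
    case (Suc n)
    have "F (x + axis j (p * of_nat (Suc n))) = F ((x + axis j (p * of_nat n)) + axis j p)"
      by (simp add: distrib_left ax add_ac)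
    then show ?case
      using Suc assms by simp
  qed
  show ?thesis
  proof (cases k)
    case (nonneg n)
    then show ?thesis using nat by simp
  next
    case (neg n)
    have "F (x + axis j (p * of_int k)) = F ((x + axis j (p * of_int k)) + axis j (p * of_nat (Suc n)))"
      by (simp only: nat)
    also have "axis j (p * of_int k) + axis j (p * of_nat (Suc n)) = 0"
      unfolding neg ax[symmetric] by (simp add: axis_def vec_eq_iff algebra_simps)
    then have "(x + axis j (p * of_int k)) + axis j (p * of_nat (Suc n)) = x"
      by (simp only: add.assoc) simp
    finally show ?thesis .
  qed
qed

lemma periodic_reduce:
  fixes F :: "real ^ 'n::finite \<Rightarrow> 'b"
  assumes per: "\<And>x j. F (x + axis j (2 * pi)) = F x"
  obtains y where "y \<in> tbox" "F y = F x"
proof -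
  define k where "k j = - \<lfloor>x $ j / (2 * pi)\<rfloor>" for j
  have "F (x + (\<Sum>j\<in>S. axis j (2 * pi * of_int (k j)))) = F x" if "finite S" for S
    using that
  proof (induction S)
    case (insert j S)
    have "F (x + (\<Sum>j\<in>insert j S. axis j (2 * pi * of_int (k j))))
        = F ((x + (\<Sum>j\<in>S. axis j (2 * pi * of_int (k j)))) + axis j (2 * pi * of_int (k j)))"
      using insert by (simp add: add_ac)
    then show ?case
      using insert periodic_shift_int[of F j, OF per] by simp
  qed simp
  then have "F (x + (\<Sum>j\<in>UNIV. axis j (2 * pi * of_int (k j)))) = F x"
    by simp
  moreover have "x + (\<Sum>j\<in>UNIV. axis j (2 * pi * of_int (k j))) \<in> tbox"
  proof -
    have "(x + (\<Sum>j\<in>UNIV. axis j (2 * pi * of_int (k j)))) $ i = 2 * pi * frac (x $ i / (2 * pi))" for i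
      by (simp add: axis_def sum.delta' k_def frac_def algebra_simps)
    moreover have "0 \<le> 2 * pi * frac a \<and> 2 * pi * frac a \<le> 2 * pi" for a :: real
      using frac_lt_1[of a] by (simp add: mult_left_le less_imp_le)
    ultimately show ?thesis
      by (simp add: mem_box_cart)
  qed
  ultimately show ?thesis
    using that by blast
qed

text \<open>If \<open>F x0\<close> were nonzero, then \<open>G\<close>, the real part of
  \<open>cnj (F x0) * F\<close>, would exceed half its value \<open>c\<close> at \<open>x0\<close>
  on a neighbourhood \<open>D\<close>. The integral of \<open>G\<close> against the
  \<open>n\<close>-th power of \<open>peak x0\<close> is 0. A small box around \<open>x0\<close>
  contributes at least a multiple of \<open>r ^ n\<close>, the complement of \<open>D\<close> at
  most a multiple of \<open>q ^ n\<close> in absolute value, and \<open>q < r\<close> is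
  contradictory for large \<open>n\<close>.\<close>

lemma peak_method:
  fixes F :: "real ^ 'n::finite \<Rightarrow> complex"
  assumes F: "continuous_on UNIV F"
    and zero: "\<And>\<xi>. integral tbox (\<lambda>x. F x * fmode \<xi> x) = 0"
    and x0: "x0 \<in> box 0 (\<chi> j. 2 * pi)"
  shows "F x0 = 0"
proof (rule ccontr)
  assume "F x0 \<noteq> 0"
  define G where "G y = Re (cnj (F x0) * F y)" for y
  have G: "continuous_on S G" for S
    unfolding G_def[abs_def] by (intro continuous_intros continuous_on_subset[OF F]) auto
  define c where "c = G x0"
  have c: "c > 0"
    using \<open>F x0 \<noteq> 0\<close> by (simp add: c_def G_def complex_neq_0 flip: power2_eq_square)
  define D where "D = box 0 (\<chi> j. 2 * pi) \<inter> {y. G y > c / 2}"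
  have D: "open D" "x0 \<in> D"
  proof -
    show "open D"
      unfolding D_def by (intro open_Int open_box open_Collect_less G continuous_on_const)
    show "x0 \<in> D"
      using x0 c by (simp add: D_def c_def)
  qed
  obtain q where q: "0 < q" "q < 1" "\<And>y. y \<in> tbox - D \<Longrightarrow> peak x0 y \<le> q"
  proof (cases "tbox - D = {}")
    case True
    then show ?thesis using that[of "1/2"] by auto
  next
    case False
    have "compact (tbox - D)"
      by (intro compact_diff D compact_cbox)
    then obtain z where z: "z \<in> tbox - D" "\<And>y. y \<in> tbox - D \<Longrightarrow> peak x0 y \<le> peak x0 z"
      using continuous_attains_sup[OF _ False peak_continuous] by blast
    have "peak x0 z < 1"
      using z(1) D(2) by (intro peak_less_1[OF x0]) auto
    then show ?thesis
      \<comment> \<open>The maximum with 1/2 keeps \<open>q\<close> positive, since the quotient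
        \<open>r / q\<close> is formed at the end.\<close>
      using z(2) by (intro that[of "max (1/2) (peak x0 z)"]) (auto simp: le_max_iff_disj)
  qed
  \<comment> \<open>Strictly between \<open>q\<close> and the peak value 1, so that
    \<open>peak x0\<close> exceeds \<open>r\<close> near \<open>x0\<close>.\<close>
  define r where "r = (1 + q) / 2"
  have r: "q < r" "r < 1" "0 < r"
    using q by (auto simp: r_def)
  have "open (D \<inter> {y. r < peak x0 y})"
    by (intro open_Int D open_Collect_less continuous_intros)
  moreover have "x0 \<in> D \<inter> {y. r < peak x0 y}"
    using D r by simp
  ultimately obtain a b where ab: "cbox a b \<subseteq> D \<inter> {y. r < peak x0 y}" "\<forall>i\<in>Basis. a \<bullet> i < b \<bullet> i"
    by (rule open_contains_cbox) auto
  have sub: "cbox a b \<subseteq> tbox"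
    using ab(1) box_subset_cbox unfolding D_def by blast
  define V where "V = measure lborel (cbox a b)"
  have V: "V > 0"
    unfolding V_def by (rule content_pos_lt[OF ab(2)])
  have "bounded (G ` tbox)"
    by (intro compact_imp_bounded compact_continuous_image G compact_cbox)
  then obtain M where M: "M > 0" "\<And>y. y \<in> tbox \<Longrightarrow> \<bar>G y\<bar> \<le> M"
    unfolding bounded_pos by auto
  have main: "c / 2 * r ^ n * V \<le> M * q ^ n * (2 * pi) ^ CARD('n)" for n
  proof -
    have I0: "integral tbox (\<lambda>y. F y * complex_of_real (peak x0 y ^ n)) = 0"
      unfolding of_real_power
      by (rule integral_trig_poly_eq_0[OF trig_poly_power[OF trig_poly_peak] continuous_on_subset[OF F] zero]) simp
    have "(\<lambda>y. F y * complex_of_real (peak x0 y ^ n)) integrable_on tbox"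
      by (intro integrable_continuous continuous_intros continuous_on_subset[OF F]) auto
    from integrable_integral[OF this]
    have "((\<lambda>y. F y * complex_of_real (peak x0 y ^ n)) has_integral 0) tbox"
      by (simp only: I0)
    from has_integral_linear[OF has_integral_mult_right[OF this, of "cnj (F x0)"] bounded_linear_Re]
    have "((\<lambda>y. Re (cnj (F x0) * (F y * complex_of_real (peak x0 y ^ n)))) has_integral 0) tbox"
      by (simp only: o_def mult_zero_right zero_complex.simps)
    moreover have "Re (a * (b * complex_of_real t)) = Re (a * b) * t" for a b t
      by (simp add: algebra_simps)
    ultimately have GQ: "((\<lambda>y. G y * peak x0 y ^ n) has_integral 0) tbox"
      by (simp only: G_def)
    have "((\<lambda>y. if y \<in> cbox a b then c / 2 * r ^ n else 0) has_integral (V * (c / 2 * r ^ n))) tbox"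
      unfolding has_integral_restrict[OF sub]
      using has_integral_const[of "c / 2 * r ^ n" a b] by (simp add: V_def)
    moreover have "((\<lambda>y::real ^ 'n. M * q ^ n) has_integral ((2 * pi) ^ CARD('n) * (M * q ^ n))) tbox"
      using has_integral_const[of "M * q ^ n" 0 "\<chi> j::'n. 2 * pi"] by (simp add: content_tbox)
    ultimately have "((\<lambda>y. (if y \<in> cbox a b then c / 2 * r ^ n else 0) - M * q ^ n) has_integral
        (V * (c / 2 * r ^ n) - (2 * pi) ^ CARD('n) * (M * q ^ n))) tbox"
      by (rule has_integral_diff)
    then have "V * (c / 2 * r ^ n) - (2 * pi) ^ CARD('n) * (M * q ^ n) \<le> 0"
    proof (rule has_integral_le[OF _ GQ])
      fix y :: "real ^ 'n" assume y: "y \<in> tbox"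
      have Mq: "0 \<le> M * q ^ n"
        using M(1) q by simp
      \<comment> \<open>Small box: \<open>G\<close> and \<open>peak x0\<close> are both large. Rest
        of \<open>D\<close>: the product is nonnegative. Outside \<open>D\<close>:
        \<open>peak x0\<close> is at most \<open>q\<close>.\<close>
      consider "y \<in> cbox a b" | "y \<in> D" "y \<notin> cbox a b" | "y \<notin> D" "y \<notin> cbox a b"
        using ab(1) by blast
      then show "(if y \<in> cbox a b then c / 2 * r ^ n else 0) - M * q ^ n \<le> G y * peak x0 y ^ n"
      proof cases
        case 1
        then have "c / 2 \<le> G y" "r \<le> peak x0 y"
          using ab(1) by (auto simp: D_def subset_iff)
        then have "c / 2 * r ^ n \<le> G y * peak x0 y ^ n"
          using c r by (intro mult_mono power_mono) auto
        then show ?thesis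
          using 1 Mq by simp
      next
        case 2
        then have "0 \<le> G y"
          using c by (simp add: D_def)
        then have "0 \<le> G y * peak x0 y ^ n"
          by (simp add: peak_nonneg)
        then show ?thesis
          using 2 Mq by simp
      next
        case 3
        have "peak x0 y ^ n \<le> q ^ n"
          using 3 y q(3)[of y] by (intro power_mono peak_nonneg) auto
        then have "\<bar>G y\<bar> * peak x0 y ^ n \<le> M * q ^ n"
          using M(2)[OF y] M(1) by (intro mult_mono) (simp_all add: peak_nonneg)
        then have "\<bar>G y * peak x0 y ^ n\<bar> \<le> M * q ^ n"
          by (simp add: abs_mult peak_nonneg)
        then show ?thesis
          using 3 by (simp add: abs_le_iff)
      qed
    qed
    then show ?thesis by (simp add: algebra_simps)
  qed
  define K where "K = 2 * M * (2 * pi) ^ CARD('n) / (c * V)"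
  obtain n where n: "K < (r / q) ^ n"
    using real_arch_pow[of "r / q" K] r q by auto
  have "(r / q) ^ n \<le> K"
    using main[of n] c V q by (simp add: K_def power_divide field_simps)
  then show False using n by simp
qed

text \<open>\<open>peak_method\<close> covers the open box only; continuity extends the zero set to
  the closed box and periodicity to the whole space.\<close>

lemma fourier_unique:
  fixes F :: "real ^ 'n::finite \<Rightarrow> complex"
  assumes F: "continuous_on UNIV F" and per: "\<And>x j. F (x + axis j (2 * pi)) = F x"
    and zero: "\<And>\<xi>. integral tbox (\<lambda>x. F x * fmode \<xi> x) = 0"
  shows "F x = 0"
proof -
  obtain y where y: "y \<in> tbox" "F y = F x"
    using periodic_reduce[OF per] .
  have "(\<chi> j. pi) \<in> box 0 (\<chi> j::'n. 2 * pi)"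
    by (simp add: mem_box_cart)
  then have cl: "closure (box 0 (\<chi> j::'n. 2 * pi)) = tbox"
    by (intro closure_box) blast
  have "F y = 0"
    by (rule continuous_constant_on_closure[where S = "box 0 (\<chi> j::'n. 2 * pi)"])
       (use F zero y in \<open>auto simp: cl intro: peak_method continuous_on_subset\<close>)
  then show ?thesis using y by simp
qed

lemma smooth_eq_fser:
  fixes \<phi> :: "real ^ 'n::finite \<Rightarrow> complex"
  assumes \<phi>: "\<phi> \<in> smooth_torus"
  shows "fser (fc \<phi>) = \<phi>"
proof
  fix x
  note [continuous_intros] = smooth_torusD(3)[OF \<phi>] fser_continuous_on[OF rapid_fc[OF \<phi>]]
  have "(\<lambda>x. fser (fc \<phi>) x - \<phi> x) x = 0"
  proof (rule fourier_unique)
    fix \<xi> :: "int ^ 'n"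
    have "integral tbox (\<lambda>x. (fser (fc \<phi>) x - \<phi> x) * fmode \<xi> x)
        = integral tbox (\<lambda>x. fser (fc \<phi>) x * fmode \<xi> x) - integral tbox (\<lambda>x. \<phi> x * fmode \<xi> x)"
      unfolding left_diff_distrib by (intro integral_diff integrable_continuous continuous_intros)
    also have "\<dots> = 0"
      using fun_cong[OF fc_fser[OF rapid_fc[OF \<phi>]], of "- \<xi>"] by (simp add: fc_eq)
    finally show "integral tbox (\<lambda>x. (fser (fc \<phi>) x - \<phi> x) * fmode \<xi> x) = 0" .
  qed (auto intro!: continuous_intros simp: fser_periodic smooth_torusD(2)[OF \<phi>])
  then show "fser (fc \<phi>) x = \<phi> x" by simp
qed

section \<open>Fourier series of distributions\<close>

text \<open>Justifies the choice of an order of the coordinates in \<open>mderiv\<close>.\<close>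

lemma ex_count_list: "\<exists>js. \<forall>j. count_list js j = \<alpha> j" for \<alpha> :: "'n::finite \<Rightarrow> nat"
proof -
  obtain xs :: "'n list" where xs: "set xs = UNIV" "distinct xs"
    using finite_distinct_list[of "UNIV :: 'n set"] by (auto simp del: finite_class.finite_UNIV simp: finite)
  have "\<exists>js. \<forall>j. count_list js j = (if j \<in> set ys then \<alpha> j else 0)" if "distinct ys" for ys
    using that
  proof (induction ys)
    case Nil
    show ?case by (intro exI[of _ "[]"]) simp
  next
    case (Cons i ys)
    then obtain js where js: "\<And>j. count_list js j = (if j \<in> set ys then \<alpha> j else 0)"
      by auto
    have "count_list (replicate m i) j = (if j = i then m else 0)" for m j
      by (induction m) auto
    then show ?case
      using Cons.prems by (intro exI[of _ "replicate (\<alpha> i) i @ js"]) (auto simp: js)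
  qed
  from this[OF xs(2)] show ?thesis
    by (simp add: xs(1))
qed

lemma mderiv_fser:
  assumes "rapid c"
  obtains js where "\<And>j. count_list js j = \<alpha> j" "length js = mdeg \<alpha>"
    "mderiv \<alpha> (fser c) = (\<lambda>x. (1 / \<i>) ^ mdeg \<alpha> * fser (\<lambda>\<xi>. symb js \<xi> * c \<xi>) x)"
proof -
  define js where "js = (SOME js. \<forall>j. count_list js j = \<alpha> j)"
  have js: "\<And>j. count_list js j = \<alpha> j"
    using someI_ex[OF ex_count_list[of \<alpha>]] unfolding js_def by blast
  have "length js = mdeg \<alpha>"
    using sum_count_set[of js UNIV] by (simp add: mdeg_def js)
  then show ?thesis
    using that[OF js] unfolding mderiv_def js_def[symmetric] pds_fser[OF assms] by blast
qed

lemma rapid_summable_norm_freq: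
  assumes "rapid c"
  shows "(\<lambda>\<xi>. cmod (c \<xi>) * norm (freq \<xi>) ^ m) summable_on UNIV"
  by (rule summable_on_comparison_test[OF rapid_summable[OF assms, of m]])
     (auto intro!: mult_left_mono power_mono norm_freq_le_jap)

lemma norm_mderiv_fser_le:
  assumes c: "rapid c"
  shows "cmod (mderiv \<alpha> (fser c) x) \<le> (\<Sum>\<^sub>\<infinity>\<xi>. cmod (c \<xi>) * norm (freq \<xi>) ^ mdeg \<alpha>)"
proof -
  obtain js where js: "length js = mdeg \<alpha>"
    "mderiv \<alpha> (fser c) = (\<lambda>x. (1 / \<i>) ^ mdeg \<alpha> * fser (\<lambda>\<xi>. symb js \<xi> * c \<xi>) x)"
    using mderiv_fser[OF c] by metis
  have "cmod (mderiv \<alpha> (fser c) x) \<le> (\<Sum>\<^sub>\<infinity>\<xi>. cmod (symb js \<xi> * c \<xi>))"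
    using norm_fser_le[OF rapid_symb[OF c]] by (simp add: js(2) norm_mult norm_power norm_divide)
  also have "\<dots> \<le> (\<Sum>\<^sub>\<infinity>\<xi>. cmod (c \<xi>) * norm (freq \<xi>) ^ mdeg \<alpha>)"
    using rapid_summable0[OF rapid_symb[OF c]] rapid_summable_norm_freq[OF c] norm_symb_le[of js]
    by (intro infsum_mono) (auto simp: norm_mult js(1) mult.commute[of "cmod (c _)"] intro!: mult_right_mono)
  finally show ?thesis .
qed

lemma norm_mderiv_fser_le_jap:
  fixes c :: "int ^ 'n::finite \<Rightarrow> complex"
  assumes c: "rapid c" and "mdeg \<alpha> \<le> k"
  shows "cmod (mderiv \<alpha> (fser c) x) \<le> (\<Sum>\<^sub>\<infinity>\<xi>. cmod (c \<xi>) * jap \<xi> ^ k)"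
proof (rule order_trans[OF norm_mderiv_fser_le[OF c]], rule infsum_mono)
  fix \<xi> :: "int ^ 'n"
  have "norm (freq \<xi>) ^ mdeg \<alpha> \<le> jap \<xi> ^ mdeg \<alpha>"
    by (intro power_mono norm_freq_le_jap) simp
  also have "\<dots> \<le> jap \<xi> ^ k"
    by (intro power_increasing assms(2) jap_ge_1)
  finally show "cmod (c \<xi>) * norm (freq \<xi>) ^ mdeg \<alpha> \<le> cmod (c \<xi>) * jap \<xi> ^ k"
    by (rule mult_left_mono) simp
qed (intro rapid_summable_norm_freq rapid_summable c)+

lemma mdeg_0 [simp]: "mdeg (\<lambda>_. 0) = 0"
  by (simp add: mdeg_def)

lemma mderiv_values_nonempty: "{cmod (mderiv \<alpha> \<phi> x) |\<alpha> x. mdeg \<alpha> \<le> k} \<noteq> {}"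
proof -
  have "cmod (mderiv (\<lambda>_. 0) \<phi> 0) \<in> {cmod (mderiv \<alpha> \<phi> x) |\<alpha> x. mdeg \<alpha> \<le> k}"
    by (intro CollectI exI[of _ "\<lambda>_. 0"] exI[of _ 0]) simp
  then show ?thesis by blast
qed

lemma Ck_norm_fser_le:
  assumes c: "rapid c"
  shows "Ck_norm k (fser c) \<le> (\<Sum>\<^sub>\<infinity>\<xi>. cmod (c \<xi>) * jap \<xi> ^ k)"
  unfolding Ck_norm_def
  by (rule cSup_least[OF mderiv_values_nonempty]) (auto intro: norm_mderiv_fser_le_jap[OF c])

text \<open>\<open>Ck_norm\<close> is a supremum of real numbers, so it is an upper bound only once
  the set of values is known to be bounded. The Fourier series of \<open>\<phi>\<close> supplies the
  bound.\<close>

lemma mderiv_le_Ck_norm: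
  assumes \<phi>: "\<phi> \<in> smooth_torus" and "mdeg \<alpha> \<le> k"
  shows "cmod (mderiv \<alpha> \<phi> x) \<le> Ck_norm k \<phi>"
  unfolding Ck_norm_def
proof (rule cSup_upper)
  show "bdd_above {cmod (mderiv \<alpha> \<phi> x) |\<alpha> x. mdeg \<alpha> \<le> k}"
    using norm_mderiv_fser_le_jap[OF rapid_fc[OF \<phi>]]
    by (intro bdd_aboveI[where M = "\<Sum>\<^sub>\<infinity>\<xi>. cmod (fc \<phi> \<xi>) * jap \<xi> ^ k"]) (auto simp: smooth_eq_fser[OF \<phi>])
qed (use assms(2) in blast)

lemma mderiv_0: "mderiv (\<lambda>_. 0) \<phi> = \<phi>"
proof -
  have "(\<forall>j. count_list js j = 0) \<longleftrightarrow> js = []" for js :: "'a list"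
    by (cases js) auto
  then show ?thesis
    by (simp add: mderiv_def pds_def)
qed

lemma norm_le_Ck_norm:
  assumes "\<phi> \<in> smooth_torus"
  shows "cmod (\<phi> x) \<le> Ck_norm k \<phi>"
  using mderiv_le_Ck_norm[OF assms, of "\<lambda>_. 0"] by (simp add: mderiv_0)

lemma Ck_norm_nonneg: "\<phi> \<in> smooth_torus \<Longrightarrow> 0 \<le> Ck_norm k \<phi>"
  using norm_le_Ck_norm norm_ge_zero order_trans by blast

lemma Ck_norm_mono:
  assumes "\<phi> \<in> smooth_torus" "k \<le> m"
  shows "Ck_norm k \<phi> \<le> Ck_norm m \<phi>"
  unfolding Ck_norm_def[of k]
  by (rule cSup_least[OF mderiv_values_nonempty])
     (use assms(2) in \<open>auto intro: mderiv_le_Ck_norm[OF assms(1)]\<close>)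

section \<open>Distributions as sums over their Fourier coefficients\<close>

lemma distributions_lincomb:
  assumes "u \<in> distributions" "\<phi> \<in> smooth_torus" "\<psi> \<in> smooth_torus"
  shows "u (\<lambda>x. a * \<phi> x + b * \<psi> x) = a * u \<phi> + b * u \<psi>"
  using assms unfolding distributions_def by blast

lemma distributions_outside: "u \<in> distributions \<Longrightarrow> \<phi> \<notin> smooth_torus \<Longrightarrow> u \<phi> = 0"
  unfolding distributions_def by blast

lemma distributions_scale:
  assumes "u \<in> distributions" "\<phi> \<in> smooth_torus"
  shows "u (\<lambda>x. a * \<phi> x) = a * u \<phi>"
  using distributions_lincomb[OF assms(1,2,2), of a 0] by simp

lemma distributions_bound:
  assumes "u \<in> distributions"
  obtains C k where "0 \<le> C" "\<And>\<phi>. \<phi> \<in> smooth_torus \<Longrightarrow> cmod (u \<phi>) \<le> C * Ck_norm k \<phi>"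
proof -
  obtain k C where C: "\<And>\<phi>. \<phi> \<in> smooth_torus \<Longrightarrow> cmod (u \<phi>) \<le> C * Ck_norm k \<phi>"
    using assms unfolding distributions_def by blast
  have "cmod (u \<phi>) \<le> \<bar>C\<bar> * Ck_norm k \<phi>" if "\<phi> \<in> smooth_torus" for \<phi>
    by (rule order_trans[OF C[OF that]]) (intro mult_right_mono Ck_norm_nonneg that, simp)
  then show ?thesis
    by (intro that[of "\<bar>C\<bar>" k]) simp_all
qed

lemma distributions_fser_finite:
  fixes u :: "'n::finite functional"
  assumes u: "u \<in> distributions" and "finite S"
  shows "u (fser (\<lambda>\<xi>. if \<xi> \<in> S then c \<xi> else 0)) = (\<Sum>\<xi>\<in>S. c \<xi> * u (fmode \<xi>))"
  using assms(2)
proof (induction S)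
  case empty
  have "fser (\<lambda>\<xi>::int ^ 'n. 0) = (\<lambda>x. 0 * fmode 0 x)"
    by (auto simp: fser_def)
  then show ?case
    using distributions_scale[OF u fmode_smooth, of 0] by simp
next
  case (insert \<eta> S)
  have fin: "fser (\<lambda>\<xi>. if \<xi> \<in> S then c \<xi> else 0) x = (\<Sum>\<xi>\<in>S. c \<xi> * fmode \<xi> x)" if "finite S" for S x
    by (subst fser_finite[OF that]) auto
  have "fser (\<lambda>\<xi>. if \<xi> \<in> insert \<eta> S then c \<xi> else 0) x
      = c \<eta> * fmode \<eta> x + 1 * fser (\<lambda>\<xi>. if \<xi> \<in> S then c \<xi> else 0) x" for x
    unfolding fin[OF insert(1)] fin[OF finite.insertI[OF insert(1)]] using insert(1,2) by simp
  then have "fser (\<lambda>\<xi>. if \<xi> \<in> insert \<eta> S then c \<xi> else 0)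
      = (\<lambda>x. c \<eta> * fmode \<eta> x + 1 * fser (\<lambda>\<xi>. if \<xi> \<in> S then c \<xi> else 0) x)"
    by (rule ext)
  moreover have "fser (\<lambda>\<xi>. if \<xi> \<in> S then c \<xi> else 0) \<in> smooth_torus"
    by (intro fser_smooth rapid_finite_support finite_subset[OF _ insert(1)]) auto
  ultimately have "u (fser (\<lambda>\<xi>. if \<xi> \<in> insert \<eta> S then c \<xi> else 0))
      = c \<eta> * u (fmode \<eta>) + 1 * u (fser (\<lambda>\<xi>. if \<xi> \<in> S then c \<xi> else 0))"
    by (simp only: distributions_lincomb[OF u fmode_smooth])
  then show ?case
    using insert by simp
qed

text \<open>The test function is split into a finite part, where linearity applies, and a remainder.
  By continuity of \<open>u\<close> the value on the remainder is at most \<open>C\<close> times the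
  tail of the convergent sum of \<open>cmod (c \<xi>) * jap \<xi> ^ k\<close>.\<close>

lemma distributions_has_sum:
  assumes u: "u \<in> distributions" and c: "rapid c"
  shows "((\<lambda>\<xi>. c \<xi> * u (fmode \<xi>)) has_sum u (fser c)) UNIV"
proof -
  obtain C k where C: "0 \<le> C" "\<And>\<phi>. \<phi> \<in> smooth_torus \<Longrightarrow> cmod (u \<phi>) \<le> C * Ck_norm k \<phi>"
    by (rule distributions_bound[OF u]) blast
  define m where "m \<xi> = cmod (c \<xi>) * jap \<xi> ^ k" for \<xi>
  have m: "(m has_sum infsum m UNIV) UNIV"
    unfolding m_def by (intro has_sum_infsum rapid_summable c)
  have bd: "cmod ((\<Sum>\<xi>\<in>S. c \<xi> * u (fmode \<xi>)) - u (fser c)) \<le> C * (infsum m UNIV - sum m S)"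
    if S: "finite S" for S
  proof -
    define cS where "cS \<xi> = (if \<xi> \<in> S then c \<xi> else 0)" for \<xi>
    define cR where "cR \<xi> = (if \<xi> \<in> S then 0 else c \<xi>)" for \<xi>
    have rS: "rapid cS" and rR: "rapid cR"
      by (rule rapid_mono[OF c]; simp add: cS_def cR_def)+
    have "fser c = (\<lambda>x. 1 * fser cS x + 1 * fser cR x)"
    proof
      fix x
      have "((\<lambda>\<xi>. cS \<xi> * fmode \<xi> x + cR \<xi> * fmode \<xi> x) has_sum (fser cS x + fser cR x)) UNIV"
        by (intro has_sum_add fser_has_sum rS rR)
      moreover have "(\<lambda>\<xi>. cS \<xi> * fmode \<xi> x + cR \<xi> * fmode \<xi> x) = (\<lambda>\<xi>. c \<xi> * fmode \<xi> x)"
        by (auto simp: cS_def cR_def)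
      ultimately show "fser c x = 1 * fser cS x + 1 * fser cR x"
        using has_sum_unique[OF fser_has_sum[OF c]] by simp
    qed
    then have "u (fser c) = u (fser cS) + u (fser cR)"
      using distributions_lincomb[OF u fser_smooth[OF rS] fser_smooth[OF rR], of 1 1] by simp
    moreover have "u (fser cS) = (\<Sum>\<xi>\<in>S. c \<xi> * u (fmode \<xi>))"
      unfolding cS_def by (rule distributions_fser_finite[OF u S])
    ultimately have "cmod ((\<Sum>\<xi>\<in>S. c \<xi> * u (fmode \<xi>)) - u (fser c)) = cmod (u (fser cR))"
      by (simp add: norm_minus_commute)
    also have "\<dots> \<le> C * (\<Sum>\<^sub>\<infinity>\<xi>. cmod (cR \<xi>) * jap \<xi> ^ k)"
      by (rule order_trans[OF C(2)[OF fser_smooth[OF rR]]]) (intro mult_left_mono Ck_norm_fser_le rR C)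
    also have "(\<Sum>\<^sub>\<infinity>\<xi>. cmod (cR \<xi>) * jap \<xi> ^ k) = infsum m UNIV - sum m S"
    proof (rule infsumI)
      have "((\<lambda>\<xi>. m \<xi> - (if \<xi> \<in> S then m \<xi> else 0)) has_sum (infsum m UNIV - sum m S)) UNIV"
        by (intro has_sum_diff m has_sum_finite_neutralI[OF S]) auto
      moreover have "(\<lambda>\<xi>. m \<xi> - (if \<xi> \<in> S then m \<xi> else 0)) = (\<lambda>\<xi>. cmod (cR \<xi>) * jap \<xi> ^ k)"
        by (auto simp: cR_def m_def)
      ultimately show "((\<lambda>\<xi>. cmod (cR \<xi>) * jap \<xi> ^ k) has_sum (infsum m UNIV - sum m S)) UNIV"
        by simp
    qed
    finally show ?thesis .
  qed
  have "((\<lambda>S. C * (infsum m UNIV - sum m S)) \<longlongrightarrow> C * (infsum m UNIV - infsum m UNIV)) (finite_subsets_at_top UNIV)"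
    using m unfolding has_sum_def by (intro tendsto_intros)
  then have "((\<lambda>S. C * (infsum m UNIV - sum m S)) \<longlongrightarrow> 0) (finite_subsets_at_top UNIV)"
    by simp
  then have "((\<lambda>S. (\<Sum>\<xi>\<in>S. c \<xi> * u (fmode \<xi>)) - u (fser c)) \<longlongrightarrow> 0) (finite_subsets_at_top UNIV)"
    by (rule Lim_null_comparison[rotated]) (intro eventually_finite_subsets_at_top_weakI bd)
  then show ?thesis
    unfolding has_sum_def using LIM_zero_cancel by blast
qed

lemma distributions_eqI:
  assumes u: "u \<in> distributions" and v: "v \<in> distributions"
    and eq: "\<And>\<xi>. fourier_coeff u \<xi> = fourier_coeff v \<xi>"
  shows "u = v"
proof
  fix \<phi>
  show "u \<phi> = v \<phi>"
  proof (cases "\<phi> \<in> smooth_torus")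
    case True
    have "u (fmode \<xi>) = v (fmode \<xi>)" for \<xi>
      using eq[of "- \<xi>"] by (simp add: fourier_coeff_fmode)
    then show ?thesis
      using has_sum_unique[OF distributions_has_sum[OF u rapid_fc[OF True]]]
        distributions_has_sum[OF v rapid_fc[OF True]] by (simp add: smooth_eq_fser[OF True])
  qed (simp add: distributions_outside u v)
qed

lemma distributions_combine:
  assumes u: "u \<in> distributions" and v: "v \<in> distributions"
  shows "(\<lambda>\<phi>. a * u \<phi> + b * v \<phi>) \<in> distributions"
proof -
  obtain C k where C: "0 \<le> C" "\<And>\<phi>. \<phi> \<in> smooth_torus \<Longrightarrow> cmod (u \<phi>) \<le> C * Ck_norm k \<phi>"
    by (rule distributions_bound[OF u]) blast
  obtain D l where D: "0 \<le> D" "\<And>\<phi>. \<phi> \<in> smooth_torus \<Longrightarrow> cmod (v \<phi>) \<le> D * Ck_norm l \<phi>"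
    by (rule distributions_bound[OF v]) blast
  define m where "m = max k l"
  have "cmod (a * u \<phi> + b * v \<phi>) \<le> (cmod a * C + cmod b * D) * Ck_norm m \<phi>" if "\<phi> \<in> smooth_torus" for \<phi>
  proof -
    have "cmod (u \<phi>) \<le> C * Ck_norm m \<phi>" "cmod (v \<phi>) \<le> D * Ck_norm m \<phi>"
      unfolding m_def
      by (rule order_trans[OF C(2)[OF that] mult_left_mono[OF Ck_norm_mono[OF that max.cobounded1] C(1)]],
          rule order_trans[OF D(2)[OF that] mult_left_mono[OF Ck_norm_mono[OF that max.cobounded2] D(1)]])
    then have "cmod a * cmod (u \<phi>) + cmod b * cmod (v \<phi>) \<le> cmod a * (C * Ck_norm m \<phi>) + cmod b * (D * Ck_norm m \<phi>)"
      by (intro add_mono mult_left_mono) auto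
    moreover have "cmod (a * u \<phi> + b * v \<phi>) \<le> cmod a * cmod (u \<phi>) + cmod b * cmod (v \<phi>)"
      by (rule order_trans[OF norm_triangle_ineq]) (simp add: norm_mult)
    ultimately show ?thesis
      by (simp add: algebra_simps)
  qed
  moreover have "a * u \<phi> + b * v \<phi> = 0" if "\<phi> \<notin> smooth_torus" for \<phi>
    using that by (simp add: distributions_outside u v)
  moreover have "a * u (\<lambda>x. a' * \<phi> x + b' * \<psi> x) + b * v (\<lambda>x. a' * \<phi> x + b' * \<psi> x)
      = a' * (a * u \<phi> + b * v \<phi>) + b' * (a * u \<psi> + b * v \<psi>)"
    if "\<phi> \<in> smooth_torus" "\<psi> \<in> smooth_torus" for \<phi> \<psi> a' b'
    by (simp add: distributions_lincomb[OF u that] distributions_lincomb[OF v that] algebra_simps)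
  ultimately show ?thesis
    unfolding distributions_def by blast
qed

lemma distributions_diff: "u \<in> distributions \<Longrightarrow> v \<in> distributions \<Longrightarrow> u - v \<in> distributions"
  using distributions_combine[of u v 1 "-1"] by (simp add: fun_diff_def)

lemma fourier_coeff_diff [simp]: "fourier_coeff (u - v) \<xi> = fourier_coeff u \<xi> - fourier_coeff v \<xi>"
  by (simp add: fourier_coeff_def)

lemma distr_of_distributions:
  fixes F :: "real ^ 'n::finite \<Rightarrow> complex"
  assumes F: "F \<in> smooth_torus"
  shows "distr_of F \<in> distributions"
proof -
  note cF [continuous_intros] = smooth_torusD(3)[OF F]
  obtain M where M: "\<And>x. x \<in> tbox \<Longrightarrow> cmod (F x) \<le> M"
    by (rule smooth_bounded[OF F]) blast
  have lin: "distr_of F (\<lambda>x. a * \<phi> x + b * \<psi> x) = a * distr_of F \<phi> + b * distr_of F \<psi>"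
    if \<phi>: "\<phi> \<in> smooth_torus" and \<psi>: "\<psi> \<in> smooth_torus" for \<phi> \<psi> a b
  proof -
    note [continuous_intros] = smooth_torusD(3)[OF \<phi>] smooth_torusD(3)[OF \<psi>]
    \<comment> \<open>\<open>distr_of\<close> is 0 off \<open>smooth_torus\<close>, so linearity
      requires that the combination is again smooth. This is read off from its rapidly convergent
      Fourier series.\<close>
    have sum: "((\<lambda>\<xi>. (a * fc \<phi> \<xi> + b * fc \<psi> \<xi>) * fmode \<xi> x) has_sum (a * \<phi> x + b * \<psi> x)) UNIV" for x
    proof -
      have "((\<lambda>\<xi>. a * (fc \<phi> \<xi> * fmode \<xi> x) + b * (fc \<psi> \<xi> * fmode \<xi> x)) has_sum (a * \<phi> x + b * \<psi> x)) UNIV"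
        using fser_has_sum[OF rapid_fc[OF \<phi>], of x] fser_has_sum[OF rapid_fc[OF \<psi>], of x]
        by (intro has_sum_add has_sum_cmult_right) (simp_all add: smooth_eq_fser \<phi> \<psi>)
      then show ?thesis by (simp add: algebra_simps)
    qed
    have "rapid (\<lambda>\<xi>. a * fc \<phi> \<xi> + b * fc \<psi> \<xi>)"
      unfolding rapid_def
    proof
      fix m
      obtain A B where A: "\<And>\<xi>. cmod (fc \<phi> \<xi>) * jap \<xi> ^ m \<le> A" and B: "\<And>\<xi>. cmod (fc \<psi> \<xi>) * jap \<xi> ^ m \<le> B"
        using rapid_fc[OF \<phi>] rapid_fc[OF \<psi>] unfolding rapid_def by metis
      have "cmod (a * fc \<phi> \<xi> + b * fc \<psi> \<xi>) * jap \<xi> ^ m \<le> cmod a * A + cmod b * B" for \<xi>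
      proof -
        have "cmod (a * fc \<phi> \<xi> + b * fc \<psi> \<xi>) * jap \<xi> ^ m
            \<le> (cmod a * cmod (fc \<phi> \<xi>) + cmod b * cmod (fc \<psi> \<xi>)) * jap \<xi> ^ m"
          by (intro mult_right_mono order_trans[OF norm_triangle_ineq]) (auto simp: norm_mult)
        also have "\<dots> = cmod a * (cmod (fc \<phi> \<xi>) * jap \<xi> ^ m) + cmod b * (cmod (fc \<psi> \<xi>) * jap \<xi> ^ m)"
          by (simp add: algebra_simps)
        also have "\<dots> \<le> cmod a * A + cmod b * B"
          by (intro add_mono mult_left_mono A B) auto
        finally show ?thesis .
      qed
      then show "\<exists>C. \<forall>\<xi>. cmod (a * fc \<phi> \<xi> + b * fc \<psi> \<xi>) * jap \<xi> ^ m \<le> C" by blast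
    qed
    from fser_smooth[OF this] have "(\<lambda>x. a * \<phi> x + b * \<psi> x) \<in> smooth_torus"
      using infsumI[OF sum] by (simp add: fser_def[abs_def])
    moreover have "integral tbox (\<lambda>x. F x * (a * \<phi> x + b * \<psi> x))
        = a * integral tbox (\<lambda>x. F x * \<phi> x) + b * integral tbox (\<lambda>x. F x * \<psi> x)"
    proof -
      have "integral tbox (\<lambda>x. F x * (a * \<phi> x + b * \<psi> x))
          = integral tbox (\<lambda>x. a * (F x * \<phi> x) + b * (F x * \<psi> x))"
        by (simp add: algebra_simps)
      also have "\<dots> = integral tbox (\<lambda>x. a * (F x * \<phi> x)) + integral tbox (\<lambda>x. b * (F x * \<psi> x))"
        by (intro integral_add integrable_continuous continuous_intros)
      finally show ?thesis by simp
    qed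
    ultimately show ?thesis
      by (simp add: distr_of_def \<phi> \<psi> add_divide_distrib)
  qed
  moreover have "cmod (distr_of F \<phi>) \<le> M * Ck_norm 0 \<phi>" if \<phi>: "\<phi> \<in> smooth_torus" for \<phi>
  proof -
    note [continuous_intros] = smooth_torusD(3)[OF \<phi>]
    \<comment> \<open>The pairing of \<open>F\<close> with \<open>\<phi>\<close> is the coefficient
      of \<open>F * \<phi>\<close> at frequency 0.\<close>
    have "cmod (fc (\<lambda>x. F x * \<phi> x) 0) \<le> M * Ck_norm 0 \<phi>"
    proof (rule norm_fc_le)
      fix x :: "real ^ 'n" assume "x \<in> tbox"
      then have "cmod (F x) \<le> M" "0 \<le> M"
        using M norm_ge_zero order_trans by blast+
      then show "cmod (F x * \<phi> x) \<le> M * Ck_norm 0 \<phi>"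
        unfolding norm_mult by (intro mult_mono norm_le_Ck_norm \<phi>) auto
    qed (intro continuous_intros)
    then show ?thesis
      using \<phi> fc_eq[of "\<lambda>x. F x * \<phi> x" 0] by (simp add: distr_of_def)
  qed
  moreover have "distr_of F \<phi> = 0" if "\<phi> \<notin> smooth_torus" for \<phi>
    using that by (simp add: distr_of_def)
  ultimately show ?thesis
    unfolding distributions_def by blast
qed

section \<open>Sobolev spaces\<close>

text \<open>The square root of \<open>sob_weight\<close>: it makes \<open>sob_norm\<close> the
  supremum of \<open>L2_set\<close> norms over finite sets, where Minkowski's inequality is
  available.\<close>

definition sob_coeff :: "real \<Rightarrow> 'n::finite functional \<Rightarrow> int ^ 'n \<Rightarrow> real" where
  "sob_coeff r u \<xi> = cmod (fourier_coeff u \<xi>) * jap \<xi> powr r"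

lemma sob_weight_eq: "sob_weight r u \<xi> = (sob_coeff r u \<xi>)\<^sup>2"
proof -
  have "jap \<xi> powr (2 * r) = (jap \<xi> powr r)\<^sup>2"
    unfolding power2_eq_square powr_add[symmetric] by simp
  then show ?thesis
    by (simp add: sob_weight_def sob_coeff_def jap_def power_mult_distrib)
qed

lemma sob_coeff_nonneg: "0 \<le> sob_coeff r u \<xi>"
  by (simp add: sob_coeff_def)

lemma sob_iff: "u \<in> sob r \<longleftrightarrow> u \<in> distributions \<and> (\<lambda>\<xi>. (sob_coeff r u \<xi>)\<^sup>2) summable_on UNIV"
  by (simp add: sob_def sob_weight_eq[abs_def])

lemma sob_distributions: "u \<in> sob r \<Longrightarrow> u \<in> distributions"
  by (simp add: sob_iff)

lemma sob_norm_eq: "sob_norm r u = sqrt (\<Sum>\<^sub>\<infinity>\<xi>. (sob_coeff r u \<xi>)\<^sup>2)"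
  by (simp add: sob_norm_def sob_weight_eq)

lemma sob_norm_nonneg: "0 \<le> sob_norm r u"
  by (simp add: sob_norm_eq infsum_nonneg)

lemma L2_set_sob_le:
  assumes "u \<in> sob r" "finite F"
  shows "L2_set (sob_coeff r u) F \<le> sob_norm r u"
  unfolding L2_set_def sob_norm_eq
  using assms by (intro real_sqrt_le_mono finite_sum_le_infsum) (auto simp: sob_iff)

lemma sob_coeff_le: "u \<in> sob r \<Longrightarrow> sob_coeff r u \<xi> \<le> sob_norm r u"
  using L2_set_sob_le[of u r "{\<xi>}"] by (simp add: L2_set_def sob_coeff_nonneg)

lemma sobI_L2_set:
  assumes u: "u \<in> distributions" and B: "\<And>F. finite F \<Longrightarrow> L2_set (sob_coeff r u) F \<le> B"
  shows "u \<in> sob r" "sob_norm r u \<le> B"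
proof -
  have "0 \<le> B" using B[of "{}"] by simp
  have bd: "(\<Sum>\<xi>\<in>F. (sob_coeff r u \<xi>)\<^sup>2) \<le> B\<^sup>2" if "finite F" for F
    using B[OF that] unfolding L2_set_def by (rule sqrt_le_D)
  have sm: "(\<lambda>\<xi>. (sob_coeff r u \<xi>)\<^sup>2) summable_on UNIV"
    by (rule nonneg_bounded_partial_sums_imp_summable_on[where C = "B\<^sup>2"])
       (auto intro!: eventually_finite_subsets_at_top_weakI bd)
  then show "u \<in> sob r"
    using u by (simp add: sob_iff)
  have "(\<Sum>\<^sub>\<infinity>\<xi>. (sob_coeff r u \<xi>)\<^sup>2) \<le> B\<^sup>2"
    by (rule infsum_le_finite_sums[OF sm bd])
  then show "sob_norm r u \<le> B"
    unfolding sob_norm_eq using \<open>0 \<le> B\<close> by (simp add: real_le_lsqrt)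
qed

text \<open>Minkowski's inequality on finite sets, with a bound independent of the set. Assuming
  only a pointwise inequality between coefficients covers closure under differences as well as the
  triangle inequality of the metric.\<close>

lemma sob_triangle:
  assumes "u \<in> sob r" "v \<in> sob r" "w \<in> distributions"
    and "\<And>\<xi>. cmod (fourier_coeff w \<xi>) \<le> cmod (fourier_coeff u \<xi>) + cmod (fourier_coeff v \<xi>)"
  shows "w \<in> sob r" "sob_norm r w \<le> sob_norm r u + sob_norm r v"
proof -
  have "L2_set (sob_coeff r w) F \<le> sob_norm r u + sob_norm r v" if "finite F" for F
  proof -
    have "L2_set (sob_coeff r w) F \<le> L2_set (\<lambda>\<xi>. sob_coeff r u \<xi> + sob_coeff r v \<xi>) F"
      using assms(4) by (intro L2_set_mono sob_coeff_nonneg)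
        (auto simp: sob_coeff_def distrib_right[symmetric] intro!: mult_right_mono)
    also have "\<dots> \<le> L2_set (sob_coeff r u) F + L2_set (sob_coeff r v) F"
      by (rule L2_set_triangle_ineq)
    also have "\<dots> \<le> sob_norm r u + sob_norm r v"
      by (intro add_mono L2_set_sob_le assms that)
    finally show ?thesis .
  qed
  note bd = this
  show "w \<in> sob r"
    by (rule sobI_L2_set(1)[OF assms(3) bd])
  show "sob_norm r w \<le> sob_norm r u + sob_norm r v"
    by (rule sobI_L2_set(2)[OF assms(3) bd])
qed

lemma sob_diff: "u \<in> sob r \<Longrightarrow> v \<in> sob r \<Longrightarrow> u - v \<in> sob r"
  by (rule sob_triangle(1)[of u r v]) (auto simp: sob_distributions distributions_diff norm_triangle_ineq4)

lemma norm_diff_triangle_ineq': "norm (x - z) \<le> norm (x - y) + norm (y - z)" for x :: "'a::real_normed_vector"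
  using norm_triangle_ineq[of "x - y" "y - z"] by simp

text \<open>Definiteness rests on \<open>distributions_eqI\<close>: a distribution is determined by
  its Fourier coefficients.\<close>

lemma Metric_space_sob: "Metric_space (sob r) (\<lambda>u v. sob_norm r (u - v))"
proof
  fix u v :: "'n::finite functional"
  show "0 \<le> sob_norm r (u - v)"
    by (rule sob_norm_nonneg)
  show "sob_norm r (u - v) = sob_norm r (v - u)"
    by (simp add: sob_norm_eq sob_coeff_def norm_minus_commute)
next
  fix u v :: "'n::finite functional"
  assume u: "u \<in> sob r" and v: "v \<in> sob r"
  show "sob_norm r (u - v) = 0 \<longleftrightarrow> u = v"
  proof
    assume 0: "sob_norm r (u - v) = 0"
    show "u = v"
    proof (rule distributions_eqI)
      fix \<xi>
      have "sob_coeff r (u - v) \<xi> = 0"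
        using sob_coeff_le[OF sob_diff[OF u v], of \<xi>] sob_coeff_nonneg[of r "u - v" \<xi>] 0 by simp
      then show "fourier_coeff u \<xi> = fourier_coeff v \<xi>"
        using jap_pos[of \<xi>] by (simp add: sob_coeff_def)
    qed (use u v in \<open>auto simp: sob_distributions\<close>)
  next
    assume "u = v"
    then have "sob_coeff r (u - v) \<xi> = 0" for \<xi>
      by (simp add: sob_coeff_def fourier_coeff_diff del: minus_apply diff_self)
    then show "sob_norm r (u - v) = 0"
      by (simp add: sob_norm_eq)
  qed
next
  fix u v w :: "'n::finite functional"
  assume "u \<in> sob r" "v \<in> sob r" "w \<in> sob r"
  then show "sob_norm r (u - w) \<le> sob_norm r (u - v) + sob_norm r (v - w)"
    by (intro sob_triangle(2)[OF sob_diff sob_diff sob_distributions[OF sob_diff]]) (simp_all add: norm_diff_triangle_ineq')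
qed

lemma topspace_sob_top [simp]: "topspace (sob_top r) = sob r"
  by (simp add: sob_top_def Metric_space.topspace_mtopology[OF Metric_space_sob])

section \<open>Continuous curves in Sobolev spaces\<close>

lemma C_maps_sob_iff:
  fixes f :: "real \<Rightarrow> 'n::finite functional"
  shows
  "f \<in> C_maps T (sob_top r) \<longleftrightarrow> (\<forall>t\<in>{0..T}. f t \<in> sob r) \<and>
    (\<forall>t\<in>{0..T}. \<forall>e>0. \<exists>d>0. \<forall>t'\<in>{0..T}. dist t' t < d \<longrightarrow> sob_norm r (f t' - f t) < e)"
proof -
  have sym: "sob_norm r (u - v) = sob_norm r (v - u)" for u v :: "'n::finite functional"
    by (rule Metric_space.commute[OF Metric_space_sob])
  have "f \<in> C_maps T (sob_top r) \<longleftrightarrow> (\<forall>t\<in>{0..T}. \<forall>e>0. \<exists>U. openin (top_of_set {0..T}) U \<and> t \<in> U \<and>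
      (\<forall>t'\<in>U. f t \<in> sob r \<and> f t' \<in> sob r \<and> sob_norm r (f t - f t') < e))"
    unfolding C_maps_def sob_top_def mem_Collect_eq
      Metric_space.continuous_map_to_metric[OF Metric_space_sob] Metric_space.in_mball[OF Metric_space_sob]
      topspace_euclidean_subtopology by (rule refl)
  also have "\<dots> \<longleftrightarrow> (\<forall>t\<in>{0..T}. f t \<in> sob r) \<and>
    (\<forall>t\<in>{0..T}. \<forall>e>0. \<exists>d>0. \<forall>t'\<in>{0..T}. dist t' t < d \<longrightarrow> sob_norm r (f t' - f t) < e)" (is "?L \<longleftrightarrow> ?R1 \<and> ?R2")
  proof (intro iffI conjI)
    assume L: ?L
    show ?R1
    proof
      fix t assume "t \<in> {0..T}"
      from L[rule_format, OF this zero_less_one] show "f t \<in> sob r" by auto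
    qed
    show ?R2
    proof (intro ballI allI impI)
      fix t and e :: real assume "t \<in> {0..T}" "0 < e"
      then obtain U where U: "openin (top_of_set {0..T}) U" "t \<in> U" "\<And>t'. t' \<in> U \<Longrightarrow> sob_norm r (f t - f t') < e"
        using L[rule_format, of t e] by auto
      obtain d where d: "d > 0" "\<And>t'. t' \<in> {0..T} \<Longrightarrow> dist t' t < d \<Longrightarrow> t' \<in> U"
        using U(1,2) unfolding openin_euclidean_subtopology_iff by meson
      have "sob_norm r (f t' - f t) < e" if "t' \<in> {0..T}" "dist t' t < d" for t'
        unfolding sym[of "f t'" "f t"] by (intro U(3) d(2) that)
      then show "\<exists>d>0. \<forall>t'\<in>{0..T}. dist t' t < d \<longrightarrow> sob_norm r (f t' - f t) < e"
        using d(1) by blast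
    qed
  next
    assume R: "?R1 \<and> ?R2"
    show ?L
    proof (intro ballI allI impI)
      fix t and e :: real assume t: "t \<in> {0..T}" and e: "0 < e"
      then obtain d where d: "d > 0" "\<And>t'. t' \<in> {0..T} \<Longrightarrow> dist t' t < d \<Longrightarrow> sob_norm r (f t' - f t) < e"
        using R by blast
      have "openin (top_of_set {0..T}) ({0..T} \<inter> ball t d)"
        by (rule openin_open_Int) simp
      moreover have "f t' \<in> sob r \<and> sob_norm r (f t - f t') < e" if "t' \<in> {0..T} \<inter> ball t d" for t'
        unfolding sym[of "f t" "f t'"] using that R d(2)[of t'] by (auto simp: dist_commute)
      ultimately show "\<exists>U. openin (top_of_set {0..T}) U \<and> t \<in> U \<and>
          (\<forall>t'\<in>U. f t \<in> sob r \<and> f t' \<in> sob r \<and> sob_norm r (f t - f t') < e)"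
        using R t d(1) by (intro exI[of _ "{0..T} \<inter> ball t d"]) auto
    qed
  qed
  finally show ?thesis .
qed

lemma C_maps_sob_mono:
  assumes f: "f \<in> C_maps T (sob_top r')" and "r \<le> r'"
  shows "f \<in> C_maps T (sob_top r)"
proof -
  have le: "u \<in> sob r \<and> sob_norm r u \<le> sob_norm r' u" if u: "u \<in> sob r'" for u :: "'n::finite functional"
  proof -
    have "L2_set (sob_coeff r u) F \<le> sob_norm r' u" if "finite F" for F
    proof (rule order_trans[OF L2_set_mono L2_set_sob_le[OF u that]])
      show "sob_coeff r u \<xi> \<le> sob_coeff r' u \<xi>" for \<xi>
        unfolding sob_coeff_def using assms(2) jap_ge_1 by (intro mult_left_mono powr_mono) auto
    qed (rule sob_coeff_nonneg)
    then show ?thesis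
      using sobI_L2_set[OF sob_distributions[OF u]] by blast
  qed
  have mem: "\<And>t. t \<in> {0..T} \<Longrightarrow> f t \<in> sob r'"
    using f by (simp add: C_maps_sob_iff)
  show ?thesis
    unfolding C_maps_sob_iff
  proof (intro conjI ballI allI impI)
    fix t and e :: real assume t: "t \<in> {0..T}" and "0 < e"
    then obtain d where d: "d > 0" "\<And>t'. t' \<in> {0..T} \<Longrightarrow> dist t' t < d \<Longrightarrow> sob_norm r' (f t' - f t) < e"
      using f unfolding C_maps_sob_iff by blast
    have "sob_norm r (f t' - f t) < e" if "t' \<in> {0..T}" "dist t' t < d" for t'
      using d(2)[OF that] le[OF sob_diff[OF mem[OF that(1)] mem[OF t]]] by linarith
    then show "\<exists>d>0. \<forall>t'\<in>{0..T}. dist t' t < d \<longrightarrow> sob_norm r (f t' - f t) < e"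
      using d(1) by blast
  qed (use le mem in blast)
qed

lemma C_maps_sob_coeff:
  assumes f: "f \<in> C_maps T (sob_top r)"
  shows "continuous_on {0..T} (\<lambda>t. fourier_coeff (f t) \<xi>)"
  unfolding continuous_on_iff
proof (intro ballI allI impI)
  fix t and e :: real assume t: "t \<in> {0..T}" and "0 < e"
  have mem: "\<And>t. t \<in> {0..T} \<Longrightarrow> f t \<in> sob r"
    using f by (simp add: C_maps_sob_iff)
  define w where "w = jap \<xi> powr r"
  have w: "w > 0" by (simp add: w_def)
  then have "0 < e * w" using \<open>0 < e\<close> by simp
  then obtain d where d: "d > 0" "\<And>t'. t' \<in> {0..T} \<Longrightarrow> dist t' t < d \<Longrightarrow> sob_norm r (f t' - f t) < e * w"
    using f t unfolding C_maps_sob_iff by blast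
  have "dist (fourier_coeff (f t') \<xi>) (fourier_coeff (f t) \<xi>) < e" if "t' \<in> {0..T}" "dist t' t < d" for t'
  proof -
    have "cmod (fourier_coeff (f t') \<xi> - fourier_coeff (f t) \<xi>) * w < e * w"
      using sob_coeff_le[OF sob_diff[OF mem[OF that(1)] mem[OF t]], of \<xi>]
      by (intro le_less_trans[OF _ d(2)[OF that]]) (simp add: sob_coeff_def w_def)
    then have "cmod (fourier_coeff (f t') \<xi> - fourier_coeff (f t) \<xi>) < e"
      using w by simp
    then show ?thesis
      by (simp add: dist_norm)
  qed
  then show "\<exists>d>0. \<forall>x'\<in>{0..T}. dist x' t < d \<longrightarrow> dist (fourier_coeff (f x') \<xi>) (fourier_coeff (f t) \<xi>) < e"
    using d(1) by blast
qed

text \<open>The image of the interval is compact, hence bounded in the metric, and the norm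
  dominates every weighted coefficient.\<close>

lemma C_maps_sob_bounded:
  fixes f :: "real \<Rightarrow> 'n::finite functional"
  assumes f: "f \<in> C_maps T (sob_top r)"
  obtains C where "\<And>t \<xi>. t \<in> {0..T} \<Longrightarrow> cmod (fourier_coeff (f t) \<xi>) * jap \<xi> powr r \<le> C"
proof -
  interpret S: Metric_space "sob r :: 'n::finite functional set" "\<lambda>u v. sob_norm r (u - v)"
    by (rule Metric_space_sob)
  have "compactin (sob_top r) (f ` {0..T})"
    using f unfolding C_maps_def by (auto intro!: image_compactin[of "top_of_set {0..T}"] simp: compactin_subtopology)
  then have "S.mbounded (f ` {0..T})"
    unfolding sob_top_def by (rule S.compactin_imp_mbounded)
  then obtain c B where cB: "f ` {0..T} \<subseteq> S.mcball c B"
    unfolding S.mbounded_def by blast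
  have "cmod (fourier_coeff (f t) \<xi>) * jap \<xi> powr r \<le> sob_norm r c + B" if "t \<in> {0..T}" for t \<xi>
  proof -
    have c: "c \<in> sob r" "f t \<in> sob r" "sob_norm r (c - f t) \<le> B"
      using cB that S.in_mcball by (auto simp: image_subset_iff)
    have "cmod (fourier_coeff (f t) \<xi>) \<le> cmod (fourier_coeff c \<xi>) + cmod (fourier_coeff (c - f t) \<xi>)"
      using norm_triangle_ineq4[of "fourier_coeff c \<xi>" "fourier_coeff (c - f t) \<xi>"] by simp
    then have "cmod (fourier_coeff (f t) \<xi>) * jap \<xi> powr r \<le> sob_coeff r c \<xi> + sob_coeff r (c - f t) \<xi>"
      unfolding sob_coeff_def distrib_right[symmetric] by (intro mult_right_mono) auto
    also have "\<dots> \<le> sob_norm r c + B"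
      by (rule add_mono[OF sob_coeff_le[OF c(1)] order_trans[OF sob_coeff_le[OF sob_diff[OF c(1,2)]] c(3)]])
    finally show ?thesis .
  qed
  then show ?thesis using that by blast
qed

text \<open>Every frequency of the set contributes at least \<open>1 / K ^ (2 * CARD('n))\<close> to
  the convergent sum of \<open>summable_on_jap\<close>, which bounds their number.\<close>

lemma finite_jap_le: "finite {\<xi>::int ^ 'n::finite. jap \<xi> \<le> K}"
proof -
  define A where "A = {\<xi>::int ^ 'n. jap \<xi> \<le> K}"
  define s where "s = (\<Sum>\<^sub>\<infinity>\<xi>::int ^ 'n. 1 / jap \<xi> ^ (2 * CARD('n)))"
  have "card G \<le> nat \<lceil>s * K ^ (2 * CARD('n))\<rceil>" if G: "G \<subseteq> A" "finite G" for G
  proof (cases "G = {}")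
    case False
    then have K: "1 \<le> K"
      using G(1) jap_ge_1 unfolding A_def by (metis (mono_tags) all_not_in_conv mem_Collect_eq order_trans subsetD)
    have "card G * (1 / K ^ (2 * CARD('n))) = (\<Sum>\<xi>\<in>G. 1 / K ^ (2 * CARD('n)))"
      by simp
    also have "\<dots> \<le> (\<Sum>\<xi>\<in>G. 1 / jap \<xi> ^ (2 * CARD('n)))"
      using G(1) K by (intro sum_mono divide_left_mono power_mono) (auto simp: A_def)
    also have "\<dots> \<le> s"
      unfolding s_def by (intro finite_sum_le_infsum summable_on_jap G) auto
    finally have "card G \<le> s * K ^ (2 * CARD('n))"
      using K by (simp add: pos_divide_le_eq)
    then show ?thesis
      by linarith
  qed simp
  then have "finite A"
    using finite_if_finite_subsets_card_bdd by blast
  then show ?thesis by (simp add: A_def)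
qed

text \<open>Turns continuity of single coefficients into continuity uniform in \<open>\<xi>\<close>,
  for the Sobolev and the Gevrey criterion alike. Outside a finite set the majorant
  \<open>w1\<close> is at most half of \<open>e * w2\<close>, so two values differ by at most
  \<open>e * w2\<close>; inside it, finitely many moduli of continuity are combined.\<close>

lemma uniform_weighted_continuity:
  fixes F :: "real \<Rightarrow> 'i \<Rightarrow> complex"
  assumes bound: "\<And>t \<xi>. t \<in> S \<Longrightarrow> cmod (F t \<xi>) \<le> w1 \<xi>"
    and cont: "\<And>\<xi>. continuous_on S (\<lambda>t. F t \<xi>)"
    and w2: "\<And>\<xi>. 0 < w2 \<xi>"
    and fin: "finite {\<xi>. e / 2 * w2 \<xi> < w1 \<xi>}" and t: "t \<in> S" and e: "0 < e"
  obtains d where "0 < d" "\<And>t' \<xi>. t' \<in> S \<Longrightarrow> dist t' t < d \<Longrightarrow> cmod (F t' \<xi> - F t \<xi>) \<le> e * w2 \<xi>"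
proof -
  define B where "B = {\<xi>. e / 2 * w2 \<xi> < w1 \<xi>}"
  have "\<exists>d>0. \<forall>t'\<in>S. dist t' t < d \<longrightarrow> (\<forall>\<xi>\<in>B. cmod (F t' \<xi> - F t \<xi>) \<le> e * w2 \<xi>)"
    using fin unfolding B_def[symmetric]
  proof (induction B)
    case empty
    then show ?case by (auto intro: exI[of _ 1])
  next
    case (insert \<eta> B)
    then obtain d where d: "d > 0" "\<And>t'. t' \<in> S \<Longrightarrow> dist t' t < d \<Longrightarrow> \<forall>\<xi>\<in>B. cmod (F t' \<xi> - F t \<xi>) \<le> e * w2 \<xi>"
      by auto
    have "0 < e * w2 \<eta>" using e w2 by simp
    then obtain d' where d': "d' > 0" "\<And>t'. t' \<in> S \<Longrightarrow> dist t' t < d' \<Longrightarrow> dist (F t' \<eta>) (F t \<eta>) < e * w2 \<eta>"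
      using cont[of \<eta>] t unfolding continuous_on_iff by meson
    show ?case
      using d d' by (intro exI[of _ "min d d'"]) (auto simp: dist_norm less_imp_le)
  qed
  then obtain d where d: "d > 0" "\<And>t'. t' \<in> S \<Longrightarrow> dist t' t < d \<Longrightarrow> \<forall>\<xi>\<in>B. cmod (F t' \<xi> - F t \<xi>) \<le> e * w2 \<xi>"
    by blast
  have "cmod (F t' \<xi> - F t \<xi>) \<le> e * w2 \<xi>" if "t' \<in> S" "dist t' t < d" for t' \<xi>
  proof (cases "\<xi> \<in> B")
    case False
    then have "w1 \<xi> \<le> e / 2 * w2 \<xi>"
      by (simp add: B_def)
    then show ?thesis
      using norm_triangle_ineq4[of "F t' \<xi>" "F t \<xi>"] bound[OF that(1), of \<xi>] bound[OF t, of \<xi>] by simp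
  qed (use d(2) that in blast)
  then show ?thesis
    using that d(1) by blast
qed

text \<open>The extra \<open>CARD('n)\<close> in the exponent leaves a weighted coefficient of size
  \<open>1 / jap \<xi> ^ CARD('n)\<close>, whose square is summable.\<close>

lemma distributions_decay_sob:
  fixes u :: "'n::finite functional" and r :: real
  assumes u: "u \<in> distributions" and B: "0 \<le> B"
    and bd: "\<And>\<xi>. cmod (fourier_coeff u \<xi>) \<le> B * jap \<xi> powr (- r - CARD('n))"
  shows "u \<in> sob r" "sob_norm r u \<le> B * sqrt (\<Sum>\<^sub>\<infinity>\<xi>::int ^ 'n. 1 / jap \<xi> ^ (2 * CARD('n)))"
proof -
  have "L2_set (sob_coeff r u) F \<le> B * sqrt (\<Sum>\<^sub>\<infinity>\<xi>::int ^ 'n. 1 / jap \<xi> ^ (2 * CARD('n)))"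
    if F: "finite F" for F
  proof -
    have 1: "sob_coeff r u \<xi> \<le> B * (1 / jap \<xi> ^ CARD('n))" for \<xi>
    proof -
      have "sob_coeff r u \<xi> \<le> B * jap \<xi> powr (- r - CARD('n)) * jap \<xi> powr r"
        unfolding sob_coeff_def by (intro mult_right_mono bd) simp
      also have "\<dots> = B * jap \<xi> powr (- real CARD('n))"
        by (simp add: mult.assoc flip: powr_add)
      finally show ?thesis
        by (simp add: powr_minus powr_realpow divide_simps)
    qed
    have "L2_set (sob_coeff r u) F \<le> L2_set (\<lambda>\<xi>. B * (1 / jap \<xi> ^ CARD('n))) F"
      by (intro L2_set_mono 1 sob_coeff_nonneg)
    also have "\<dots> = B * sqrt (\<Sum>\<xi>\<in>F. 1 / jap \<xi> ^ (2 * CARD('n)))"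
      using B by (simp add: L2_set_def power_mult_distrib power_divide real_sqrt_mult sum_distrib_left[symmetric]
          power_mult[symmetric] mult.commute[of 2] sum_divide_distrib[symmetric] del: times_divide_eq_right)
    also have "\<dots> \<le> B * sqrt (\<Sum>\<^sub>\<infinity>\<xi>::int ^ 'n. 1 / jap \<xi> ^ (2 * CARD('n)))"
      by (intro mult_left_mono real_sqrt_le_mono finite_sum_le_infsum summable_on_jap F B) auto
    finally show ?thesis .
  qed
  note bd' = this
  show "u \<in> sob r"
    by (rule sobI_L2_set(1)[OF u bd'])
  show "sob_norm r u \<le> B * sqrt (\<Sum>\<^sub>\<infinity>\<xi>::int ^ 'n. 1 / jap \<xi> ^ (2 * CARD('n)))"
    by (rule sobI_L2_set(2)[OF u bd'])
qed

lemma C_maps_sobI: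
  fixes f :: "real \<Rightarrow> 'n::finite functional"
  assumes dist: "\<And>t. t \<in> {0..T} \<Longrightarrow> f t \<in> distributions"
    and bound: "\<And>m::nat. \<exists>C. \<forall>t\<in>{0..T}. \<forall>\<xi>. cmod (fourier_coeff (f t) \<xi>) * jap \<xi> ^ m \<le> C"
    and cont: "\<And>\<xi>. continuous_on {0..T} (\<lambda>t. fourier_coeff (f t) \<xi>)"
  shows "f \<in> C_maps T (sob_top r)"
proof -
  \<comment> \<open>One unit beyond \<open>r + CARD('n)\<close>: the spare factor
    \<open>jap \<xi>\<close> leaves only finitely many frequencies where the majorant is not small
    against \<open>w2\<close>.\<close>
  define m where "m = nat \<lceil>r + CARD('n) + 1\<rceil>"
  obtain C0 where C0: "\<And>t \<xi>. t \<in> {0..T} \<Longrightarrow> cmod (fourier_coeff (f t) \<xi>) * jap \<xi> ^ m \<le> C0"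
    using bound[of m] by blast
  define C where "C = max C0 1"
  define w2 where "w2 = (\<lambda>\<xi>::int ^ 'n. jap \<xi> powr (- r - CARD('n)))"
  \<comment> \<open>Adding 1 gives a positive divisor and the strict inequality that ends the
    proof.\<close>
  define Z where "Z = sqrt (\<Sum>\<^sub>\<infinity>\<xi>::int ^ 'n. 1 / jap \<xi> ^ (2 * CARD('n))) + 1"
  have Z: "Z > 0" "sqrt (\<Sum>\<^sub>\<infinity>\<xi>::int ^ 'n. 1 / jap \<xi> ^ (2 * CARD('n))) < Z"
    by (auto simp: Z_def intro!: add_nonneg_pos infsum_nonneg)
  have bd: "cmod (fourier_coeff (f t) \<xi>) \<le> C / jap \<xi> ^ m" if "t \<in> {0..T}" for t \<xi>
    using C0[OF that, of \<xi>] by (simp add: pos_le_divide_eq C_def)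
  have w: "C / jap \<xi> ^ m * jap \<xi> \<le> C * w2 \<xi>" for \<xi>
  proof -
    have "1 / jap \<xi> ^ m * jap \<xi> = jap \<xi> powr (1 - real m)"
      by (simp add: powr_diff powr_realpow)
    also have "\<dots> \<le> w2 \<xi>"
      unfolding w2_def by (intro powr_mono jap_ge_1) (simp add: m_def, linarith)
    finally show ?thesis
      using mult_left_mono[of "1 / jap \<xi> ^ m * jap \<xi>" "w2 \<xi>" C] by (simp add: C_def)
  qed
  have fin: "finite {\<xi>. e * w2 \<xi> < C / jap \<xi> ^ m}" if "e > 0" for e
  proof (rule finite_subset[OF _ finite_jap_le[of "C / e"]], intro subsetI CollectI)
    fix \<xi> assume "\<xi> \<in> {\<xi>. e * w2 \<xi> < C / jap \<xi> ^ m}"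
    then have "e * w2 \<xi> * jap \<xi> \<le> C / jap \<xi> ^ m * jap \<xi>"
      by (intro mult_right_mono) auto
    also have "\<dots> \<le> C * w2 \<xi>" by (rule w)
    finally have "(e * jap \<xi>) * w2 \<xi> \<le> C * w2 \<xi>"
      by (simp add: mult_ac)
    then have "e * jap \<xi> \<le> C"
      by (rule mult_right_le_imp_le) (simp add: w2_def)
    then show "jap \<xi> \<le> C / e"
      using that by (simp add: pos_le_divide_eq mult.commute)
  qed
  show ?thesis
    unfolding C_maps_sob_iff
  proof (intro conjI ballI allI impI)
    fix t assume t: "t \<in> {0..T}"
    have bd': "cmod (fourier_coeff (f t) \<xi>) \<le> C * jap \<xi> powr (- r - CARD('n))" for \<xi>
    proof -
      have "C / jap \<xi> ^ m * 1 \<le> C / jap \<xi> ^ m * jap \<xi>"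
        by (intro mult_left_mono jap_ge_1) (simp add: C_def)
      then show ?thesis
        using bd[OF t, of \<xi>] w[of \<xi>] by (simp add: w2_def)
    qed
    have "0 \<le> C" by (simp add: C_def)
    then show "f t \<in> sob r"
      by (rule distributions_decay_sob(1)[OF dist[OF t] _ bd'])
  next
    fix t and e :: real assume t: "t \<in> {0..T}" and e: "0 < e"
    have "0 < e / Z" using e Z by simp
    then have fin': "finite {\<xi>. e / Z / 2 * w2 \<xi> < C / jap \<xi> ^ m}"
      by (intro fin) simp
    have w2: "\<And>\<xi>. 0 < w2 \<xi>" by (simp add: w2_def)
    obtain d where d: "0 < d" "\<And>t' \<xi>. t' \<in> {0..T} \<Longrightarrow> dist t' t < d \<Longrightarrow>
        cmod (fourier_coeff (f t') \<xi> - fourier_coeff (f t) \<xi>) \<le> e / Z * w2 \<xi>"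
      using uniform_weighted_continuity[OF bd cont w2 fin' t \<open>0 < e / Z\<close>] by blast
    have "sob_norm r (f t' - f t) < e" if "t' \<in> {0..T}" "dist t' t < d" for t'
    proof -
      have "sob_norm r (f t' - f t) \<le> e / Z * sqrt (\<Sum>\<^sub>\<infinity>\<xi>::int ^ 'n. 1 / jap \<xi> ^ (2 * CARD('n)))"
        using d(2)[OF that] \<open>0 < e / Z\<close>
        by (intro distributions_decay_sob(2) distributions_diff dist that t) (auto simp: w2_def)
      also have "\<dots> < e / Z * Z"
        using Z \<open>0 < e / Z\<close> by (intro mult_strict_left_mono)
      finally show ?thesis using Z by simp
    qed
    then show "\<exists>d>0. \<forall>t'\<in>{0..T}. dist t' t < d \<longrightarrow> sob_norm r (f t' - f t) < e"
      using d(1) by blast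
  qed
qed

section \<open>Smooth functions and the projective limit topology\<close>

lemma topspace_Cinf_top: "topspace Cinf_top = Cinf"
proof -
  have "openin (sob_top 0) (sob 0)"
    using openin_topspace[of "sob_top 0"] by simp
  then have "sob 0 \<inter> Cinf \<in> {U \<inter> Cinf |U r. openin (sob_top r) U}"
    by blast
  moreover have "sob 0 \<inter> Cinf = Cinf"
    by (auto simp: Cinf_def)
  ultimately show ?thesis
    unfolding Cinf_top_def topology_generated_by_topspace by auto
qed

text \<open>The universal property of the projective limit: preimages need to be checked on the
  generating sets only.\<close>

lemma C_maps_Cinf_iff:
  fixes f :: "real \<Rightarrow> 'n::finite functional"
  shows "f \<in> C_maps T Cinf_top \<longleftrightarrow> (\<forall>r. f \<in> C_maps T (sob_top r))"
proof
  assume L: "f \<in> C_maps T Cinf_top"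
  show "\<forall>r. f \<in> C_maps T (sob_top r)"
  proof
    fix r
    have mem: "f t \<in> Cinf" if "t \<in> {0..T}" for t
      using L that continuous_map_image_subset_topspace[of "top_of_set {0..T}" Cinf_top f]
      by (auto simp: C_maps_def topspace_Cinf_top)
    show "f \<in> C_maps T (sob_top r)"
      unfolding C_maps_def mem_Collect_eq continuous_map_alt
    proof (intro conjI allI impI)
      fix U :: "'n functional set" assume "openin (sob_top r) U"
      then have "openin Cinf_top (U \<inter> Cinf)"
        unfolding Cinf_top_def by (intro topology_generated_by_Basis) blast
      then have "openin (top_of_set {0..T}) (f -` (U \<inter> Cinf) \<inter> topspace (top_of_set {0..T}))"
        using L unfolding C_maps_def mem_Collect_eq continuous_map_alt by blast
      moreover have "f -` (U \<inter> Cinf) \<inter> topspace (top_of_set {0..T}) = f -` U \<inter> topspace (top_of_set {0..T})"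
        using mem by auto
      ultimately show "openin (top_of_set {0..T}) (f -` U \<inter> topspace (top_of_set {0..T}))"
        by simp
    qed (use mem in \<open>auto simp: Cinf_def\<close>)
  qed
next
  assume R: "\<forall>r. f \<in> C_maps T (sob_top r)"
  have mem: "f t \<in> Cinf" if "t \<in> {0..T}" for t
    using R that by (auto simp: Cinf_def C_maps_sob_iff)
  show "f \<in> C_maps T Cinf_top"
    unfolding C_maps_def mem_Collect_eq Cinf_top_def
  proof (rule continuous_on_generated_topo)
    fix V :: "'n functional set" assume "V \<in> {U \<inter> Cinf |U r. openin (sob_top r) U}"
    then obtain U r where U: "V = U \<inter> Cinf" "openin (sob_top r) U"
      by blast
    have "f -` V \<inter> topspace (top_of_set {0..T}) = f -` U \<inter> topspace (top_of_set {0..T})"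
      using mem U(1) by auto
    then show "openin (top_of_set {0..T}) (f -` V \<inter> topspace (top_of_set {0..T}))"
      using R U(2) unfolding C_maps_def mem_Collect_eq continuous_map_alt by metis
  next
    show "f ` topspace (top_of_set {0..T}) \<subseteq> \<Union> {U \<inter> Cinf |U r. openin (sob_top r) U}"
      unfolding topspace_Cinf_top[unfolded Cinf_top_def topology_generated_by_topspace] using mem by auto
  qed
qed

lemma Cinf_iff: "u \<in> Cinf \<longleftrightarrow> u \<in> distributions \<and> rapid (fourier_coeff u)"
proof
  assume u: "u \<in> Cinf"
  have "cmod (fourier_coeff u \<xi>) * jap \<xi> ^ m \<le> sob_norm (real m) u" for m \<xi>
    using sob_coeff_le[of u "real m" \<xi>] u by (auto simp: Cinf_def sob_coeff_def powr_realpow)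
  then show "u \<in> distributions \<and> rapid (fourier_coeff u)"
    using u unfolding rapid_def Cinf_def by (auto simp: sob_iff)
next
  assume u: "u \<in> distributions \<and> rapid (fourier_coeff u)"
  \<comment> \<open>A constant curve on the degenerate interval \<open>{0..0}\<close> turns the
    criterion for curves into one for single distributions.\<close>
  have "(\<lambda>_. u) \<in> C_maps 0 (sob_top r)" for r
    using u by (intro C_maps_sobI) (auto simp: rapid_def)
  then show "u \<in> Cinf"
    by (auto simp: C_maps_sob_iff Cinf_def)
qed

lemma distr_of_fser:
  assumes "rapid c"
  shows "distr_of (fser c) \<in> Cinf" "fourier_coeff (distr_of (fser c)) = c"
  using assms by (simp_all add: Cinf_iff fc_fser distr_of_distributions fser_smooth)

text \<open>The Fourier series shows that a smooth representative exists, inversion that it is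
  unique, so the definite description is resolved.\<close>

lemma fun_of_eq:
  assumes "u \<in> Cinf"
  shows "fun_of u = fser (fourier_coeff u)"
  unfolding fun_of_def
proof (rule the_equality)
  have u: "u \<in> distributions" "rapid (fourier_coeff u)"
    using assms by (auto simp: Cinf_iff)
  show "fser (fourier_coeff u) \<in> smooth_torus \<and> distr_of (fser (fourier_coeff u)) = u"
    using u by (auto intro!: distributions_eqI distr_of_distributions fser_smooth simp: fc_fser)
next
  fix F assume F: "F \<in> smooth_torus \<and> distr_of F = u"
  then show "F = fser (fourier_coeff u)"
    using smooth_eq_fser[of F] by simp
qed

section \<open>Gevrey spaces\<close>

text \<open>The decay of Gevrey coefficients on the Fourier side; \<open>s = 1\<close> is the
  exponential decay of analytic functions. A larger \<open>b\<close> means faster decay.\<close>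

definition gdec :: "real \<Rightarrow> real \<Rightarrow> int ^ 'n::finite \<Rightarrow> real" where
  "gdec s b \<xi> = exp (- b * norm (freq \<xi>) powr (1 / s))"

lemma gdec_pos [simp]: "0 < gdec s b \<xi>"
  by (simp add: gdec_def)

lemma gdec_nonneg [simp]: "0 \<le> gdec s b \<xi>"
  by (simp add: gdec_def)

lemma gdec_neq_0 [simp]: "gdec s b \<xi> \<noteq> 0"
  using gdec_pos[of s b \<xi>] by linarith

lemma gdec_add: "gdec s (a + b) \<xi> = gdec s a \<xi> * gdec s b \<xi>"
  by (simp add: gdec_def left_diff_distrib flip: exp_add)

lemma gdec_le_1: "0 \<le> b \<Longrightarrow> gdec s b \<xi> \<le> 1"
  by (simp add: gdec_def)

lemma gdec_antimono: "a \<le> b \<Longrightarrow> gdec s b \<xi> \<le> gdec s a \<xi>"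
  by (simp add: gdec_def mult_right_mono)

lemma power_div_fact_le_exp:
  assumes "0 \<le> y"
  shows "y ^ k / fact k \<le> exp (y::real)"
proof -
  have "(\<Sum>n\<in>{k}. y ^ n /\<^sub>R fact n) \<le> (\<Sum>n. y ^ n /\<^sub>R fact n)"
    using assms by (intro sum_le_suminf summable_exp_generic) auto
  then show ?thesis
    by (simp add: exp_def divide_inverse mult.commute)
qed

lemma power_powr_commute: "0 \<le> z \<Longrightarrow> 0 < s \<Longrightarrow> (z ^ k) powr s = (z powr s) ^ k" for z s :: real
  by (induction k) (simp_all add: powr_mult)

text \<open>The inequality \<open>y ^ k \<le> fact k * exp y\<close>, raised to the power
  \<open>s\<close>. The choice of \<open>y\<close> makes the \<open>s\<close>-th power of
  \<open>exp y\<close> equal to \<open>exp (b * x powr (1 / s))\<close>.\<close>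

lemma power_mult_exp_powr_le:
  fixes x b s :: real
  assumes x: "0 \<le> x" and b: "0 < b" and s: "0 < s"
  shows "x ^ k * exp (- b * x powr (1 / s)) \<le> ((s / b) powr s) ^ k * fact k powr s"
proof -
  define y where "y = b / s * x powr (1 / s)"
  have y: "0 \<le> y" using b s by (simp add: y_def)
  have "y ^ k \<le> fact k * exp y"
    using power_div_fact_le_exp[OF y, of k] by (simp add: pos_divide_le_eq mult.commute)
  then have "(y ^ k) powr s \<le> (fact k * exp y) powr s"
    using y s by (intro powr_mono2) auto
  also have "\<dots> = fact k powr s * exp (b * x powr (1 / s))"
    using s by (simp add: powr_mult exp_powr_real y_def)
  also have "y powr s = (b / s) powr s * x"
    unfolding y_def using x b s by (subst powr_mult) (simp_all add: powr_powr)
  then have "(y ^ k) powr s = ((b / s) powr s * x) ^ k"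
    by (simp add: power_powr_commute y s)
  finally have "((b / s) powr s * x) ^ k * exp (- b * x powr (1 / s)) \<le> fact k powr s"
    by (simp add: exp_minus divide_simps)
  then have "((s / b) powr s) ^ k * (((b / s) powr s * x) ^ k * exp (- b * x powr (1 / s)))
      \<le> ((s / b) powr s) ^ k * fact k powr s"
    by (rule mult_left_mono) simp
  moreover have "((s / b) powr s) ^ k * ((b / s) powr s * x) ^ k = x ^ k"
  proof -
    have "(s / b) powr s * (b / s) powr s = 1"
      using b s by (simp flip: powr_mult)
    then show ?thesis
      by (simp add: power_mult_distrib[symmetric] mult.assoc[symmetric])
  qed
  ultimately show ?thesis
    by (simp only: mult.assoc[symmetric])
qed

text \<open>Instead of optimizing over \<open>k\<close>, all bounds are summed: their
  \<open>s\<close>-th roots read \<open>p * y ^ k / fact k \<le> q\<close>, and weighting with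
  \<open>(1 / 2) ^ k\<close> yields \<open>p * exp (y / 2) \<le> 2 * q\<close>. Raising this to the
  power \<open>s\<close> produces the constants \<open>2 powr s\<close> and
  \<open>s / 2\<close>.\<close>

lemma exp_decay_of_power_bounds:
  fixes x a A h s :: real
  assumes x: "0 \<le> x" and a: "0 \<le> a" and A: "0 \<le> A" and h: "0 < h" and s: "0 < s"
    and bd: "\<And>k. x ^ k * a \<le> A * h ^ k * fact k powr s"
  shows "a \<le> 2 powr s * A * exp (- (s / 2) * (x / h) powr (1 / s))"
proof -
  define y where "y = (x / h) powr (1 / s)"
  define p where "p = a powr (1 / s)"
  define q where "q = A powr (1 / s)"
  have y: "0 \<le> y" "y powr s = x / h" and p: "0 \<le> p" "p powr s = a" and q: "0 \<le> q" "q powr s = A"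
    using x a A h s by (simp_all add: y_def p_def q_def powr_powr)
  have tm: "p * (y ^ k / fact k) \<le> q" for k
  proof -
    have "(p * (y ^ k / fact k)) powr s = a * (x / h) ^ k / fact k powr s"
      using y p s by (simp add: powr_mult powr_divide power_powr_commute)
    also have "\<dots> \<le> A"
      using bd[of k] h by (simp add: power_divide divide_simps mult_ac)
    finally have "((p * (y ^ k / fact k)) powr s) powr (1 / s) \<le> A powr (1 / s)"
      using s by (intro powr_mono2) auto
    then show ?thesis
      using y p s by (simp add: powr_powr q_def)
  qed
  have "p * exp (y / 2) \<le> 2 * q"
  proof -
    have 1: "(\<lambda>k. p * ((y / 2) ^ k /\<^sub>R fact k)) sums (p * exp (y / 2))"
      by (intro sums_mult exp_converges)
    have 2: "(\<lambda>k. q * (1 / 2) ^ k) sums (q * (1 / (1 - 1 / 2)))"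
      by (intro sums_mult geometric_sums) simp
    have "p * ((y / 2) ^ k /\<^sub>R fact k) \<le> q * (1 / 2) ^ k" for k
      using mult_right_mono[OF tm[of k], of "(1 / 2) ^ k"] by (simp add: power_divide divide_simps)
    then show ?thesis
      using sums_le[OF _ 1 2] by simp
  qed
  then have "(p * exp (y / 2)) powr s \<le> (2 * q) powr s"
    using p s by (intro powr_mono2) auto
  then have "a * exp (s / 2 * y) \<le> 2 powr s * A"
    using p q by (simp add: powr_mult exp_powr_real mult.commute)
  then show ?thesis
    by (simp add: y_def exp_minus divide_simps)
qed

section \<open>Gevrey classes in terms of the decay of Fourier coefficients\<close>

lemma gdec_decay:
  assumes "0 < s" "0 < b"
  shows "\<exists>C. \<forall>\<xi>::int ^ 'n::finite. gdec s b \<xi> * jap \<xi> ^ m \<le> C"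
proof -
  define H where "H = ((s / b) powr s) ^ m * fact m powr s"
  have "gdec s b \<xi> * jap \<xi> ^ m \<le> 2 ^ m * (1 + H)" for \<xi> :: "int ^ 'n"
  proof -
    have "gdec s b \<xi> * jap \<xi> ^ m \<le> gdec s b \<xi> * (2 ^ m * (1 + norm (freq \<xi>) ^ m))"
      by (intro mult_left_mono jap_power_le) simp
    also have "\<dots> = 2 ^ m * (gdec s b \<xi> + norm (freq \<xi>) ^ m * gdec s b \<xi>)"
      by (simp add: algebra_simps)
    also have "\<dots> \<le> 2 ^ m * (1 + H)"
      using power_mult_exp_powr_le[OF norm_ge_zero assms(2,1), of "freq \<xi>" m] assms
      by (intro mult_left_mono add_mono gdec_le_1) (auto simp: gdec_def H_def)
    finally show ?thesis .
  qed
  then show ?thesis by blast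
qed

lemma gdec_bound_decay:
  assumes "0 < s" "0 < b" "0 \<le> A"
  shows "\<exists>C. \<forall>c (\<xi>::int ^ 'n::finite). c \<le> A * gdec s b \<xi> \<longrightarrow> c * jap \<xi> ^ m \<le> C"
proof -
  obtain C where C: "\<And>\<xi>::int ^ 'n. gdec s b \<xi> * jap \<xi> ^ m \<le> C"
    using gdec_decay[OF assms(1,2)] by blast
  have "c * jap \<xi> ^ m \<le> A * C" if "c \<le> A * gdec s b \<xi>" for c and \<xi> :: "int ^ 'n"
    by (rule order_trans[OF mult_right_mono[OF that]])
       (use mult_left_mono[OF C[of \<xi>] assms(3)] in \<open>simp_all add: mult.assoc\<close>)
  then show ?thesis by blast
qed

lemma gdec_bound_rapid:
  assumes "0 < s" "0 < b" "0 \<le> A" "\<And>\<xi>. cmod (c \<xi>) \<le> A * gdec s b \<xi>"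
  shows "rapid c"
  unfolding rapid_def using gdec_bound_decay[OF assms(1-3)] assms(4) by meson

lemma summable_on_gdec:
  assumes "0 < s" "0 < b"
  shows "gdec s b summable_on (UNIV :: (int ^ 'n::finite) set)"
proof -
  obtain C where "\<And>\<xi>::int ^ 'n. gdec s b \<xi> * jap \<xi> ^ (2 * CARD('n)) \<le> C"
    using gdec_decay[OF assms] by blast
  then show ?thesis
    by (intro summable_on_decay) auto
qed

text \<open>Only pure derivatives in the direction \<open>j\<close> of a dominant component are
  used. Replacing that component by the length of the frequency costs the factor
  \<open>CARD('n)\<close> in the rate.\<close>

lemma gevrey_coeff_bound:
  fixes u :: "'n::finite functional" and A h s :: real
  assumes u: "u \<in> Cinf" and s: "0 < s" and h: "0 < h" and A: "0 \<le> A"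
    and bd: "\<And>\<alpha> x. cmod (mderiv \<alpha> (fun_of u) x) \<le> A * h ^ mdeg \<alpha> * fact (mdeg \<alpha>) powr s"
  shows "cmod (fourier_coeff u \<xi>) \<le> 2 powr s * A * gdec s (s / 2 * (1 / (CARD('n) * h)) powr (1 / s)) \<xi>"
proof -
  define c where "c = fourier_coeff u"
  have c: "rapid c"
    using u by (simp add: c_def Cinf_iff)
  obtain j where j: "norm (freq \<xi>) \<le> CARD('n) * \<bar>real_of_int (\<xi> $ j)\<bar>"
    by (rule norm_freq_le_component)
  define x where "x = \<bar>real_of_int (\<xi> $ j)\<bar>"
  have pw: "x ^ k * cmod (c \<xi>) \<le> A * h ^ k * fact k powr s" for k
  proof -
    define \<alpha> where "\<alpha> = (\<lambda>i. if i = j then k else 0)"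
    have \<alpha>: "mdeg \<alpha> = k"
      by (simp add: mdeg_def \<alpha>_def)
    obtain js where js: "\<And>i. count_list js i = \<alpha> i" "length js = k"
      "mderiv \<alpha> (fser c) = (\<lambda>x. (1 / \<i>) ^ k * fser (\<lambda>\<xi>. symb js \<xi> * c \<xi>) x)"
      using mderiv_fser[OF c, of \<alpha>] unfolding \<alpha> by metis
    \<comment> \<open>Only \<open>j\<close> occurs in \<open>js\<close>, so whatever order
      \<open>mderiv\<close> chose, the list is \<open>replicate k j\<close>.\<close>
    have "\<forall>i\<in>set js. i = j"
      using js(1) unfolding \<alpha>_def by (metis count_list_0_iff)
    then have "js = replicate k j"
      using replicate_length_same js(2) by metis
    then have symb: "symb js \<xi> = (\<i> * of_int (\<xi> $ j)) ^ k"
      by (simp add: symb_def)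
    \<comment> \<open>The unimodular factor goes into the coefficients, so that
      \<open>mderiv\<close> itself is a Fourier series with known coefficients.\<close>
    have eq: "mderiv \<alpha> (fser c) = fser (\<lambda>\<xi>. (1 / \<i>) ^ k * (symb js \<xi> * c \<xi>))"
      unfolding js(3) by (simp add: fser_def[abs_def] mult.assoc infsum_cmult_right')
    have rap: "rapid (\<lambda>\<xi>. (1 / \<i>) ^ k * (symb js \<xi> * c \<xi>))"
      by (rule rapid_mono[OF rapid_symb[OF c, of js]]) (simp add: norm_mult norm_power norm_divide)
    have "cmod (fc (fser (\<lambda>\<xi>. (1 / \<i>) ^ k * (symb js \<xi> * c \<xi>))) \<xi>) \<le> A * h ^ k * fact k powr s"
    proof (rule norm_fc_le)
      show "cmod (fser (\<lambda>\<xi>. (1 / \<i>) ^ k * (symb js \<xi> * c \<xi>)) x) \<le> A * h ^ k * fact k powr s" for x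
        using bd[of \<alpha> x] unfolding fun_of_eq[OF u] c_def[symmetric] eq \<alpha> .
    qed (rule fser_continuous_on[OF rap])
    then show ?thesis
      unfolding fc_fser[OF rap] by (simp add: symb norm_mult norm_power norm_divide x_def)
  qed
  have "cmod (c \<xi>) \<le> 2 powr s * A * exp (- (s / 2) * (x / h) powr (1 / s))"
    by (rule exp_decay_of_power_bounds[OF _ norm_ge_zero A h s pw]) (simp add: x_def)
  also have "\<dots> \<le> 2 powr s * A * gdec s (s / 2 * (1 / (CARD('n) * h)) powr (1 / s)) \<xi>"
  proof -
    have "(1 / (CARD('n) * h)) powr (1 / s) * norm (freq \<xi>) powr (1 / s) = (norm (freq \<xi>) / (CARD('n) * h)) powr (1 / s)"
      using h by (simp flip: powr_mult)
    also have "\<dots> \<le> (x / h) powr (1 / s)"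
      using j h s by (intro powr_mono2) (auto simp: x_def field_simps)
    finally have "s / 2 * ((1 / (CARD('n) * h)) powr (1 / s) * norm (freq \<xi>) powr (1 / s)) \<le> s / 2 * (x / h) powr (1 / s)"
      using s by (intro mult_left_mono) auto
    then show ?thesis
      using A by (intro mult_left_mono) (auto simp: gdec_def mult.assoc)
  qed
  finally show ?thesis
    by (simp add: c_def)
qed

text \<open>The decay is split into two halves: one absorbs the power of the frequency, the other
  makes the sum over frequencies converge. The base \<open>(2 * s / b) powr s\<close> depends on the
  rate alone and \<open>A\<close> enters linearly, so small coefficients of a common rate are small
  in one fixed Banach step.\<close>

lemma gevrey_deriv_bound:
  fixes u :: "'n::finite functional" and A b s :: real
  assumes u: "u \<in> distributions" and s: "0 < s" and b: "0 < b" and A: "0 \<le> A"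
    and bd: "\<And>\<xi>. cmod (fourier_coeff u \<xi>) \<le> A * gdec s b \<xi>"
  shows "u \<in> Cinf"
    and "cmod (mderiv \<alpha> (fun_of u) x)
      \<le> A * (\<Sum>\<^sub>\<infinity>\<xi>::int ^ 'n. gdec s (b / 2) \<xi>) * ((2 * s / b) powr s) ^ mdeg \<alpha> * fact (mdeg \<alpha>) powr s"
proof -
  have c: "rapid (fourier_coeff u)"
    by (rule gdec_bound_rapid[OF s b A bd])
  then show C: "u \<in> Cinf"
    using u by (simp add: Cinf_iff)
  let ?H = "((2 * s / b) powr s) ^ mdeg \<alpha> * fact (mdeg \<alpha>) powr s"
  have "cmod (mderiv \<alpha> (fun_of u) x) \<le> (\<Sum>\<^sub>\<infinity>\<xi>. cmod (fourier_coeff u \<xi>) * norm (freq \<xi>) ^ mdeg \<alpha>)"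
    unfolding fun_of_eq[OF C] by (rule norm_mderiv_fser_le[OF c])
  also have "\<dots> \<le> (\<Sum>\<^sub>\<infinity>\<xi>::int ^ 'n. A * ?H * gdec s (b / 2) \<xi>)"
  proof (intro infsum_mono rapid_summable_norm_freq c summable_on_cmult_right summable_on_gdec s)
    fix \<xi> :: "int ^ 'n"
    have "norm (freq \<xi>) ^ mdeg \<alpha> * gdec s (b / 2) \<xi> \<le> ?H"
      using power_mult_exp_powr_le[OF norm_ge_zero _ s, of "b / 2" "freq \<xi>" "mdeg \<alpha>"] b
      by (simp add: gdec_def mult.commute)
    then have "A * gdec s (b / 2) \<xi> * (norm (freq \<xi>) ^ mdeg \<alpha> * gdec s (b / 2) \<xi>) \<le> A * gdec s (b / 2) \<xi> * ?H"
      using A by (intro mult_left_mono) auto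
    moreover have "gdec s b \<xi> = gdec s (b / 2) \<xi> * gdec s (b / 2) \<xi>"
      unfolding gdec_add[symmetric] by simp
    moreover have "cmod (fourier_coeff u \<xi>) * norm (freq \<xi>) ^ mdeg \<alpha> \<le> A * gdec s b \<xi> * norm (freq \<xi>) ^ mdeg \<alpha>"
      by (intro mult_right_mono bd) simp
    ultimately show "cmod (fourier_coeff u \<xi>) * norm (freq \<xi>) ^ mdeg \<alpha> \<le> A * ?H * gdec s (b / 2) \<xi>"
      by (simp add: mult_ac)
  qed (use b in simp)
  also have "\<dots> = A * ?H * (\<Sum>\<^sub>\<infinity>\<xi>::int ^ 'n. gdec s (b / 2) \<xi>)"
    by (rule infsum_cmult_right')
  finally show "cmod (mderiv \<alpha> (fun_of u) x)
      \<le> A * (\<Sum>\<^sub>\<infinity>\<xi>::int ^ 'n. gdec s (b / 2) \<xi>) * ((2 * s / b) powr s) ^ mdeg \<alpha> * fact (mdeg \<alpha>) powr s"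
    by (simp add: mult_ac)
qed

lemma gevrey_norm_less_imp:
  assumes "gevrey_norm h s u < ennreal \<epsilon>" "0 < h" "0 < \<epsilon>"
  shows "cmod (mderiv \<alpha> (fun_of u) x) \<le> \<epsilon> * h ^ mdeg \<alpha> * fact (mdeg \<alpha>) powr s"
proof -
  have "ennreal (cmod (mderiv \<alpha> (fun_of u) x) / (h ^ mdeg \<alpha> * fact (mdeg \<alpha>) powr s)) \<le> gevrey_norm h s u"
    unfolding gevrey_norm_def by (rule SUP_upper2[of \<alpha>], simp, rule SUP_upper2[of x], simp_all)
  then have "ennreal (cmod (mderiv \<alpha> (fun_of u) x) / (h ^ mdeg \<alpha> * fact (mdeg \<alpha>) powr s)) < ennreal \<epsilon>"
    using assms(1) by (rule le_less_trans)
  then have "cmod (mderiv \<alpha> (fun_of u) x) / (h ^ mdeg \<alpha> * fact (mdeg \<alpha>) powr s) < \<epsilon>"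
    using assms(2,3) by (subst (asm) ennreal_less_iff) auto
  then show ?thesis
    using assms(2) by (simp add: pos_divide_less_eq mult.assoc)
qed

lemma gevrey_norm_le:
  assumes "\<And>\<alpha> x. cmod (mderiv \<alpha> (fun_of u) x) \<le> B * h ^ mdeg \<alpha> * fact (mdeg \<alpha>) powr s" "0 < h"
  shows "gevrey_norm h s u \<le> ennreal B"
  unfolding gevrey_norm_def
  using assms by (intro SUP_least ennreal_leI) (simp add: pos_divide_le_eq mult.assoc)

lemma gevrey_iff:
  fixes u :: "'n::finite functional"
  assumes s: "0 < s"
  shows "u \<in> gevrey s \<longleftrightarrow> u \<in> distributions \<and> (\<exists>A\<ge>0. \<exists>b>0. \<forall>\<xi>. cmod (fourier_coeff u \<xi>) \<le> A * gdec s b \<xi>)"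
proof
  assume "u \<in> gevrey s"
  then obtain C h where u: "u \<in> Cinf" and Ch: "0 < C" "0 < h"
    "\<And>\<alpha> x. cmod (mderiv \<alpha> (fun_of u) x) \<le> C * h ^ mdeg \<alpha> * fact (mdeg \<alpha>) powr s"
    unfolding gevrey_def by blast
  have "cmod (fourier_coeff u \<xi>) \<le> (2 powr s * C) * gdec s (s / 2 * (1 / (CARD('n) * h)) powr (1 / s)) \<xi>" for \<xi>
    by (rule gevrey_coeff_bound[OF u s Ch(2) less_imp_le[OF Ch(1)] Ch(3)])
  moreover have "0 < s / 2 * (1 / (CARD('n) * h)) powr (1 / s)"
    using s Ch(2) by simp
  moreover have "0 \<le> 2 powr s * C"
    using Ch(1) by simp
  ultimately show "u \<in> distributions \<and> (\<exists>A\<ge>0. \<exists>b>0. \<forall>\<xi>. cmod (fourier_coeff u \<xi>) \<le> A * gdec s b \<xi>)"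
    using u unfolding Cinf_iff by blast
next
  assume "u \<in> distributions \<and> (\<exists>A\<ge>0. \<exists>b>0. \<forall>\<xi>. cmod (fourier_coeff u \<xi>) \<le> A * gdec s b \<xi>)"
  then obtain A b where u: "u \<in> distributions" and Ab: "0 \<le> A" "0 < b" "\<And>\<xi>. cmod (fourier_coeff u \<xi>) \<le> A * gdec s b \<xi>"
    by blast
  define S where "S = (\<Sum>\<^sub>\<infinity>\<xi>::int ^ 'n. gdec s (b / 2) \<xi>)"
  have S: "0 \<le> S" by (simp add: S_def infsum_nonneg)
  have h: "0 < (2 * s / b) powr s"
    using s Ab(2) by simp
  note bd = gevrey_deriv_bound[OF u s Ab(2,1,3), folded S_def]
  \<comment> \<open>\<open>gevrey\<close> asks for a positive constant and \<open>A * S\<close> may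
    vanish; hence the \<open>+ 1\<close>.\<close>
  have "cmod (mderiv \<alpha> (fun_of u) x) \<le> (A * S + 1) * ((2 * s / b) powr s) ^ mdeg \<alpha> * fact (mdeg \<alpha>) powr s" for \<alpha> x
    by (rule order_trans[OF bd(2)]) (intro mult_right_mono, use h in auto)
  moreover have "0 < A * S + 1"
    using S Ab(1) by (simp add: add_nonneg_pos)
  ultimately show "u \<in> gevrey s"
    using bd(1) h unfolding gevrey_def by blast
qed

lemma gevrey_subset_distributions: "0 < s \<Longrightarrow> u \<in> gevrey s \<Longrightarrow> u \<in> distributions"
  by (simp add: gevrey_iff)

lemma gevrey_h_subset_gevrey:
  fixes u :: "'n::finite functional"
  assumes "u \<in> gevrey_h h s" "0 < h"
  shows "u \<in> gevrey s"
proof -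
  have u: "u \<in> Cinf" "gevrey_norm h s u < \<infinity>"
    using assms(1) by (auto simp: gevrey_h_def)
  obtain r where r: "gevrey_norm h s u = ennreal r" "0 \<le> r"
    using u(2) by (cases "gevrey_norm h s u") auto
  have "gevrey_norm h s u < ennreal (r + 1)"
    using r by (simp add: ennreal_less_iff)
  from gevrey_norm_less_imp[OF this assms(2)] show ?thesis
    using u(1) r(2) assms(2) unfolding gevrey_def
    by (intro CollectI conjI exI[of _ "r + 1"] exI[of _ h] allI) auto
qed

lemma gevrey_combine:
  fixes u v :: "'n::finite functional"
  assumes "0 < s" "u \<in> gevrey s" "v \<in> gevrey s"
  shows "(\<lambda>\<phi>. a * u \<phi> + b * v \<phi>) \<in> gevrey s"
proof -
  obtain A p where u: "u \<in> distributions" "0 \<le> A" "0 < p" "\<And>\<xi>. cmod (fourier_coeff u \<xi>) \<le> A * gdec s p \<xi>"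
    using assms by (auto simp: gevrey_iff)
  obtain B q where v: "v \<in> distributions" "0 \<le> B" "0 < q" "\<And>\<xi>. cmod (fourier_coeff v \<xi>) \<le> B * gdec s q \<xi>"
    using assms by (auto simp: gevrey_iff)
  define r where "r = min p q"
  have "cmod (fourier_coeff (\<lambda>\<phi>. a * u \<phi> + b * v \<phi>) \<xi>) \<le> (cmod a * A + cmod b * B) * gdec s r \<xi>" for \<xi>
  proof -
    have "cmod (fourier_coeff (\<lambda>\<phi>. a * u \<phi> + b * v \<phi>) \<xi>) \<le> cmod a * cmod (fourier_coeff u \<xi>) + cmod b * cmod (fourier_coeff v \<xi>)"
      unfolding fourier_coeff_def by (rule order_trans[OF norm_triangle_ineq]) (simp add: norm_mult)
    also have "\<dots> \<le> cmod a * (A * gdec s r \<xi>) + cmod b * (B * gdec s r \<xi>)"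
    proof (intro add_mono mult_left_mono)
      show "cmod (fourier_coeff u \<xi>) \<le> A * gdec s r \<xi>"
        by (rule order_trans[OF u(4)]) (intro mult_left_mono gdec_antimono u, simp add: r_def)
      show "cmod (fourier_coeff v \<xi>) \<le> B * gdec s r \<xi>"
        by (rule order_trans[OF v(4)]) (intro mult_left_mono gdec_antimono v, simp add: r_def)
    qed auto
    finally show ?thesis by (simp add: algebra_simps)
  qed
  moreover have "0 < r" "0 \<le> cmod a * A + cmod b * B"
    using u v by (simp_all add: r_def)
  ultimately show ?thesis
    unfolding gevrey_iff[OF assms(1)] using distributions_combine[OF u(1) v(1)] by blast
qed

section \<open>The inductive limit topology and its continuous curves\<close>

lemma openin_gevrey_top: "openin (gevrey_top s) U \<longleftrightarrow> gevrey_open s U"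
  unfolding gevrey_top_def by (simp add: istopology_gevrey_open topology_inverse')

text \<open>
  Any weight that dominates a multiple of every Gevrey decay rate gives a continuous seminorm on the
  inductive limit; these seminorms suffice to bound compact sets.
\<close>

definition gevrey_weight :: "real \<Rightarrow> (nat \<Rightarrow> int ^ 'n::finite) \<Rightarrow> (nat \<Rightarrow> real) \<Rightarrow> bool" where
  "gevrey_weight s \<eta> w \<longleftrightarrow> (\<forall>n. 0 < w n) \<and> (\<forall>b>0. \<exists>\<epsilon>>0. \<forall>n. \<epsilon> * gdec s b (\<eta> n) \<le> w n)"

text \<open>In the step \<open>h\<close> a small norm forces coefficients below a small multiple of
  \<open>gdec s b\<close> with a rate \<open>b\<close> determined by \<open>h\<close>; the weight
  dominates a multiple of exactly that rate.\<close>

lemma gevrey_weight_nhds0: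
  fixes \<eta> :: "nat \<Rightarrow> int ^ 'n::finite"
  assumes s: "0 < s" and w: "gevrey_weight s \<eta> w" and k: "0 < k"
  shows "{u \<in> gevrey s. \<forall>n. cmod (fourier_coeff u (\<eta> n)) \<le> k * w n} \<in> gevrey_nhds0 s" (is "?V \<in> _")
  unfolding gevrey_nhds0_def
proof (intro CollectI conjI allI impI)
  show "abs_convex ?V"
    unfolding abs_convex_def
  proof (intro ballI allI impI)
    fix u v :: "'n functional" and a b :: complex
    assume u: "u \<in> ?V" and v: "v \<in> ?V" and ab: "cmod a + cmod b \<le> 1"
    have "cmod (fourier_coeff (\<lambda>\<phi>. a * u \<phi> + b * v \<phi>) (\<eta> n)) \<le> k * w n" for n
    proof -
      have "cmod (fourier_coeff (\<lambda>\<phi>. a * u \<phi> + b * v \<phi>) (\<eta> n))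
          \<le> cmod a * cmod (fourier_coeff u (\<eta> n)) + cmod b * cmod (fourier_coeff v (\<eta> n))"
        unfolding fourier_coeff_def by (rule order_trans[OF norm_triangle_ineq]) (simp add: norm_mult)
      also have "\<dots> \<le> cmod a * (k * w n) + cmod b * (k * w n)"
        using u v by (intro add_mono mult_left_mono) auto
      also have "\<dots> = (cmod a + cmod b) * (k * w n)"
        by (simp add: distrib_right)
      also have "\<dots> \<le> 1 * (k * w n)"
        using w k unfolding gevrey_weight_def by (intro mult_right_mono ab) (simp add: less_imp_le)
      finally show ?thesis by simp
    qed
    then show "(\<lambda>\<phi>. a * u \<phi> + b * v \<phi>) \<in> ?V"
      using gevrey_combine[OF s] u v by blast
  qed
next
  fix h :: real assume h: "0 < h"
  define b where "b = s / 2 * (1 / (CARD('n) * h)) powr (1 / s)"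
  have "0 < b" using s h by (simp add: b_def)
  then obtain \<epsilon>0 where \<epsilon>0: "0 < \<epsilon>0" "\<And>n. \<epsilon>0 * gdec s b (\<eta> n) \<le> w n"
    using w unfolding gevrey_weight_def by blast
  define \<epsilon> where "\<epsilon> = k * \<epsilon>0 / 2 powr s"
  have \<epsilon>: "0 < \<epsilon>" using \<epsilon>0 k by (simp add: \<epsilon>_def)
  have "u \<in> ?V" if u: "u \<in> gevrey_h h s" "gevrey_norm h s u < ennreal \<epsilon>" for u
  proof -
    have "u \<in> Cinf" using u(1) by (simp add: gevrey_h_def)
    from gevrey_coeff_bound[OF this s h less_imp_le[OF \<epsilon>] gevrey_norm_less_imp[OF u(2) h \<epsilon>], folded b_def]
    have "cmod (fourier_coeff u (\<eta> n)) \<le> k * (\<epsilon>0 * gdec s b (\<eta> n))" for n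
      by (simp add: \<epsilon>_def mult.assoc)
    then have "cmod (fourier_coeff u (\<eta> n)) \<le> k * w n" for n
      using mult_left_mono[OF \<epsilon>0(2)[of n], of k] k order_trans by (meson less_imp_le)
    then show ?thesis
      using gevrey_h_subset_gevrey[OF u(1) h] by blast
  qed
  then show "\<exists>\<epsilon>>0. {u \<in> gevrey_h h s. gevrey_norm h s u < ennreal \<epsilon>} \<subseteq> ?V"
    using \<epsilon> by (intro exI[of _ \<epsilon>]) blast
qed auto

text \<open>The case of one frequency, which makes each single Fourier coefficient continuous on the
  inductive limit.\<close>

lemma gevrey_weight_const: "0 < e \<Longrightarrow> gevrey_weight s (\<lambda>_. \<xi>) (\<lambda>_. e)"
  unfolding gevrey_weight_def
  by (auto intro!: exI[of _ e] simp: gdec_le_1 mult_left_le)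

lemma topspace_gevrey_top:
  assumes "0 < s"
  shows "topspace (gevrey_top s) = (gevrey s :: 'n::finite functional set)"
proof
  show "topspace (gevrey_top s) \<subseteq> (gevrey s :: 'n functional set)"
    using openin_topspace[of "gevrey_top s"] unfolding openin_gevrey_top gevrey_open_def by blast
  have "gevrey_open s (gevrey s :: 'n functional set)"
    unfolding gevrey_open_def
    by (intro conjI ballI bexI[OF _ gevrey_weight_nhds0[OF assms gevrey_weight_const[of 1 s 0] zero_less_one]]) auto
  then show "(gevrey s :: 'n functional set) \<subseteq> topspace (gevrey_top s)"
    using openin_subset unfolding openin_gevrey_top[symmetric] by blast
qed

text \<open>A margin \<open>r < 1\<close> common to all \<open>n\<close>, rather than a strict
  inequality for each \<open>n\<close>, leaves room for a whole neighbourhood, of size half of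
  \<open>1 - r\<close>.\<close>

lemma gevrey_weight_open:
  fixes \<eta> :: "nat \<Rightarrow> int ^ 'n::finite"
  assumes s: "0 < s" and w: "gevrey_weight s \<eta> w"
  shows "openin (gevrey_top s) {v \<in> gevrey s. \<exists>r<1. \<forall>n. cmod (fourier_coeff v (\<eta> n) - z n) \<le> r * w n}"
    (is "openin _ ?U")
  unfolding openin_gevrey_top gevrey_open_def
proof (intro conjI ballI)
  fix v assume "v \<in> ?U"
  then obtain r where v: "v \<in> gevrey s" "r < 1" "\<And>n. cmod (fourier_coeff v (\<eta> n) - z n) \<le> r * w n"
    by blast
  define k where "k = (1 - r) / 2"
  have k: "0 < k" "r + k < 1"
    using v(2) by (simp_all add: k_def field_simps)
  let ?V = "{u \<in> gevrey s. \<forall>n. cmod (fourier_coeff u (\<eta> n)) \<le> k * w n}"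
  have "v' \<in> ?U" if v': "v' \<in> gevrey s" "v' - v \<in> ?V" for v'
  proof -
    have "cmod (fourier_coeff v' (\<eta> n) - z n) \<le> (r + k) * w n" for n
    proof -
      have "cmod (fourier_coeff v' (\<eta> n) - fourier_coeff v (\<eta> n)) \<le> k * w n"
        using v'(2) by simp
      then show ?thesis
        using norm_diff_triangle_ineq'[of "fourier_coeff v' (\<eta> n)" "z n" "fourier_coeff v (\<eta> n)"] v(3)[of n]
        by (simp add: distrib_right)
    qed
    then show ?thesis
      using v'(1) k(2) by blast
  qed
  then show "\<exists>V\<in>gevrey_nhds0 s. {v' \<in> gevrey s. v' - v \<in> V} \<subseteq> ?U"
    by (intro bexI[OF _ gevrey_weight_nhds0[OF s w k(1)]]) blast
qed auto

lemma C_maps_gevrey_local: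
  fixes f :: "real \<Rightarrow> 'n::finite functional"
  assumes s: "0 < s" and f: "f \<in> C_maps T (gevrey_top s)" and w: "gevrey_weight s \<eta> w" and t: "t \<in> {0..T}"
  obtains d where "0 < d" "\<And>t' n. t' \<in> {0..T} \<Longrightarrow> dist t' t < d \<Longrightarrow>
    cmod (fourier_coeff (f t') (\<eta> n) - fourier_coeff (f t) (\<eta> n)) \<le> w n"
proof -
  let ?U = "{v \<in> gevrey s. \<exists>r<1. \<forall>n. cmod (fourier_coeff v (\<eta> n) - fourier_coeff (f t) (\<eta> n)) \<le> r * w n}"
  have ft: "f t \<in> gevrey s"
    using f t continuous_map_image_subset_topspace[of "top_of_set {0..T}" "gevrey_top s" f]
    by (auto simp: C_maps_def image_subset_iff topspace_gevrey_top[OF s])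
  have "openin (top_of_set {0..T}) {t' \<in> topspace (top_of_set {0..T}). f t' \<in> ?U}"
    using f gevrey_weight_open[OF s w] unfolding C_maps_def by (intro openin_continuous_map_preimage) auto
  then have op: "openin (top_of_set {0..T}) {t' \<in> {0..T}. f t' \<in> ?U}"
    by simp
  have "t \<in> {t' \<in> {0..T}. f t' \<in> ?U}"
    using t ft by (intro CollectI conjI exI[of _ 0]) simp_all
  with op obtain d where d: "0 < d" "\<forall>t'\<in>{0..T}. dist t' t < d \<longrightarrow> t' \<in> {t' \<in> {0..T}. f t' \<in> ?U}"
    unfolding openin_euclidean_subtopology_iff by meson
  have "cmod (fourier_coeff (f t') (\<eta> n) - fourier_coeff (f t) (\<eta> n)) \<le> w n" if t': "t' \<in> {0..T}" "dist t' t < d" for t' n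
  proof -
    obtain r where r: "r < 1" "cmod (fourier_coeff (f t') (\<eta> n) - fourier_coeff (f t) (\<eta> n)) \<le> r * w n"
      using d(2)[rule_format, OF t'] by blast
    have "r * w n \<le> 1 * w n"
      using r(1) w unfolding gevrey_weight_def by (intro mult_right_mono) (simp_all add: less_imp_le)
    then show ?thesis
      using r(2) by simp
  qed
  then show ?thesis
    using that d(1) by blast
qed

lemma C_maps_gevrey_mem:
  assumes "0 < s" "f \<in> C_maps T (gevrey_top s)" "t \<in> {0..T}"
  shows "f t \<in> gevrey s"
  using assms(2,3) continuous_map_image_subset_topspace[of "top_of_set {0..T}" "gevrey_top s" f]
  by (auto simp: C_maps_def image_subset_iff topspace_gevrey_top[OF assms(1)])

lemma C_maps_gevrey_coeff:
  fixes f :: "real \<Rightarrow> 'n::finite functional"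
  assumes s: "0 < s" and f: "f \<in> C_maps T (gevrey_top s)"
  shows "continuous_on {0..T} (\<lambda>t. fourier_coeff (f t) \<xi>)"
  unfolding continuous_on_iff
proof (intro ballI allI impI)
  fix t and e :: real assume t: "t \<in> {0..T}" and "0 < e"
  then have "0 < e / 2" by simp
  obtain d where d: "0 < d" "\<And>t' n::nat. t' \<in> {0..T} \<Longrightarrow> dist t' t < d \<Longrightarrow>
      cmod (fourier_coeff (f t') \<xi> - fourier_coeff (f t) \<xi>) \<le> e / 2"
    using C_maps_gevrey_local[OF s f gevrey_weight_const[OF \<open>0 < e / 2\<close>] t, of \<xi>] by blast
  then show "\<exists>d>0. \<forall>x'\<in>{0..T}. dist x' t < d \<longrightarrow> dist (fourier_coeff (f x') \<xi>) (fourier_coeff (f t) \<xi>) < e"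
    using \<open>0 < e\<close> by (intro exI[of _ d]) (fastforce simp: dist_norm)
qed

text \<open>If no common constant and rate existed, then for each \<open>n\<close> the constant
  \<open>n + 1\<close> and the rate \<open>1 / (n + 1)\<close> would fail at some time
  \<open>tn n\<close> and frequency \<open>\<eta> n\<close>. The failing rates tend to 0, so they
  form a weight \<open>w\<close> that is eventually slower than any fixed Gevrey decay. At a limit
  point \<open>t\<close> of the times, continuity in the seminorm of \<open>w\<close> and the decay
  of \<open>f t\<close> bound the offending coefficients by a fixed multiple of \<open>w n\<close>,
  which contradicts the factor \<open>n + 1\<close>.\<close>

lemma C_maps_gevrey_bounded:
  fixes f :: "real \<Rightarrow> 'n::finite functional"
  assumes s: "0 < s" and f: "f \<in> C_maps T (gevrey_top s)"
  obtains A b where "0 \<le> A" "0 < b" "\<And>t \<xi>. t \<in> {0..T} \<Longrightarrow> cmod (fourier_coeff (f t) \<xi>) \<le> A * gdec s b \<xi>"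
proof (rule ccontr)
  assume "\<not> thesis"
  then have "\<exists>t \<xi>. t \<in> {0..T} \<and> real (Suc n) * gdec s (1 / Suc n) \<xi> < cmod (fourier_coeff (f t) \<xi>)" for n
    using that[of "real (Suc n)" "1 / Suc n"] by (metis not_le of_nat_0_le_iff of_nat_0_less_iff zero_less_Suc zero_less_divide_1_iff)
  then obtain tn \<eta> where tn: "\<And>n. tn n \<in> {0..T}"
    and big: "\<And>n. real (Suc n) * gdec s (1 / Suc n) (\<eta> n) < cmod (fourier_coeff (f (tn n)) (\<eta> n))"
    by metis
  define w where "w n = gdec s (1 / Suc n) (\<eta> n)" for n
  have w: "gevrey_weight s \<eta> w"
    unfolding gevrey_weight_def
  proof (intro conjI allI impI)
    fix b :: real assume b: "0 < b"
    then obtain m where m: "inverse (real (Suc m)) < b"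
      using reals_Archimedean by blast
    \<comment> \<open>From index \<open>m\<close> on the rate \<open>1 / (n + 1)\<close> is below
      \<open>b\<close>; the finitely many earlier terms are covered by the minimum.\<close>
    define \<epsilon> where "\<epsilon> = Min (insert 1 (w ` {..<m}))"
    have \<epsilon>: "0 < \<epsilon>" "\<epsilon> \<le> 1"
      by (auto simp: \<epsilon>_def w_def)
    have "\<epsilon> * gdec s b (\<eta> n) \<le> w n" for n
    proof (cases "n < m")
      case True
      then have "\<epsilon> \<le> w n" by (auto simp: \<epsilon>_def)
      moreover have "\<epsilon> * gdec s b (\<eta> n) \<le> \<epsilon> * 1"
        using \<epsilon> b by (intro mult_left_mono gdec_le_1) auto
      ultimately show ?thesis by simp
    next
      case False
      then have "1 / real (Suc n) \<le> b"
        using m by (intro order_trans[OF _ less_imp_le[OF m]]) (simp add: divide_simps)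
      then have "gdec s b (\<eta> n) \<le> w n"
        unfolding w_def by (rule gdec_antimono)
      moreover have "\<epsilon> * gdec s b (\<eta> n) \<le> 1 * gdec s b (\<eta> n)"
        using \<epsilon> by (intro mult_right_mono) auto
      ultimately show ?thesis by linarith
    qed
    then show "\<exists>\<epsilon>>0. \<forall>n. \<epsilon> * gdec s b (\<eta> n) \<le> w n"
      using \<epsilon> by blast
  qed (simp add: w_def)
  obtain t r where t: "t \<in> {0..T}" and r: "strict_mono r" and lim: "(tn \<circ> r) \<longlonglongrightarrow> t"
    using compact_Icc[of 0 T] tn unfolding compact_def by metis
  obtain d where d: "0 < d" "\<And>t' n. t' \<in> {0..T} \<Longrightarrow> dist t' t < d \<Longrightarrow>
      cmod (fourier_coeff (f t') (\<eta> n) - fourier_coeff (f t) (\<eta> n)) \<le> w n"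
    using C_maps_gevrey_local[OF s f w t] by blast
  obtain A b where Ab: "0 \<le> A" "0 < b" "\<And>\<xi>. cmod (fourier_coeff (f t) \<xi>) \<le> A * gdec s b \<xi>"
    using C_maps_gevrey_mem[OF s f t] unfolding gevrey_iff[OF s] by blast
  obtain \<epsilon> where \<epsilon>: "0 < \<epsilon>" "\<And>n. \<epsilon> * gdec s b (\<eta> n) \<le> w n"
    using w Ab(2) unfolding gevrey_weight_def by blast
  have ft: "cmod (fourier_coeff (f t) (\<eta> n)) \<le> A / \<epsilon> * w n" for n
  proof -
    have "A * gdec s b (\<eta> n) = A / \<epsilon> * (\<epsilon> * gdec s b (\<eta> n))"
      using \<epsilon>(1) by simp
    also have "\<dots> \<le> A / \<epsilon> * w n"
      using Ab(1) \<epsilon> by (intro mult_left_mono) auto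
    finally show ?thesis
      using Ab(3)[of "\<eta> n"] by linarith
  qed
  obtain k0 where k0: "\<And>k. k0 \<le> k \<Longrightarrow> dist (tn (r k)) t < d"
    using lim d(1) unfolding lim_sequentially o_def by blast
  obtain k1 :: nat where k1: "A / \<epsilon> + 1 < real k1"
    using reals_Archimedean2 by blast
  \<comment> \<open>Beyond \<open>k0\<close> the time is close to \<open>t\<close>, beyond
    \<open>k1\<close> the factor \<open>n + 1\<close> is too large; a strictly increasing
    \<open>r\<close> satisfies \<open>k \<le> r k\<close>, so this index does both.\<close>
  define n where "n = r (max k0 k1)"
  have "k1 \<le> n"
    using seq_suble[OF r, of "max k0 k1"] by (simp add: n_def)
  have "cmod (fourier_coeff (f (tn n)) (\<eta> n)) \<le> cmod (fourier_coeff (f (tn n)) (\<eta> n) - fourier_coeff (f t) (\<eta> n)) + cmod (fourier_coeff (f t) (\<eta> n))"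
    using norm_triangle_sub add.commute by metis
  also have "\<dots> \<le> w n + A / \<epsilon> * w n"
    by (intro add_mono d(2) tn ft) (simp add: n_def k0)
  also have "\<dots> = (A / \<epsilon> + 1) * w n"
    by (simp add: algebra_simps)
  also have "\<dots> \<le> real (Suc n) * w n"
    using k1 \<open>k1 \<le> n\<close> by (intro mult_right_mono) (auto simp: w_def)
  also have "\<dots> < cmod (fourier_coeff (f (tn n)) (\<eta> n))"
    using big[of n] by (simp add: w_def)
  finally show False by simp
qed

text \<open>Half of the rate \<open>b\<close> is given up: the spare half makes all but finitely
  many frequencies negligible, the remaining half keeps every difference in one Banach step.
  Continuity into that step implies continuity into the limit.\<close>

lemma C_maps_gevreyI:
  fixes f :: "real \<Rightarrow> 'n::finite functional"
  assumes s: "0 < s" and dist: "\<And>t. t \<in> {0..T} \<Longrightarrow> f t \<in> distributions"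
    and A: "0 \<le> A" and b: "0 < b"
    and bd: "\<And>t \<xi>. t \<in> {0..T} \<Longrightarrow> cmod (fourier_coeff (f t) \<xi>) \<le> A * gdec s b \<xi>"
    and cont: "\<And>\<xi>. continuous_on {0..T} (\<lambda>t. fourier_coeff (f t) \<xi>)"
  shows "f \<in> C_maps T (gevrey_top s)"
proof -
  have mem: "f t \<in> gevrey s" if "t \<in> {0..T}" for t
    unfolding gevrey_iff[OF s] using dist bd A b that by blast
  have "openin (top_of_set {0..T}) (f -` U \<inter> topspace (top_of_set {0..T}))" if U: "openin (gevrey_top s) U" for U
    unfolding openin_euclidean_subtopology_iff
  proof (intro conjI ballI)
    fix t assume "t \<in> f -` U \<inter> topspace (top_of_set {0..T})"
    then have t: "t \<in> {0..T}" "f t \<in> U" by auto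
    obtain V where V: "V \<in> gevrey_nhds0 s" "{v \<in> gevrey s. v - f t \<in> V} \<subseteq> U"
      using U t(2) unfolding openin_gevrey_top gevrey_open_def by blast
    \<comment> \<open>The step that \<open>gevrey_deriv_bound\<close> yields for coefficients of
      rate \<open>b / 2\<close>.\<close>
    define h where "h = (2 * s / (b / 2)) powr s"
    have h: "0 < h" using s b by (simp add: h_def)
    obtain \<epsilon> where \<epsilon>: "0 < \<epsilon>" "{u \<in> gevrey_h h s. gevrey_norm h s u < ennreal \<epsilon>} \<subseteq> V"
      using V(1) h unfolding gevrey_nhds0_def by blast
    define S where "S = (\<Sum>\<^sub>\<infinity>\<xi>::int ^ 'n. gdec s (b / 2 / 2) \<xi>)"
    have S: "0 \<le> S" by (simp add: S_def infsum_nonneg)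
    define e where "e = \<epsilon> / (S + 1)"
    have e: "0 < e" using \<epsilon> S by (simp add: e_def)
    have eS: "e * S < \<epsilon>"
      using \<epsilon> S by (simp add: e_def field_simps)
    obtain C where C: "\<And>\<xi>::int ^ 'n. gdec s (b / 2) \<xi> * jap \<xi> ^ 1 \<le> C"
      using gdec_decay[of s "b / 2" 1] s b by auto
    have half: "gdec s b \<xi> = gdec s (b / 2) \<xi> * gdec s (b / 2) \<xi>" for \<xi> :: "int ^ 'n"
      unfolding gdec_add[symmetric] by simp
    have fin: "finite {\<xi>::int ^ 'n. e / 2 * gdec s (b / 2) \<xi> < A * gdec s b \<xi>}"
    proof (rule finite_subset[OF _ finite_jap_le[of "2 * A * C / e"]], intro subsetI CollectI)
      fix \<xi> :: "int ^ 'n" assume "\<xi> \<in> {\<xi>. e / 2 * gdec s (b / 2) \<xi> < A * gdec s b \<xi>}"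
      then have "(e / 2) * gdec s (b / 2) \<xi> < (A * gdec s (b / 2) \<xi>) * gdec s (b / 2) \<xi>"
        by (simp add: half mult.assoc)
      then have "e / 2 \<le> A * gdec s (b / 2) \<xi>"
        by (auto dest: mult_right_less_imp_less)
      then have "e / 2 * jap \<xi> \<le> A * gdec s (b / 2) \<xi> * jap \<xi>"
        by (intro mult_right_mono) auto
      also have "\<dots> \<le> A * C"
        using mult_left_mono[OF C[of \<xi>] A] by (simp add: mult.assoc)
      finally show "jap \<xi> \<le> 2 * A * C / e"
        using e by (simp add: field_simps)
    qed
    obtain d where d: "0 < d" "\<And>t' \<xi>. t' \<in> {0..T} \<Longrightarrow> dist t' t < d \<Longrightarrow>
        cmod (fourier_coeff (f t') \<xi> - fourier_coeff (f t) \<xi>) \<le> e * gdec s (b / 2) \<xi>"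
      using uniform_weighted_continuity[OF bd cont gdec_pos fin t(1) e] by blast
    have "t' \<in> f -` U \<inter> topspace (top_of_set {0..T})" if t': "t' \<in> {0..T}" "dist t' t < d" for t'
    proof -
      have dd: "f t' - f t \<in> distributions"
        by (intro distributions_diff dist t' t)
      have "cmod (fourier_coeff (f t' - f t) \<xi>) \<le> e * gdec s (b / 2) \<xi>" for \<xi>
        using d(2)[OF t'] by simp
      note gb = gevrey_deriv_bound[OF dd s _ less_imp_le[OF e] this, folded S_def h_def]
      have "gevrey_norm h s (f t' - f t) \<le> ennreal (e * S)"
        using gb(2) b h by (intro gevrey_norm_le) auto
      also have "\<dots> < ennreal \<epsilon>"
        using eS e S by (simp add: ennreal_less_iff)
      finally have "gevrey_norm h s (f t' - f t) < ennreal \<epsilon>" .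
      moreover from this have "gevrey_norm h s (f t' - f t) < \<infinity>"
        using less_trans ennreal_less_top by (metis infinity_ennreal_def)
      ultimately have "f t' - f t \<in> V"
        using \<epsilon>(2) gb(1) b unfolding gevrey_h_def by auto
      then show ?thesis
        using V(2) mem[OF t'(1)] t'(1) by auto
    qed
    then show "\<exists>d>0. \<forall>t'\<in>{0..T}. dist t' t < d \<longrightarrow> t' \<in> f -` U \<inter> topspace (top_of_set {0..T})"
      using d(1) by blast
  qed auto
  then show ?thesis
    unfolding C_maps_def mem_Collect_eq continuous_map_alt
    using mem by (auto simp: topspace_gevrey_top[OF s])
qed

section \<open>Inclusions between spaces of curves\<close>

lemma C_maps_gevrey_subset_Cinf:
  fixes f :: "real \<Rightarrow> 'n::finite functional"
  assumes s: "0 < s" and f: "f \<in> C_maps T (gevrey_top s)"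
  shows "f \<in> C_maps T Cinf_top"
  unfolding C_maps_Cinf_iff
proof (intro allI C_maps_sobI C_maps_gevrey_coeff[OF s f])
  obtain A b where Ab: "0 \<le> A" "0 < b" "\<And>t \<xi>. t \<in> {0..T} \<Longrightarrow> cmod (fourier_coeff (f t) \<xi>) \<le> A * gdec s b \<xi>"
    using C_maps_gevrey_bounded[OF s f] by blast
  fix m
  show "\<exists>C. \<forall>t\<in>{0..T}. \<forall>\<xi>. cmod (fourier_coeff (f t) \<xi>) * jap \<xi> ^ m \<le> C"
    using gdec_bound_decay[OF s Ab(2,1), of m, where 'n = 'n] Ab(3) by meson
next
  fix t assume "t \<in> {0..T}"
  then show "f t \<in> distributions"
    using C_maps_gevrey_mem[OF s f] gevrey_subset_distributions[OF s] by blast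
qed

text \<open>The power \<open>1 / s1\<close> of a length is at most 1 plus its power
  \<open>1 / s2\<close>; the 1 is needed for lengths below 1 and turns into the factor
  \<open>exp b\<close>.\<close>

lemma gdec_change_order:
  fixes \<xi> :: "int ^ 'n::finite"
  assumes "0 < s2" "s2 \<le> s1" "0 < b"
  shows "gdec s2 b \<xi> \<le> exp b * gdec s1 b \<xi>"
proof -
  define x where "x = norm (freq \<xi>)"
  have "x powr (1 / s1) \<le> 1 + x powr (1 / s2)"
  proof (cases "x \<le> 1")
    case True
    then have "x powr (1 / s1) \<le> 1 powr (1 / s1)"
      using assms by (intro powr_mono2) (auto simp: x_def)
    then show ?thesis
      by (simp add: add_increasing2)
  next
    case False
    then have "x powr (1 / s1) \<le> x powr (1 / s2)"
      using assms by (intro powr_mono) (auto simp: frac_le)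
    then show ?thesis by simp
  qed
  then have "b * x powr (1 / s1) \<le> b * (1 + x powr (1 / s2))"
    using assms by (intro mult_left_mono) auto
  then have "- b * x powr (1 / s2) \<le> b + - b * x powr (1 / s1)"
    by (simp add: algebra_simps)
  then show ?thesis
    by (simp add: gdec_def x_def flip: exp_add)
qed

text \<open>Goes through the coefficient criterion in both directions instead of comparing the two
  inductive limit topologies.\<close>

lemma C_maps_gevrey_mono:
  fixes f :: "real \<Rightarrow> 'n::finite functional"
  assumes s: "0 < s2" "s2 \<le> s1" and f: "f \<in> C_maps T (gevrey_top s2)"
  shows "f \<in> C_maps T (gevrey_top s1)"
proof -
  obtain A b where Ab: "0 \<le> A" "0 < b" "\<And>t \<xi>. t \<in> {0..T} \<Longrightarrow> cmod (fourier_coeff (f t) \<xi>) \<le> A * gdec s2 b \<xi>"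
    using C_maps_gevrey_bounded[OF s(1) f] by blast
  show ?thesis
  proof (rule C_maps_gevreyI)
    show "f t \<in> distributions" if "t \<in> {0..T}" for t
      using C_maps_gevrey_mem[OF s(1) f that] gevrey_subset_distributions[OF s(1)] by blast
    show "cmod (fourier_coeff (f t) \<xi>) \<le> A * exp b * gdec s1 b \<xi>" if "t \<in> {0..T}" for t \<xi>
      using Ab(3)[OF that, of \<xi>] mult_left_mono[OF gdec_change_order[OF s Ab(2), of \<xi>] Ab(1)]
      by (simp add: mult.assoc)
  qed (use s Ab C_maps_gevrey_coeff[OF s(1) f] in auto)
qed

lemma gevrey_subset_Cinf: "gevrey s \<subseteq> Cinf"
  by (auto simp: gevrey_def)

lemma gevrey_mono:
  assumes "0 < s2" "s2 \<le> s1"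
  shows "gevrey s2 \<subseteq> (gevrey s1 :: 'n::finite functional set)"
proof
  fix u :: "'n functional" assume "u \<in> gevrey s2"
  then obtain A b where u: "u \<in> distributions" "0 \<le> A" "0 < b" "\<And>\<xi>. cmod (fourier_coeff u \<xi>) \<le> A * gdec s2 b \<xi>"
    unfolding gevrey_iff[OF assms(1)] by blast
  have "cmod (fourier_coeff u \<xi>) \<le> A * exp b * gdec s1 b \<xi>" for \<xi>
    using u(4)[of \<xi>] mult_left_mono[OF gdec_change_order[OF assms u(3), of \<xi>] u(2)]
    by (simp add: mult.assoc)
  moreover have "0 \<le> A * exp b" "0 < s1" using u assms by auto
  ultimately show "u \<in> gevrey s1"
    using u(1,3) by (auto simp: gevrey_iff)
qed

section \<open>The Cauchy problem\<close>

lemma fc_fmode: "fc (fmode \<xi>) \<eta> = (if \<eta> = \<xi> then 1 else 0)"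
  unfolding fmode_eq_fser by (simp add: fc_fser rapid_single)

text \<open>The function \<open>c * fmode \<xi>\<close> as a distribution; on such distributions the
  Cauchy problem is a scalar ODE.\<close>

definition dmode :: "int ^ 'n::finite \<Rightarrow> complex \<Rightarrow> 'n functional" where
  "dmode \<xi> c = (\<lambda>\<psi>. c * distr_of (fmode \<xi>) \<psi>)"

lemma dmode_distributions: "dmode \<xi> c \<in> distributions"
  using distributions_combine[OF distr_of_distributions[OF fmode_smooth] distr_of_distributions[OF fmode_smooth], of c \<xi> 0]
  by (simp add: dmode_def)

lemma fourier_coeff_dmode: "fourier_coeff (dmode \<xi> c) \<eta> = (if \<eta> = \<xi> then c else 0)"
  using fc_fmode[of \<xi> \<eta>] by (simp add: dmode_def fourier_coeff_def)

lemma dmode_apply: "\<psi> \<in> smooth_torus \<Longrightarrow> dmode \<xi> c \<psi> = c * fc \<psi> (- \<xi>)"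
  by (simp only: dmode_def fc_eq) (simp add: distr_of_def mult.commute)

lemma C_maps_dmode:
  fixes \<xi> :: "int ^ 'n::finite"
  assumes s: "0 < s" and c: "continuous_on {0..T} c"
  shows "(\<lambda>t. dmode \<xi> (c t)) \<in> C_maps T (gevrey_top s)"
proof -
  have "bounded (c ` {0..T})"
    by (intro compact_imp_bounded compact_continuous_image c compact_Icc)
  then obtain B where B: "0 < B" "\<And>t. t \<in> {0..T} \<Longrightarrow> cmod (c t) \<le> B"
    unfolding bounded_pos by auto
  \<comment> \<open>Dividing by the value of \<open>gdec\<close> at \<open>\<xi>\<close> suffices,
    as all other coefficients vanish.\<close>
  have B': "cmod (fourier_coeff (dmode \<xi> (c t)) \<eta>) \<le> B / gdec s 1 \<xi> * gdec s 1 \<eta>" if "t \<in> {0..T}" for t \<eta>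
    using B that by (auto simp: fourier_coeff_dmode)
  show ?thesis
  proof (rule C_maps_gevreyI[OF s dmode_distributions _ zero_less_one B'])
    show "continuous_on {0..T} (\<lambda>t. fourier_coeff (dmode \<xi> (c t)) \<eta>)" for \<eta>
      unfolding fourier_coeff_dmode by (cases "\<eta> = \<xi>") (use c in simp_all)
  qed (use B in auto)
qed

lemma dmode_gevrey:
  assumes "0 < s"
  shows "dmode \<xi> c \<in> gevrey s"
  using C_maps_gevrey_mem[OF assms C_maps_dmode[OF assms, of 0 "\<lambda>_. c" \<xi>], of 0] by simp

text \<open>The full symbol of the spatial operator: the negative Laplacian contributes the squared
  length of \<open>\<xi>\<close>, each \<open>distr_D j\<close> the component
  \<open>\<xi> $ j\<close>.\<close>

definition symbol ::
    "(real \<Rightarrow> complex) \<Rightarrow> ('n::finite \<Rightarrow> real \<Rightarrow> complex) \<Rightarrow> (real \<Rightarrow> complex) \<Rightarrow> int ^ 'n \<Rightarrow> real \<Rightarrow> complex" where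
  "symbol a2 a1 a0 \<xi> t = a2 t * (\<Sum>j\<in>UNIV. (of_int (\<xi> $ j))\<^sup>2) + (\<Sum>j\<in>UNIV. a1 j t * of_int (\<xi> $ j)) + a0 t"

lemma symbol_continuous:
  assumes "continuous_on S a2" "\<And>j. continuous_on S (a1 j)" "continuous_on S a0"
  shows "continuous_on S (symbol a2 a1 a0 \<xi>)"
  unfolding symbol_def[abs_def] by (intro continuous_intros assms)

text \<open>The hypotheses say only that, as far as \<open>u\<close> sees, \<open>\<psi>\<close>
  behaves like the mode of frequency \<open>- \<xi>\<close>. This covers a one-frequency
  distribution with any test function and any distribution with a single test mode.\<close>

lemma spatial_op_symbol:
  assumes \<psi>: "\<psi> \<in> smooth_torus"
    and 1: "\<And>j. u (pd j \<psi>) = - \<i> * of_int (\<xi> $ j) * u \<psi>"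
    and 2: "\<And>j. u (pd j (pd j \<psi>)) = - (of_int (\<xi> $ j))\<^sup>2 * u \<psi>"
  shows "spatial_op a2 a1 a0 t u \<psi> = symbol a2 a1 a0 \<xi> t * u \<psi>"
proof -
  have "distr_laplace u \<psi> = - (\<Sum>j\<in>UNIV. (of_int (\<xi> $ j))\<^sup>2) * u \<psi>"
    by (simp add: distr_laplace_def distr_pd_def \<psi> pd_smooth 2 sum_distrib_right sum_negf)
  moreover have "distr_D j u \<psi> = of_int (\<xi> $ j) * u \<psi>" for j
    by (simp add: distr_D_def distr_pd_def \<psi> 1 mult.assoc)
  ultimately show ?thesis
    by (simp add: spatial_op_def symbol_def distrib_right sum_distrib_right mult.assoc)
qed

lemma spatial_op_dmode:
  assumes "\<psi> \<in> smooth_torus"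
  shows "spatial_op a2 a1 a0 t (dmode \<xi> c) \<psi> = symbol a2 a1 a0 \<xi> t * dmode \<xi> c \<psi>"
  using assms
  by (intro spatial_op_symbol) (simp_all add: dmode_apply pd_smooth fc_pd power2_eq_square algebra_simps)

lemma spatial_op_fmode:
  assumes u: "u \<in> distributions"
  shows "spatial_op a2 a1 a0 t u (fmode (- \<xi>)) = symbol a2 a1 a0 \<xi> t * fourier_coeff u \<xi>"
proof -
  have pd2: "pd j (pd j (fmode (- \<xi>))) = (\<lambda>x. - (of_int (\<xi> $ j))\<^sup>2 * fmode (- \<xi>) x)" for j
  proof -
    have "pd j (pd j (fmode (- \<xi>))) = fser (\<lambda>\<eta>. if \<eta> = - \<xi> then - (of_int (\<xi> $ j))\<^sup>2 else 0)"
      unfolding fmode_eq_fser pd_fser[OF rapid_single] pd_fser[OF rapid_deriv[OF rapid_single]]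
      by (rule arg_cong[of _ _ fser]) (auto simp: fun_eq_iff power2_eq_square mult_ac)
    then show ?thesis
      by (simp add: fser_single)
  qed
  have pd1: "pd j (fmode (- \<xi>)) = (\<lambda>x. - \<i> * of_int (\<xi> $ j) * fmode (- \<xi>) x)" for j
    by (simp add: pd_fmode)
  show ?thesis
    unfolding fourier_coeff_fmode
  proof (rule spatial_op_symbol[OF fmode_smooth])
    show "u (pd j (fmode (- \<xi>))) = - \<i> * of_int (\<xi> $ j) * u (fmode (- \<xi>))" for j
      unfolding pd1 by (rule distributions_scale[OF u fmode_smooth])
    show "u (pd j (pd j (fmode (- \<xi>)))) = - (of_int (\<xi> $ j))\<^sup>2 * u (fmode (- \<xi>))" for j
      unfolding pd2 by (rule distributions_scale[OF u fmode_smooth])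
  qed
qed

text \<open>Every term of the weak equation carries the factor \<open>fc \<psi> (- \<xi>)\<close>,
  which is 1 for the test function \<open>fmode (- \<xi>)\<close>. What remains is the weak form of
  the scalar ODE.\<close>

lemma solves_CP_dmode_iff:
  fixes \<xi> :: "int ^ 'n::finite"
  assumes s: "continuous_on {0..T} c"
  shows "solves_CP T a2 a1 a0 (\<lambda>t. dmode \<xi> (f0 t)) (dmode \<xi> g0) (\<lambda>t. dmode \<xi> (c t)) \<longleftrightarrow>
    c 0 = g0 \<and> (\<forall>\<phi>\<in>time_tests T.
      integral {0..T} (\<lambda>t. c t * - (1 / \<i> * time_deriv \<phi> t)) + integral {0..T} (\<lambda>t. symbol a2 a1 a0 \<xi> t * c t * \<phi> t)
      = integral {0..T} (\<lambda>t. f0 t * \<phi> t))" (is "?L \<longleftrightarrow> _ \<and> (\<forall>\<phi>\<in>_. ?W \<phi>)")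
proof -
  have cont: "\<exists>\<rho>. (\<lambda>t. dmode \<xi> (c t)) \<in> C_maps T (sob_top \<rho>)"
    using C_maps_gevrey_subset_Cinf[OF zero_less_one C_maps_dmode[OF zero_less_one s], of \<xi>]
    unfolding C_maps_Cinf_iff by (intro exI[of _ 0]) (erule spec)
  have init: "dmode \<xi> (c 0) = dmode \<xi> g0 \<longleftrightarrow> c 0 = g0"
  proof
    assume "dmode \<xi> (c 0) = dmode \<xi> g0"
    from arg_cong[OF this, of "\<lambda>u. fourier_coeff u \<xi>"] show "c 0 = g0"
      by (simp add: fourier_coeff_dmode)
  qed simp
  have pull: "integral {0..T} (\<lambda>t. dmode \<xi> (F t) \<psi> * G t) = fc \<psi> (- \<xi>) * integral {0..T} (\<lambda>t. F t * G t)"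
    if "\<psi> \<in> smooth_torus" for F G \<psi>
  proof -
    have "integral {0..T} (\<lambda>t. dmode \<xi> (F t) \<psi> * G t) = integral {0..T} (\<lambda>t. fc \<psi> (- \<xi>) * (F t * G t))"
      by (rule integral_cong) (simp add: dmode_apply[OF that] mult_ac)
    then show ?thesis by (simp only: integral_mult_right)
  qed
  have weak: "distr_integral T (\<lambda>t. dmode \<xi> (c t)) (\<lambda>t. - (1 / \<i> * time_deriv \<phi> t)) \<psi>
        + distr_integral T (\<lambda>t. spatial_op a2 a1 a0 t (dmode \<xi> (c t))) \<phi> \<psi>
        = distr_integral T (\<lambda>t. dmode \<xi> (f0 t)) \<phi> \<psi> \<longleftrightarrow>
      fc \<psi> (- \<xi>) * (integral {0..T} (\<lambda>t. c t * - (1 / \<i> * time_deriv \<phi> t)) + integral {0..T} (\<lambda>t. symbol a2 a1 a0 \<xi> t * c t * \<phi> t))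
      = fc \<psi> (- \<xi>) * integral {0..T} (\<lambda>t. f0 t * \<phi> t)"
    if \<psi>: "\<psi> \<in> smooth_torus" for \<phi> \<psi>
  proof -
    have "integral {0..T} (\<lambda>t. spatial_op a2 a1 a0 t (dmode \<xi> (c t)) \<psi> * \<phi> t)
        = fc \<psi> (- \<xi>) * integral {0..T} (\<lambda>t. symbol a2 a1 a0 \<xi> t * c t * \<phi> t)"
    proof -
      have "integral {0..T} (\<lambda>t. spatial_op a2 a1 a0 t (dmode \<xi> (c t)) \<psi> * \<phi> t)
          = integral {0..T} (\<lambda>t. fc \<psi> (- \<xi>) * (symbol a2 a1 a0 \<xi> t * c t * \<phi> t))"
        by (rule integral_cong) (simp add: spatial_op_dmode[OF \<psi>] dmode_apply[OF \<psi>] mult_ac)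
      then show ?thesis by (simp only: integral_mult_right)
    qed
    then show ?thesis
      unfolding distr_integral_def pull[OF \<psi>] by (simp only: distrib_left)
  qed
  have one: "fc (fmode (- \<xi>)) (- \<xi>) = 1"
    by (simp add: fc_fmode)
  show ?thesis
  proof
    assume L: ?L
    have "?W \<phi>" if "\<phi> \<in> time_tests T" for \<phi>
      using L[unfolded solves_CP_def, THEN conjunct2, THEN conjunct2, rule_format, OF that fmode_smooth[of "- \<xi>"]]
      unfolding weak[OF fmode_smooth[of "- \<xi>"], of \<phi>] one mult_1 .
    then show "c 0 = g0 \<and> (\<forall>\<phi>\<in>time_tests T. ?W \<phi>)"
      using L unfolding solves_CP_def init by blast
  next
    assume R: "c 0 = g0 \<and> (\<forall>\<phi>\<in>time_tests T. ?W \<phi>)"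
    show ?L
      unfolding solves_CP_def init
    proof (intro conjI ballI cont)
      fix \<phi> and \<psi> :: "real ^ 'n \<Rightarrow> complex"
      assume \<phi>: "\<phi> \<in> time_tests T" and \<psi>: "\<psi> \<in> smooth_torus"
      show "distr_integral T (\<lambda>t. dmode \<xi> (c t)) (\<lambda>t. - (1 / \<i> * time_deriv \<phi> t)) \<psi>
        + distr_integral T (\<lambda>t. spatial_op a2 a1 a0 t (dmode \<xi> (c t))) \<phi> \<psi>
        = distr_integral T (\<lambda>t. dmode \<xi> (f0 t)) \<phi> \<psi>"
        unfolding weak[OF \<psi>] using R \<phi> by (intro arg_cong[of _ _ "(*) (fc \<psi> (- \<xi>))"]) blast
    qed (use R in blast)
  qed
qed

text \<open>The coefficients of the operator depend on time only, so testing with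
  \<open>fmode (- \<xi>)\<close> isolates one frequency.\<close>

lemma solves_CP_project:
  assumes u: "solves_CP T a2 a1 a0 f g u"
  shows "solves_CP T a2 a1 a0 (\<lambda>t. dmode \<xi> (fourier_coeff (f t) \<xi>)) (dmode \<xi> (fourier_coeff g \<xi>))
    (\<lambda>t. dmode \<xi> (fourier_coeff (u t) \<xi>))"
proof -
  obtain \<rho> where \<rho>: "u \<in> C_maps T (sob_top \<rho>)"
    using u unfolding solves_CP_def by blast
  have dist: "u t \<in> distributions" if "t \<in> {0..T}" for t
    using \<rho> that sob_distributions unfolding C_maps_sob_iff by blast
  have "integral {0..T} (\<lambda>t. spatial_op a2 a1 a0 t (u t) (fmode (- \<xi>)) * \<phi> t)
      = integral {0..T} (\<lambda>t. symbol a2 a1 a0 \<xi> t * fourier_coeff (u t) \<xi> * \<phi> t)" for \<phi>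
    by (rule integral_cong) (simp add: spatial_op_fmode dist)
  note op = this
  have init: "u 0 = g"
    using u unfolding solves_CP_def by blast
  show ?thesis
  proof (rule iffD2[OF solves_CP_dmode_iff[OF C_maps_sob_coeff[OF \<rho>]]], intro conjI ballI)
    fix \<phi> assume "\<phi> \<in> time_tests T"
    from u[unfolded solves_CP_def, THEN conjunct2, THEN conjunct2, rule_format, OF this fmode_smooth[of "- \<xi>"]]
    show "integral {0..T} (\<lambda>t. fourier_coeff (u t) \<xi> * - (1 / \<i> * time_deriv \<phi> t))
        + integral {0..T} (\<lambda>t. symbol a2 a1 a0 \<xi> t * fourier_coeff (u t) \<xi> * \<phi> t)
        = integral {0..T} (\<lambda>t. fourier_coeff (f t) \<xi> * \<phi> t)"
      unfolding distr_integral_def op by (simp only: fourier_coeff_fmode)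
  qed (simp add: init)
qed

section \<open>Duhamel's formula for the scalar equation\<close>

definition prim :: "(real \<Rightarrow> complex) \<Rightarrow> real \<Rightarrow> complex" where
  "prim l t = integral {0..t} l"

text \<open>The solution of \<open>c' = - \<i> * l * c + \<i> * f0\<close> with initial value
  \<open>g0\<close>, that is, of \<open>(1 / \<i>) * c' + l * c = f0\<close>.\<close>

definition duhamel :: "(real \<Rightarrow> complex) \<Rightarrow> (real \<Rightarrow> complex) \<Rightarrow> complex \<Rightarrow> real \<Rightarrow> complex" where
  "duhamel l f0 g0 t = exp (- \<i> * prim l t) * (g0 + \<i> * prim (\<lambda>s. exp (\<i> * prim l s) * f0 s) t)"

lemma prim_0 [simp]: "prim l 0 = 0"
  by (simp add: prim_def)

lemma prim_deriv:
  "continuous_on {0..T} l \<Longrightarrow> t \<in> {0..T} \<Longrightarrow> (prim l has_vector_derivative l t) (at t within {0..T})"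
  unfolding prim_def[abs_def] by (rule integral_has_vector_derivative)

lemma prim_continuous: "continuous_on {0..T} l \<Longrightarrow> continuous_on {0..T} (prim l)"
  by (rule continuous_on_vector_derivative[OF prim_deriv])

lemma duhamel_deriv:
  assumes l: "continuous_on {0..T} l" and f0: "continuous_on {0..T} f0" and t: "t \<in> {0..T}"
  shows "(duhamel l f0 g0 has_vector_derivative - \<i> * l t * duhamel l f0 g0 t + \<i> * f0 t) (at t within {0..T})"
proof -
  have cont: "continuous_on {0..T} (\<lambda>s. exp (\<i> * prim l s) * f0 s)"
    by (intro continuous_intros prim_continuous l f0)
  have 1: "((\<lambda>t. exp (- \<i> * prim l t)) has_vector_derivative (- \<i> * l t) * exp (- \<i> * prim l t)) (at t within {0..T})"
  proof -
    have "((\<lambda>t. - \<i> * prim l t) has_vector_derivative - \<i> * l t) (at t within {0..T})"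
      by (intro has_vector_derivative_mult_right prim_deriv l t)
    from field_vector_diff_chain_within[OF this, of exp "exp (- \<i> * prim l t)"]
    show ?thesis
      by (simp add: o_def DERIV_exp has_field_derivative_at_within)
  qed
  have 2: "((\<lambda>t. g0 + \<i> * prim (\<lambda>s. exp (\<i> * prim l s) * f0 s) t) has_vector_derivative
      \<i> * (exp (\<i> * prim l t) * f0 t)) (at t within {0..T})"
    using has_vector_derivative_add[OF has_vector_derivative_const has_vector_derivative_mult_right[OF prim_deriv[OF cont t]], of g0 \<i>]
    by simp
  have e: "exp (- \<i> * prim l t) * exp (\<i> * prim l t) = 1"
    by (simp flip: exp_add)
  have eq: "exp (- \<i> * prim l t) * (\<i> * (exp (\<i> * prim l t) * f0 t))
      + (- \<i> * l t) * exp (- \<i> * prim l t) * (g0 + \<i> * prim (\<lambda>s. exp (\<i> * prim l s) * f0 s) t)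
      = - \<i> * l t * duhamel l f0 g0 t + \<i> * f0 t * (exp (- \<i> * prim l t) * exp (\<i> * prim l t))"
    by (simp add: duhamel_def algebra_simps)
  have "duhamel l f0 g0 = (\<lambda>t. exp (- \<i> * prim l t) * (g0 + \<i> * prim (\<lambda>s. exp (\<i> * prim l s) * f0 s) t))"
    by (rule ext) (rule duhamel_def)
  with has_vector_derivative_mult[OF 1 2, unfolded eq e] show ?thesis
    by (simp only: mult_1_right)
qed

text \<open>The derivative of the solution times \<open>\<phi>\<close> is integrated over the
  interval; the boundary terms vanish because the support of \<open>\<phi>\<close> avoids both
  endpoints.\<close>

lemma duhamel_weak:
  assumes T: "0 < T" and l: "continuous_on {0..T} l" and f0: "continuous_on {0..T} f0" and \<phi>: "\<phi> \<in> time_tests T"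
  shows "integral {0..T} (\<lambda>t. duhamel l f0 g0 t * - (1 / \<i> * time_deriv \<phi> t))
      + integral {0..T} (\<lambda>t. l t * duhamel l f0 g0 t * \<phi> t) = integral {0..T} (\<lambda>t. f0 t * \<phi> t)"
proof -
  let ?c = "duhamel l f0 g0"
  have c: "continuous_on {0..T} ?c"
    by (rule continuous_on_vector_derivative[OF duhamel_deriv[OF l f0]])
  have "(time_deriv ^^ 0) \<phi> differentiable (at t)" "(time_deriv ^^ 1) \<phi> differentiable (at t)" for t
    using \<phi> unfolding time_tests_def by blast+
  then have d0: "\<phi> differentiable (at t)" and d1: "time_deriv \<phi> differentiable (at t)" for t
    by simp_all
  have c0: "continuous_on S \<phi>" and c1: "continuous_on S (time_deriv \<phi>)" for S
    using d0 d1 by (auto intro!: continuous_at_imp_continuous_on differentiable_imp_continuous_within)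
  have zero: "\<phi> 0 = 0" "\<phi> T = 0"
  proof -
    have "{t. \<phi> t \<noteq> 0} \<subseteq> {0<..<T}"
      using \<phi> closure_subset[of "{t. \<phi> t \<noteq> 0}"] unfolding time_tests_def by blast
    then have "0 \<notin> {t. \<phi> t \<noteq> 0}" "T \<notin> {t. \<phi> t \<noteq> 0}"
      by (meson greaterThanLessThan_iff less_irrefl subsetD)+
    then show "\<phi> 0 = 0" "\<phi> T = 0"
      by simp_all
  qed
  note [continuous_intros] = c c0 c1 l f0
  have "((\<lambda>t. ?c t * time_deriv \<phi> t + (- \<i> * l t * ?c t + \<i> * f0 t) * \<phi> t) has_integral ?c T * \<phi> T - ?c 0 * \<phi> 0) {0..T}"
  proof (rule fundamental_theorem_of_calculus)
    fix t assume t: "t \<in> {0..T}"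
    have "(\<phi> has_vector_derivative time_deriv \<phi> t) (at t within {0..T})"
      unfolding time_deriv_def using d0[of t] vector_derivative_works has_vector_derivative_at_within by blast
    then show "((\<lambda>t. ?c t * \<phi> t) has_vector_derivative ?c t * time_deriv \<phi> t + (- \<i> * l t * ?c t + \<i> * f0 t) * \<phi> t) (at t within {0..T})"
      by (rule has_vector_derivative_mult[OF duhamel_deriv[OF l f0 t]])
  qed (use T in simp)
  then have int: "((\<lambda>t. ?c t * time_deriv \<phi> t + (- \<i> * l t * ?c t + \<i> * f0 t) * \<phi> t) has_integral 0) {0..T}"
    by (simp add: zero)
  have "((\<lambda>t. ?c t * - (1 / \<i> * time_deriv \<phi> t)) has_integral integral {0..T} (\<lambda>t. ?c t * - (1 / \<i> * time_deriv \<phi> t))) {0..T}"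
    by (intro integrable_integral integrable_continuous_real continuous_intros) auto
  moreover have "((\<lambda>t. l t * ?c t * \<phi> t) has_integral integral {0..T} (\<lambda>t. l t * ?c t * \<phi> t)) {0..T}"
    by (intro integrable_integral integrable_continuous_real continuous_intros)
  moreover have "((\<lambda>t. f0 t * \<phi> t) has_integral integral {0..T} (\<lambda>t. f0 t * \<phi> t)) {0..T}"
    by (intro integrable_integral integrable_continuous_real continuous_intros)
  ultimately have "((\<lambda>t. (?c t * - (1 / \<i> * time_deriv \<phi> t) + l t * ?c t * \<phi> t) - f0 t * \<phi> t) has_integral
      (integral {0..T} (\<lambda>t. ?c t * - (1 / \<i> * time_deriv \<phi> t)) + integral {0..T} (\<lambda>t. l t * ?c t * \<phi> t))
      - integral {0..T} (\<lambda>t. f0 t * \<phi> t)) {0..T}"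
    by (intro has_integral_diff has_integral_add)
  moreover have "(?c t * - (1 / \<i> * time_deriv \<phi> t) + l t * ?c t * \<phi> t) - f0 t * \<phi> t
      = \<i> * (?c t * time_deriv \<phi> t + (- \<i> * l t * ?c t + \<i> * f0 t) * \<phi> t)" for t
  proof -
    have "c * - (1 / \<i> * p) + k * c * q - f * q = \<i> * (c * p + (- \<i> * k * c + \<i> * f) * q)" for c p k q f :: complex
      by (simp add: algebra_simps)
    then show ?thesis .
  qed
  ultimately have "((\<lambda>t. \<i> * (?c t * time_deriv \<phi> t + (- \<i> * l t * ?c t + \<i> * f0 t) * \<phi> t)) has_integral
      (integral {0..T} (\<lambda>t. ?c t * - (1 / \<i> * time_deriv \<phi> t)) + integral {0..T} (\<lambda>t. l t * ?c t * \<phi> t))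
      - integral {0..T} (\<lambda>t. f0 t * \<phi> t)) {0..T}"
    by (simp only:)
  from has_integral_unique[OF this has_integral_mult_right[OF int]] show ?thesis
    by simp
qed

lemma duhamel_0 [simp]: "duhamel l f0 g0 0 = g0"
  by (simp add: duhamel_def)

section \<open>Growth of the propagator and transfer of well-posedness\<close>

locale cauchy_problem =
  fixes T :: real and a2 a0 :: "real \<Rightarrow> complex" and a1 :: "'n::finite \<Rightarrow> real \<Rightarrow> complex"
  assumes T: "0 < T" and a2: "continuous_on {0..T} a2" and a1: "\<And>j. continuous_on {0..T} (a1 j)"
    and a0: "continuous_on {0..T} a0"
begin

abbreviation mode_symbol :: "int ^ 'n \<Rightarrow> real \<Rightarrow> complex" where
  "mode_symbol \<equiv> symbol a2 a1 a0"

lemma sym_continuous: "continuous_on {0..T} (mode_symbol \<xi>)"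
  by (intro symbol_continuous a2 a1 a0)

text \<open>
  Well-posedness in \<open>X\<close> includes uniqueness; both the projection of a solution to one frequency and
  the Duhamel solution of the corresponding ODE solve the projected problem, hence coincide.
\<close>

lemma fourier_coeff_solution:
  fixes f u :: "real \<Rightarrow> 'n functional"
  assumes wp: "well_posed T a2 a1 a0 X X" and s: "0 < s"
    and sub: "C_maps T (gevrey_top s) \<subseteq> C_maps T X" "gevrey s \<subseteq> topspace X"
    and f: "continuous_on {0..T} (\<lambda>t. fourier_coeff (f t) \<xi>)"
    and u: "solves_CP T a2 a1 a0 f g u" and t: "t \<in> {0..T}"
  shows "fourier_coeff (u t) \<xi> = duhamel (mode_symbol \<xi>) (\<lambda>t. fourier_coeff (f t) \<xi>) (fourier_coeff g \<xi>) t"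
proof -
  let ?f = "\<lambda>t. fourier_coeff (f t) \<xi>"
  let ?c = "duhamel (mode_symbol \<xi>) ?f (fourier_coeff g \<xi>)"
  have c: "continuous_on {0..T} ?c"
    by (rule continuous_on_vector_derivative[OF duhamel_deriv[OF sym_continuous f]])
  obtain \<rho> where \<rho>: "u \<in> C_maps T (sob_top \<rho>)"
    using u unfolding solves_CP_def by blast
  \<comment> \<open>One-frequency data are Gevrey of every positive order, so \<open>sub\<close>
    makes them admissible in \<open>X\<close>.\<close>
  have "(\<lambda>t. dmode \<xi> (?f t)) \<in> C_maps T X" "dmode \<xi> (fourier_coeff g \<xi>) \<in> topspace X"
    using sub C_maps_dmode[OF s f] dmode_gevrey[OF s] by blast+
  then obtain w where w: "\<And>v. v \<in> C_maps T X \<Longrightarrow>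
      solves_CP T a2 a1 a0 (\<lambda>t. dmode \<xi> (?f t)) (dmode \<xi> (fourier_coeff g \<xi>)) v \<Longrightarrow> \<forall>t\<in>{0..T}. v t = w t"
    using wp unfolding well_posed_def by meson
  have "(\<lambda>t. dmode \<xi> (fourier_coeff (u t) \<xi>)) \<in> C_maps T X" "(\<lambda>t. dmode \<xi> (?c t)) \<in> C_maps T X"
    using sub(1) C_maps_dmode[OF s C_maps_sob_coeff[OF \<rho>]] C_maps_dmode[OF s c] by blast+
  moreover have "solves_CP T a2 a1 a0 (\<lambda>t. dmode \<xi> (?f t)) (dmode \<xi> (fourier_coeff g \<xi>)) (\<lambda>t. dmode \<xi> (?c t))"
    unfolding solves_CP_dmode_iff[OF c] using duhamel_weak[OF T sym_continuous f] by simp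
  ultimately have "dmode \<xi> (fourier_coeff (u t) \<xi>) = dmode \<xi> (?c t)"
    using w solves_CP_project[OF u, of \<xi>] t by (metis (no_types, lifting))
  then show ?thesis
    using fourier_coeff_dmode[of \<xi> _ \<xi>] by metis
qed

text \<open>The largest modulus at time \<open>t\<close> of a Duhamel solution with continuous
  right-hand side and data of modulus at most 1: \<open>norm_duhamel_le\<close> bounds it and
  \<open>norm_duhamel_resonant\<close> attains it. The exponentials are the moduli of the propagator
  from time 0 and of its inverse.\<close>

definition growth :: "int ^ 'n \<Rightarrow> real \<Rightarrow> real" where
  "growth \<xi> t = exp (Im (prim (mode_symbol \<xi>) t)) * (1 + integral {0..t} (\<lambda>s. exp (- Im (prim (mode_symbol \<xi>) s))))"

lemma growth_integrand_continuous: "continuous_on {0..T} (\<lambda>s. exp (- Im (prim (mode_symbol \<xi>) s)))"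
  by (intro continuous_intros prim_continuous sym_continuous)

lemma norm_duhamel_le:
  assumes t: "t \<in> {0..T}" and f0: "continuous_on {0..T} f0" "\<And>s. s \<in> {0..T} \<Longrightarrow> cmod (f0 s) \<le> M"
    and g0: "cmod g0 \<le> M"
  shows "cmod (duhamel (mode_symbol \<xi>) f0 g0 t) \<le> M * growth \<xi> t"
proof -
  have sub: "{0..t} \<subseteq> {0..T}" using t by auto
  have "cmod (prim (\<lambda>s. exp (\<i> * prim (mode_symbol \<xi>) s) * f0 s) t) \<le> integral {0..t} (\<lambda>s. M * exp (- Im (prim (mode_symbol \<xi>) s)))"
    unfolding prim_def[of "\<lambda>s. exp (\<i> * prim (mode_symbol \<xi>) s) * f0 s"]
  proof (rule integral_norm_bound_integral)
    show "(\<lambda>s. exp (\<i> * prim (mode_symbol \<xi>) s) * f0 s) integrable_on {0..t}"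
      by (intro integrable_continuous_real continuous_on_subset[OF _ sub] continuous_intros prim_continuous sym_continuous f0(1))
    show "(\<lambda>s. M * exp (- Im (prim (mode_symbol \<xi>) s))) integrable_on {0..t}"
      by (intro integrable_continuous_real continuous_on_subset[OF _ sub] continuous_on_mult_left growth_integrand_continuous)
    show "cmod (exp (\<i> * prim (mode_symbol \<xi>) s) * f0 s) \<le> M * exp (- Im (prim (mode_symbol \<xi>) s))" if "s \<in> {0..t}" for s
      using f0(2)[of s] that sub by (simp add: norm_mult mult.commute subset_iff)
  qed
  also have "\<dots> = M * integral {0..t} (\<lambda>s. exp (- Im (prim (mode_symbol \<xi>) s)))"
    by simp
  finally have "cmod (g0 + \<i> * prim (\<lambda>s. exp (\<i> * prim (mode_symbol \<xi>) s) * f0 s) t)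
      \<le> M * (1 + integral {0..t} (\<lambda>s. exp (- Im (prim (mode_symbol \<xi>) s))))"
    using g0 by (intro order_trans[OF norm_triangle_ineq]) (simp add: norm_mult distrib_left)
  then show ?thesis
    using mult_left_mono[of _ _ "exp (Im (prim (mode_symbol \<xi>) t))"]
    by (simp add: duhamel_def growth_def norm_mult mult.left_commute)
qed

text \<open>
  The phase of the right-hand side cancels the oscillation of the integrand in Duhamel's formula.
\<close>

lemma norm_duhamel_resonant:
  assumes t: "t \<in> {0..T}" and M: "0 \<le> M"
  shows "cmod (duhamel (mode_symbol \<xi>) (\<lambda>s. - \<i> * exp (- \<i> * of_real (Re (prim (mode_symbol \<xi>) s))) * of_real M) (of_real M) t)
    = M * growth \<xi> t"
proof -
  let ?L = "prim (mode_symbol \<xi>)"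
  have sub: "{0..t} \<subseteq> {0..T}" using t by auto
  have "exp (\<i> * ?L s) * (- \<i> * exp (- \<i> * of_real (Re (?L s))) * of_real M) = - \<i> * of_real M * of_real (exp (- Im (?L s)))" for s
  proof -
    have "\<i> * ?L s + - \<i> * of_real (Re (?L s)) = of_real (- Im (?L s))"
      by (simp add: complex_eq_iff)
    then have "exp (\<i> * ?L s) * exp (- \<i> * of_real (Re (?L s))) = of_real (exp (- Im (?L s)))"
      by (simp only: exp_add[symmetric] exp_of_real)
    then show ?thesis
      by (simp add: algebra_simps)
  qed
  moreover have "integral {0..t} (\<lambda>s. complex_of_real (exp (- Im (?L s)))) = of_real (integral {0..t} (\<lambda>s. exp (- Im (?L s))))"
  proof -
    have "(\<lambda>s. exp (- Im (?L s))) integrable_on {0..t}"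
      by (intro integrable_continuous_real continuous_on_subset[OF growth_integrand_continuous sub])
    then have "integral {0..t} (complex_of_real \<circ> (\<lambda>s. exp (- Im (?L s)))) = of_real (integral {0..t} (\<lambda>s. exp (- Im (?L s))))"
      by (rule integral_linear[OF _ bounded_linear_of_real])
    then show ?thesis
      by (simp add: o_def)
  qed
  ultimately have "prim (\<lambda>s. exp (\<i> * ?L s) * (- \<i> * exp (- \<i> * of_real (Re (?L s))) * of_real M)) t
      = - \<i> * of_real M * of_real (integral {0..t} (\<lambda>s. exp (- Im (?L s))))"
    unfolding prim_def[of "\<lambda>s. exp (\<i> * ?L s) * _ s"] by (simp only: integral_mult_right)
  then have "duhamel (mode_symbol \<xi>) (\<lambda>s. - \<i> * exp (- \<i> * of_real (Re (?L s))) * of_real M) (of_real M) t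
      = exp (- \<i> * ?L t) * of_real (M * (1 + integral {0..t} (\<lambda>s. exp (- Im (?L s)))))"
    unfolding duhamel_def by (simp add: algebra_simps)
  moreover have "0 \<le> integral {0..t} (\<lambda>s. exp (- Im (?L s)))"
    by (intro integral_nonneg integrable_continuous_real continuous_on_subset[OF growth_integrand_continuous sub]) simp
  then have "0 \<le> M * (1 + integral {0..t} (\<lambda>s. exp (- Im (?L s))))"
    using M by simp
  ultimately show ?thesis
    by (simp only: norm_mult norm_of_real abs_of_nonneg growth_def norm_exp_eq_Re) (simp add: mult_ac)
qed

text \<open>For the resonant data the coefficients of the solution have modulus exactly
  \<open>gdec s b \<xi> * growth \<xi> t\<close>, and membership in some \<open>sob \<rho>\<close>
  bounds them polynomially. A second factor \<open>gdec s b\<close> absorbs the polynomial, whence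
  \<open>b = a / 2\<close>.\<close>

lemma growth_bound:
  assumes wp: "well_posed T a2 a1 a0 X X" and s: "0 < s"
    and sub: "C_maps T (gevrey_top s) \<subseteq> C_maps T X" "gevrey s \<subseteq> topspace X" and a: "0 < a"
  obtains C where "\<And>t \<xi>. t \<in> {0..T} \<Longrightarrow> growth \<xi> t * gdec s a \<xi> \<le> C"
proof -
  define b where "b = a / 2"
  have b: "0 < b" using a by (simp add: b_def)
  define fh where "fh t \<xi> = - \<i> * exp (- \<i> * of_real (Re (prim (mode_symbol \<xi>) t))) * of_real (gdec s b \<xi>)" for t \<xi>
  define f where "f t = distr_of (fser (fh t))" for t
  define g where "g = distr_of (fser (\<lambda>\<xi>::int ^ 'n. of_real (gdec s b \<xi>)))"
  have nfh: "cmod (fh t \<xi>) \<le> 1 * gdec s b \<xi>" for t \<xi>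
    by (simp add: fh_def norm_mult)
  have rfh: "rapid (fh t)" for t
    by (rule gdec_bound_rapid[OF s b zero_le_one nfh])
  have rg: "rapid (\<lambda>\<xi>::int ^ 'n. of_real (gdec s b \<xi>))"
    by (rule gdec_bound_rapid[OF s b zero_le_one]) simp
  have f: "fourier_coeff (f t) = fh t" "f t \<in> distributions" for t
    using distr_of_fser[OF rfh] by (simp_all add: f_def Cinf_iff)
  have g: "fourier_coeff g = (\<lambda>\<xi>. of_real (gdec s b \<xi>))" "g \<in> distributions"
    using distr_of_fser[OF rg] by (simp_all add: g_def Cinf_iff)
  have cf: "continuous_on {0..T} (\<lambda>t. fourier_coeff (f t) \<xi>)" for \<xi>
    unfolding f fh_def by (intro continuous_intros prim_continuous sym_continuous)
  have "f \<in> C_maps T (gevrey_top s)"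
    using nfh by (intro C_maps_gevreyI[OF s f(2) zero_le_one b _ cf]) (simp add: f)
  moreover have "g \<in> gevrey s"
    unfolding gevrey_iff[OF s] using g b by (intro conjI exI[of _ 1] exI[of _ b]) auto
  ultimately obtain u where u: "solves_CP T a2 a1 a0 f g u"
    using wp sub unfolding well_posed_def by (meson subsetD)
  then obtain \<rho> where \<rho>: "u \<in> C_maps T (sob_top \<rho>)"
    unfolding solves_CP_def by blast
  obtain C where C: "\<And>t \<xi>. t \<in> {0..T} \<Longrightarrow> cmod (fourier_coeff (u t) \<xi>) * jap \<xi> powr \<rho> \<le> C"
    using C_maps_sob_bounded[OF \<rho>] by blast
  \<comment> \<open>An integer exponent at least \<open>- \<rho>\<close>, which is 0 for nonnegative
    \<open>\<rho>\<close>.\<close>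
  define m where "m = nat \<lceil>- \<rho>\<rceil>"
  obtain D where D: "\<And>\<xi>::int ^ 'n. gdec s b \<xi> * jap \<xi> ^ m \<le> D"
    using gdec_decay[OF s b] by blast
  have "growth \<xi> t * gdec s a \<xi> \<le> C * D" if t: "t \<in> {0..T}" for t \<xi>
  proof -
    have "cmod (fourier_coeff (u t) \<xi>) = gdec s b \<xi> * growth \<xi> t"
      unfolding fourier_coeff_solution[OF wp s sub cf u t] f g fh_def
      by (rule norm_duhamel_resonant[OF t]) simp
    then have 1: "gdec s b \<xi> * growth \<xi> t * jap \<xi> powr \<rho> \<le> C"
      using C[OF t, of \<xi>] by simp
    have "jap \<xi> powr (- \<rho>) \<le> jap \<xi> powr real m"
      by (intro powr_mono jap_ge_1) (simp add: m_def, linarith)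
    then have "gdec s b \<xi> * jap \<xi> powr (- \<rho>) \<le> gdec s b \<xi> * jap \<xi> ^ m"
      by (intro mult_left_mono) (simp_all add: powr_realpow)
    then have 2: "gdec s b \<xi> * jap \<xi> powr (- \<rho>) \<le> D"
      using D[of \<xi>] by linarith
    have "0 \<le> C"
      using C[OF t, of \<xi>] by (rule order_trans[rotated]) simp
    then have "(gdec s b \<xi> * growth \<xi> t * jap \<xi> powr \<rho>) * (gdec s b \<xi> * jap \<xi> powr (- \<rho>)) \<le> C * D"
      using 1 2 by (intro mult_mono) auto
    moreover have "(gdec s b \<xi> * growth \<xi> t * jap \<xi> powr \<rho>) * (gdec s b \<xi> * jap \<xi> powr (- \<rho>))
        = growth \<xi> t * (gdec s b \<xi> * gdec s b \<xi>) * (jap \<xi> powr \<rho> * jap \<xi> powr (- \<rho>))"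
      by (simp only: mult_ac)
    moreover have "jap \<xi> powr \<rho> * jap \<xi> powr (- \<rho>) = 1"
      unfolding powr_add[symmetric] by simp
    moreover have "gdec s b \<xi> * gdec s b \<xi> = gdec s a \<xi>"
      unfolding gdec_add[symmetric] by (simp add: b_def)
    ultimately show ?thesis
      by simp
  qed
  then show ?thesis using that by blast
qed

text \<open>The solution in \<open>X\<close> is kept and only its regularity is improved; a
  competitor among Gevrey curves is a competitor in \<open>X\<close>, so uniqueness comes
  along.\<close>

lemma well_posed_gevrey_transfer:
  assumes wp: "well_posed T a2 a1 a0 X X" and s: "0 < s"
    and sub: "C_maps T (gevrey_top s) \<subseteq> C_maps T X" "gevrey s \<subseteq> topspace X"
  shows "well_posed_gevrey T a2 a1 a0 s"
  unfolding well_posed_gevrey_def well_posed_def topspace_gevrey_top[OF s]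
proof (intro ballI)
  fix f :: "real \<Rightarrow> 'n functional" and g :: "'n functional"
  assume f: "f \<in> C_maps T (gevrey_top s)" and g: "g \<in> gevrey s"
  obtain u where u: "solves_CP T a2 a1 a0 f g u"
    and uniq: "\<And>v. v \<in> C_maps T X \<Longrightarrow> solves_CP T a2 a1 a0 f g v \<Longrightarrow> \<forall>t\<in>{0..T}. v t = u t"
    using wp[unfolded well_posed_def, rule_format, OF subsetD[OF sub(1) f] subsetD[OF sub(2) g]] by blast
  obtain \<rho> where \<rho>: "u \<in> C_maps T (sob_top \<rho>)"
    using u unfolding solves_CP_def by blast
  obtain A b where Ab: "0 \<le> A" "0 < b" "\<And>t \<xi>. t \<in> {0..T} \<Longrightarrow> cmod (fourier_coeff (f t) \<xi>) \<le> A * gdec s b \<xi>"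
    using C_maps_gevrey_bounded[OF s f] by blast
  obtain B d where Bd: "0 \<le> B" "0 < d" "\<And>\<xi>. cmod (fourier_coeff g \<xi>) \<le> B * gdec s d \<xi>"
    using g unfolding gevrey_iff[OF s] by blast
  \<comment> \<open>The data decay at the rate \<open>e + e\<close>: one \<open>e\<close> is spent
    on the growth of the propagator, the other remains as the rate of the solution.\<close>
  define e where "e = min b d / 2"
  have e: "0 < e" "e + e \<le> b" "e + e \<le> d"
    using Ab Bd by (auto simp: e_def)
  define K where "K = max A B"
  have K: "0 \<le> K" "A \<le> K" "B \<le> K" using Ab by (auto simp: K_def)
  obtain C0 where C0: "\<And>t \<xi>. t \<in> {0..T} \<Longrightarrow> growth \<xi> t * gdec s e \<xi> \<le> C0"
    using growth_bound[OF wp s sub e(1)] by blast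
  define C where "C = max C0 0"
  have "cmod (fourier_coeff (u t) \<xi>) \<le> K * C * gdec s e \<xi>" if t: "t \<in> {0..T}" for t \<xi>
  proof -
    have "cmod (fourier_coeff (u t) \<xi>) \<le> K * gdec s (e + e) \<xi> * growth \<xi> t"
      unfolding fourier_coeff_solution[OF wp s sub C_maps_gevrey_coeff[OF s f] u t]
    proof (rule norm_duhamel_le[OF t C_maps_gevrey_coeff[OF s f]])
      show "cmod (fourier_coeff (f t') \<xi>) \<le> K * gdec s (e + e) \<xi>" if "t' \<in> {0..T}" for t'
        by (rule order_trans[OF Ab(3)[OF that]]) (intro mult_mono gdec_antimono e K gdec_nonneg)
      show "cmod (fourier_coeff g \<xi>) \<le> K * gdec s (e + e) \<xi>"
        by (rule order_trans[OF Bd(3)]) (intro mult_mono gdec_antimono e K gdec_nonneg)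
    qed
    also have "\<dots> = K * gdec s e \<xi> * (growth \<xi> t * gdec s e \<xi>)"
      unfolding gdec_add by (simp only: mult_ac)
    also have "\<dots> \<le> K * gdec s e \<xi> * C"
      using C0[OF t, of \<xi>] K(1) by (intro mult_left_mono) (auto simp: C_def)
    finally show ?thesis by (simp add: mult_ac)
  qed
  moreover have "u t \<in> distributions" if "t \<in> {0..T}" for t
    using \<rho> that sob_distributions unfolding C_maps_sob_iff by blast
  ultimately have "u \<in> C_maps T (gevrey_top s)"
    by (intro C_maps_gevreyI[OF s _ _ e(1) _ C_maps_sob_coeff[OF \<rho>], of "K * C"]) (simp_all add: K(1) C_def)
  then show "\<exists>u\<in>C_maps T (gevrey_top s). solves_CP T a2 a1 a0 f g u \<and>
      (\<forall>v\<in>C_maps T (gevrey_top s). solves_CP T a2 a1 a0 f g v \<longrightarrow> (\<forall>t\<in>{0..T}. v t = u t))"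
    using u uniq subsetD[OF sub(1)] by blast
qed

end

section \<open>Loss of derivatives, and the combined result\<close>

lemma C_maps_eq:
  assumes "f \<in> C_maps T X" "\<And>t. t \<in> {0..T} \<Longrightarrow> f t = g t"
  shows "g \<in> C_maps T X"
  using assms(1) unfolding C_maps_def mem_Collect_eq
  by (rule continuous_map_eq) (simp add: assms(2))

lemma well_posed_sob_imp_Cinf:
  fixes a1 :: "'n::finite \<Rightarrow> real \<Rightarrow> complex"
  assumes wp: "well_posed_sob T a2 a1 a0 \<delta>"
  shows "well_posed_Cinf T a2 a1 a0"
  unfolding well_posed_Cinf_def well_posed_def topspace_Cinf_top
proof (intro ballI)
  fix f :: "real \<Rightarrow> 'n functional" and g :: "'n functional"
  assume f: "f \<in> C_maps T Cinf_top" and g: "g \<in> Cinf"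
  have "\<exists>u. u \<in> C_maps T (sob_top (r - \<delta>)) \<and> solves_CP T a2 a1 a0 f g u \<and>
      (\<forall>v\<in>C_maps T (sob_top (r - \<delta>)). solves_CP T a2 a1 a0 f g v \<longrightarrow> (\<forall>t\<in>{0..T}. v t = u t))" for r
    using wp f g unfolding well_posed_sob_def well_posed_def C_maps_Cinf_iff Cinf_def topspace_sob_top by blast
  then obtain U where U: "\<And>r. U r \<in> C_maps T (sob_top (r - \<delta>))" "\<And>r. solves_CP T a2 a1 a0 f g (U r)"
    and uniq: "\<And>r v. v \<in> C_maps T (sob_top (r - \<delta>)) \<Longrightarrow> solves_CP T a2 a1 a0 f g v \<Longrightarrow> \<forall>t\<in>{0..T}. v t = U r t"
    by metis
  have eq: "U r t = U 0 t" if "t \<in> {0..T}" for r t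
  proof -
    \<comment> \<open>Both curves lie in the weaker of the two spaces, where the hypothesis at order
      \<open>m\<close> gives uniqueness.\<close>
    define m where "m = min r 0"
    have "U r \<in> C_maps T (sob_top (m - \<delta>))" "U 0 \<in> C_maps T (sob_top (m - \<delta>))"
      by (rule C_maps_sob_mono[OF U(1)], simp add: m_def)+
    then show ?thesis
      using uniq[of _ m] U(2) that by metis
  qed
  have "U 0 \<in> C_maps T Cinf_top"
    unfolding C_maps_Cinf_iff
  proof
    fix r
    \<comment> \<open>Starting from order \<open>r + \<delta>\<close> makes up for the loss.\<close>
    have "U (r + \<delta>) \<in> C_maps T (sob_top r)"
      using U(1)[of "r + \<delta>"] by simp
    then show "U 0 \<in> C_maps T (sob_top r)"
      by (rule C_maps_eq) (rule eq)
  qed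
  moreover have "v \<in> C_maps T (sob_top (0 - \<delta>))" if "v \<in> C_maps T Cinf_top" for v
    using that unfolding C_maps_Cinf_iff by blast
  ultimately show "\<exists>u\<in>C_maps T Cinf_top. solves_CP T a2 a1 a0 f g u \<and>
      (\<forall>v\<in>C_maps T Cinf_top. solves_CP T a2 a1 a0 f g v \<longrightarrow> (\<forall>t\<in>{0..T}. v t = u t))"
    using U(2)[of 0] uniq[of _ 0] by blast
qed

theorem proposition4p2:
  fixes T :: real
    and a2 a0 :: "real \<Rightarrow> complex"
    and a1 :: "'n::finite \<Rightarrow> real \<Rightarrow> complex"
  assumes "T > 0"
    and "continuous_on {0..T} a2"
    and "\<And>j. continuous_on {0..T} (a1 j)"
    and "continuous_on {0..T} a0"
  shows "((\<exists>\<delta>\<ge>0. well_posed_sob T a2 a1 a0 \<delta>) \<longrightarrow> well_posed_Cinf T a2 a1 a0) \<and>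
         (well_posed_Cinf T a2 a1 a0 \<longrightarrow> (\<forall>s\<ge>1. well_posed_gevrey T a2 a1 a0 s)) \<and>
         (\<forall>s1 s2. 1 \<le> s2 \<and> s2 \<le> s1 \<and> well_posed_gevrey T a2 a1 a0 s1
            \<longrightarrow> well_posed_gevrey T a2 a1 a0 s2)"
proof (intro conjI impI allI)
  interpret cauchy_problem T a2 a0 a1
    using assms by unfold_locales
  show "well_posed_Cinf T a2 a1 a0" if "\<exists>\<delta>\<ge>0. well_posed_sob T a2 a1 a0 \<delta>"
    using that well_posed_sob_imp_Cinf by blast
  show "well_posed_gevrey T a2 a1 a0 s" if "well_posed_Cinf T a2 a1 a0" "1 \<le> s" for s
  proof (rule well_posed_gevrey_transfer[of Cinf_top])
    show "0 < s" using that(2) by simp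
    then show "C_maps T (gevrey_top s) \<subseteq> C_maps T (Cinf_top :: 'n functional topology)"
      using C_maps_gevrey_subset_Cinf by blast
    show "gevrey s \<subseteq> topspace Cinf_top"
      unfolding topspace_Cinf_top by (rule gevrey_subset_Cinf)
  qed (use that(1) in \<open>simp add: well_posed_Cinf_def\<close>)
  show "well_posed_gevrey T a2 a1 a0 s2" if s: "1 \<le> s2 \<and> s2 \<le> s1 \<and> well_posed_gevrey T a2 a1 a0 s1" for s1 s2
  proof (rule well_posed_gevrey_transfer[of "gevrey_top s1"])
    have "0 < s2" "s2 \<le> s1" "0 < s1" using s by simp_all
    then show "0 < s2" "C_maps T (gevrey_top s2) \<subseteq> C_maps T (gevrey_top s1 :: 'n functional topology)"
      "gevrey s2 \<subseteq> topspace (gevrey_top s1)"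
      using C_maps_gevrey_mono gevrey_mono topspace_gevrey_top by blast+
  qed (use s in \<open>simp add: well_posed_gevrey_def\<close>)
qed

end
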